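(* The class of rigid conjunctive conic idempotent residuated lattices has the strong amalgamation property.
   Context: A residuated lattice is an algebra $(A,\wedge,\vee,\cdot,\backslash,/,1)$ such that $(A,\wedge,\vee)$ is a lattice, $(A,\cdot,1)$ is a monoid, and $y\le x\backslash z \iff x\cdot y\le z\iff x\le z/y$ for all $x,y,z$. It is idempotent if $x\cdot x=x$ for all $x$, and conic if every $a\in A$ satisfies $a\le 1$ or $1\le a$. Define $x^r:=x\backslash 1$, $x^\ell:=1/x$, $x^\star:=x^\ell\wedge x^r$, $\gamma(x):=x^{\ell r}\wedge x^{r\ell}$ (superscripts are applied from left to right, e.g. $x^{\ell r}=(x^\ell)^r$). A (semi)conic idempotent residuated lattice is rigid if it satisfies $x^r=x^{r\star\star}$ and $x^\ell=x^{\ell\star\star}$, and conjunctive if it satisfies $\gamma(x\wedge y)=\gamma(x)\wedge\gamma(y)$. A class $\mathcal K$ of similar algebras has the strong amalgamation property if for all $\mathbf A,\mathbf B,\mathbf C\in\mathcal K$ and embeddings $f_B\colon\mathbf A\to\mathbf B$, $f_C\colon\mathbf A\to\mathbf C$ there are $\mathbf D\in\mathcal K$ and embeddings $g_B\colon\mathbf B\to\mathbf D$, $g_C\colon\mathbf C\to\mathbf D$ with $g_B\circ f_B=g_C\circ f_C$ and $(g_B\circ f_B)[A]=g_B[B]\cap g_C[C]$. *)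

theory Defs
  imports "HOL-Algebra.Group"
begin

text \<open>
  Algebras in the signature of residuated lattices, over an explicit carrier. Meet and join are
  operations, so that homomorphisms preserve them; the order is derived from the meet.
  \<open>x \<setminus> z\<close> is the left residual (\<open>x\<close> under \<open>z\<close>) and
  \<open>z \<sslash> x\<close> the right residual (\<open>z\<close> over \<open>x\<close>).
\<close>

record 'a residuated_lattice = "'a monoid" +
  meet_op :: "['a, 'a] \<Rightarrow> 'a" (infixl "\<curlywedge>\<index>" 65)
  join_op :: "['a, 'a] \<Rightarrow> 'a" (infixl "\<curlyvee>\<index>" 65)
  under :: "['a, 'a] \<Rightarrow> 'a" (infixl "\<setminus>\<index>" 67)
  over :: "['a, 'a] \<Rightarrow> 'a" (infixl "\<sslash>\<index>" 67)

definition rl_le :: "('a, 'm) residuated_lattice_scheme \<Rightarrow> 'a \<Rightarrow> 'a \<Rightarrow> bool" (infix "\<preceq>\<index>" 50)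
  where "x \<preceq>\<^bsub>A\<^esub> y \<longleftrightarrow> x \<curlywedge>\<^bsub>A\<^esub> y = x"

locale residuated_lattice = monoid A for A (structure) +
  assumes meet_closed: "\<lbrakk>x \<in> carrier A; y \<in> carrier A\<rbrakk> \<Longrightarrow> x \<curlywedge> y \<in> carrier A"
    and join_closed: "\<lbrakk>x \<in> carrier A; y \<in> carrier A\<rbrakk> \<Longrightarrow> x \<curlyvee> y \<in> carrier A"
    and under_closed: "\<lbrakk>x \<in> carrier A; y \<in> carrier A\<rbrakk> \<Longrightarrow> x \<setminus> y \<in> carrier A"
    and over_closed: "\<lbrakk>x \<in> carrier A; y \<in> carrier A\<rbrakk> \<Longrightarrow> x \<sslash> y \<in> carrier A"
    and meet_comm: "\<lbrakk>x \<in> carrier A; y \<in> carrier A\<rbrakk> \<Longrightarrow> x \<curlywedge> y = y \<curlywedge> x"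
    and join_comm: "\<lbrakk>x \<in> carrier A; y \<in> carrier A\<rbrakk> \<Longrightarrow> x \<curlyvee> y = y \<curlyvee> x"
    and meet_assoc: "\<lbrakk>x \<in> carrier A; y \<in> carrier A; z \<in> carrier A\<rbrakk>
      \<Longrightarrow> (x \<curlywedge> y) \<curlywedge> z = x \<curlywedge> (y \<curlywedge> z)"
    and join_assoc: "\<lbrakk>x \<in> carrier A; y \<in> carrier A; z \<in> carrier A\<rbrakk>
      \<Longrightarrow> (x \<curlyvee> y) \<curlyvee> z = x \<curlyvee> (y \<curlyvee> z)"
    and meet_join_absorb: "\<lbrakk>x \<in> carrier A; y \<in> carrier A\<rbrakk> \<Longrightarrow> x \<curlywedge> (x \<curlyvee> y) = x"
    and join_meet_absorb: "\<lbrakk>x \<in> carrier A; y \<in> carrier A\<rbrakk> \<Longrightarrow> x \<curlyvee> (x \<curlywedge> y) = x"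
    and under_residual: "\<lbrakk>x \<in> carrier A; y \<in> carrier A; z \<in> carrier A\<rbrakk>
      \<Longrightarrow> y \<preceq> x \<setminus> z \<longleftrightarrow> x \<otimes> y \<preceq> z"
    and over_residual: "\<lbrakk>x \<in> carrier A; y \<in> carrier A; z \<in> carrier A\<rbrakk>
      \<Longrightarrow> x \<preceq> z \<sslash> y \<longleftrightarrow> x \<otimes> y \<preceq> z"

locale conic_idempotent_residuated_lattice = residuated_lattice A for A (structure) +
  assumes mult_idem: "x \<in> carrier A \<Longrightarrow> x \<otimes> x = x"
    and conic: "x \<in> carrier A \<Longrightarrow> x \<preceq> \<one> \<or> \<one> \<preceq> x"

definition rneg :: "('a, 'm) residuated_lattice_scheme \<Rightarrow> 'a \<Rightarrow> 'a"
  where "rneg A x = x \<setminus>\<^bsub>A\<^esub> \<one>\<^bsub>A\<^esub>"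

definition lneg :: "('a, 'm) residuated_lattice_scheme \<Rightarrow> 'a \<Rightarrow> 'a"
  where "lneg A x = \<one>\<^bsub>A\<^esub> \<sslash>\<^bsub>A\<^esub> x"

definition star :: "('a, 'm) residuated_lattice_scheme \<Rightarrow> 'a \<Rightarrow> 'a"
  where "star A x = lneg A x \<curlywedge>\<^bsub>A\<^esub> rneg A x"

text \<open>
  Superscripts are applied from left to right: \<open>x\<close> to the \<open>lr\<close> is \<open>rneg A (lneg A x)\<close>.
\<close>

definition gamma :: "('a, 'm) residuated_lattice_scheme \<Rightarrow> 'a \<Rightarrow> 'a"
  where "gamma A x = rneg A (lneg A x) \<curlywedge>\<^bsub>A\<^esub> lneg A (rneg A x)"

definition rigid :: "('a, 'm) residuated_lattice_scheme \<Rightarrow> bool"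
  where "rigid A \<longleftrightarrow> (\<forall>x \<in> carrier A.
    rneg A x = star A (star A (rneg A x)) \<and> lneg A x = star A (star A (lneg A x)))"

definition conjunctive :: "('a, 'm) residuated_lattice_scheme \<Rightarrow> bool"
  where "conjunctive A \<longleftrightarrow> (\<forall>x \<in> carrier A. \<forall>y \<in> carrier A.
    gamma A (x \<curlywedge>\<^bsub>A\<^esub> y) = gamma A x \<curlywedge>\<^bsub>A\<^esub> gamma A y)"

definition rigid_conjunctive_conic_idempotent_RLs :: "'a residuated_lattice set"
  where "rigid_conjunctive_conic_idempotent_RLs =
    {A. conic_idempotent_residuated_lattice A \<and> rigid A \<and> conjunctive A}"

definition rl_embedding ::
  "('a, 'm) residuated_lattice_scheme \<Rightarrow> ('b, 'n) residuated_lattice_scheme \<Rightarrow> ('a \<Rightarrow> 'b) \<Rightarrow> bool"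
  where "rl_embedding A B f \<longleftrightarrow>
    f ` carrier A \<subseteq> carrier B \<and> inj_on f (carrier A) \<and>
    f \<one>\<^bsub>A\<^esub> = \<one>\<^bsub>B\<^esub> \<and>
    (\<forall>x \<in> carrier A. \<forall>y \<in> carrier A.
      f (x \<otimes>\<^bsub>A\<^esub> y) = f x \<otimes>\<^bsub>B\<^esub> f y \<and>
      f (x \<curlywedge>\<^bsub>A\<^esub> y) = f x \<curlywedge>\<^bsub>B\<^esub> f y \<and>
      f (x \<curlyvee>\<^bsub>A\<^esub> y) = f x \<curlyvee>\<^bsub>B\<^esub> f y \<and>
      f (x \<setminus>\<^bsub>A\<^esub> y) = f x \<setminus>\<^bsub>B\<^esub> f y \<and>
      f (x \<sslash>\<^bsub>A\<^esub> y) = f x \<sslash>\<^bsub>B\<^esub> f y)"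

text \<open>
  A class of algebras is represented by its members whose carrier is a subset of a universe
  \<open>'u\<close>, up to isomorphism all members of cardinality at most that of \<open>'u\<close>.
  If the class is closed under isomorphisms and subalgebras and \<open>'u\<close> is infinite,
  asking for the amalgam over the same \<open>'u\<close> is no restriction: any amalgam can be cut
  down to the subalgebra generated by the images of \<open>B\<close> and \<open>C\<close>, which again has
  cardinality at most that of \<open>'u\<close>. Over a finite \<open>'u\<close> the amalgam might not fit.
\<close>

definition strong_amalgamation_property :: "'u residuated_lattice set \<Rightarrow> bool"
  where "strong_amalgamation_property K \<longleftrightarrow>
    (\<forall>A \<in> K. \<forall>B \<in> K. \<forall>C \<in> K. \<forall>fB fC.
      rl_embedding A B fB \<and> rl_embedding A C fC \<longrightarrow>
      (\<exists>D \<in> K. \<exists>gB gC.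
        rl_embedding B D gB \<and> rl_embedding C D gC \<and>
        (\<forall>x \<in> carrier A. gB (fB x) = gC (fC x)) \<and>
        (gB \<circ> fB) ` carrier A = gB ` carrier B \<inter> gC ` carrier C))"

end

theory Submission
  imports Defs
begin

text \<open>
  In a conic idempotent residuated lattice the product, and with it both residuals, is determined by the
  lattice, the two negations, and relative pseudocomplements below the unit. Under rigidity and
  conjunctivity the fixed points of \<open>\<gamma>\<close> form a chain, the skeleton, and the algebra is an ordinal sum,
  over the skeleton, of the fibres of \<open>\<gamma>\<close>: lattices with a top, Brouwerian below the unit. The only
  interaction is that if the two negations of an element differ, then they are adjacent and the fibre of
  the larger one is trivial; by rigidity this is visible in every subalgebra containing that negation.
  Hence one can amalgamate the skeletons as chains, amalgamate the fibres separately by filters of both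
  sides that agree on the common part (prime filters for Brouwerian fibres), and reassemble. The algebra
  obtained is finally cut down to the subalgebra generated by the two factors, to fit the universe.
\<close>

section \<open>Conic idempotent residuated lattices\<close>

text \<open>The obstacle is the chain amalgam of the skeletons. Two elements of different factors in
  the same cut of the common part may be ordered either way, but a choice made below the unit
  dictates the choice above it through the negations, and it would be spoiled if a proper element of
  one factor had a negation in the common part. Rigidity excludes the latter: a skeleton element can
  be computed back from either of its negations. Conjunctivity makes the elements that are not below
  a given skeleton element closed under meets, as they are in an ordinal sum over a chain. Two
  representations of fibres occur because the two cones ask for different things. Below the unit a
  residual inside a fibre is a relative pseudocomplement, so implication has to be preserved, and
  distributivity makes prime filters available. Above the unit the residuals depend only on the
  order and the negations; fibres there may fail to be distributive, and prime filters must give way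
  to all filters.\<close>

context residuated_lattice
begin

declare meet_closed [simp] join_closed [simp] under_closed [simp] over_closed [simp]

lemma le_refl: "x \<in> carrier A \<Longrightarrow> x \<preceq> x"
  unfolding rl_le_def by (metis join_closed join_meet_absorb meet_closed meet_join_absorb)

lemma le_antisym: "\<lbrakk>x \<preceq> y; y \<preceq> x; x \<in> carrier A; y \<in> carrier A\<rbrakk> \<Longrightarrow> x = y"
  unfolding rl_le_def by (metis meet_comm)

lemma le_trans:
  "\<lbrakk>x \<preceq> y; y \<preceq> z; x \<in> carrier A; y \<in> carrier A; z \<in> carrier A\<rbrakk> \<Longrightarrow> x \<preceq> z"
  unfolding rl_le_def by (metis meet_assoc)

lemma le_join_iff: "\<lbrakk>x \<in> carrier A; y \<in> carrier A\<rbrakk> \<Longrightarrow> x \<preceq> y \<longleftrightarrow> x \<curlyvee> y = y"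
  unfolding rl_le_def by (metis join_comm join_meet_absorb meet_comm meet_join_absorb)

lemma le_meet_iff:
  assumes "x \<in> carrier A" "y \<in> carrier A" "z \<in> carrier A"
  shows "z \<preceq> x \<curlywedge> y \<longleftrightarrow> z \<preceq> x \<and> z \<preceq> y"
proof -
  have "x \<curlywedge> y \<preceq> x"
    using assms by (metis join_comm join_meet_absorb le_join_iff meet_closed)
  moreover have "x \<curlywedge> y \<preceq> y"
    using assms by (metis join_comm join_meet_absorb le_join_iff meet_closed meet_comm)
  moreover have "z \<preceq> x \<curlywedge> y" if "z \<preceq> x" "z \<preceq> y"
    using that assms by (simp add: rl_le_def flip: meet_assoc)
  ultimately show ?thesis using assms by (blast intro: le_trans meet_closed)
qed

lemma join_upper: "\<lbrakk>x \<in> carrier A; y \<in> carrier A\<rbrakk> \<Longrightarrow> x \<preceq> x \<curlyvee> y"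
  "\<lbrakk>x \<in> carrier A; y \<in> carrier A\<rbrakk> \<Longrightarrow> y \<preceq> x \<curlyvee> y"
  using meet_join_absorb[of x y] meet_join_absorb[of y x]
  by (simp_all add: rl_le_def join_comm)

lemma join_le_iff:
  assumes "x \<in> carrier A" "y \<in> carrier A" "z \<in> carrier A"
  shows "x \<curlyvee> y \<preceq> z \<longleftrightarrow> x \<preceq> z \<and> y \<preceq> z"
proof -
  have "x \<curlyvee> y \<preceq> z" if "x \<preceq> z" "y \<preceq> z"
    using that assms by (simp add: le_join_iff join_assoc)
  then show ?thesis using assms by (blast intro: le_trans join_closed join_upper)
qed

lemma meet_lower: "\<lbrakk>x \<in> carrier A; y \<in> carrier A\<rbrakk> \<Longrightarrow> x \<curlywedge> y \<preceq> x"
  "\<lbrakk>x \<in> carrier A; y \<in> carrier A\<rbrakk> \<Longrightarrow> x \<curlywedge> y \<preceq> y"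
  using le_meet_iff[of x y "x \<curlywedge> y"] le_refl[of "x \<curlywedge> y"] by simp_all

lemma under_eqI:
  assumes "x \<in> carrier A" "z \<in> carrier A" "w \<in> carrier A"
    and "\<And>y. y \<in> carrier A \<Longrightarrow> y \<preceq> w \<longleftrightarrow> x \<otimes> y \<preceq> z"
  shows "x \<setminus> z = w"
proof (rule le_antisym)
  show "x \<setminus> z \<preceq> w"
    using assms le_refl[of "x \<setminus> z"] by (simp add: under_residual)
  show "w \<preceq> x \<setminus> z"
    using assms le_refl[of w] by (simp add: under_residual)
qed (use assms in \<open>simp_all\<close>)

lemma over_eqI:
  assumes "x \<in> carrier A" "z \<in> carrier A" "w \<in> carrier A"
    and "\<And>y. y \<in> carrier A \<Longrightarrow> y \<preceq> w \<longleftrightarrow> y \<otimes> x \<preceq> z"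
  shows "z \<sslash> x = w"
proof (rule le_antisym)
  show "z \<sslash> x \<preceq> w"
    using assms le_refl[of "z \<sslash> x"] by (simp add: over_residual)
  show "w \<preceq> z \<sslash> x"
    using assms le_refl[of w] by (simp add: over_residual)
qed (use assms in \<open>simp_all\<close>)

lemma mult_mono_right:
  assumes "y \<preceq> z" "x \<in> carrier A" "y \<in> carrier A" "z \<in> carrier A"
  shows "x \<otimes> y \<preceq> x \<otimes> z"
proof -
  have "z \<preceq> x \<setminus> (x \<otimes> z)" using assms by (simp add: under_residual le_refl)
  then have "y \<preceq> x \<setminus> (x \<otimes> z)"
    using assms by (intro le_trans[OF assms(1)]) (simp_all)
  then show ?thesis using assms by (simp add: under_residual)
qed

lemma mult_mono_left:
  assumes "x \<preceq> y" "x \<in> carrier A" "y \<in> carrier A" "z \<in> carrier A"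
  shows "x \<otimes> z \<preceq> y \<otimes> z"
proof -
  have "y \<preceq> (y \<otimes> z) \<sslash> z" using assms by (simp add: over_residual le_refl)
  then have "x \<preceq> (y \<otimes> z) \<sslash> z"
    using assms by (intro le_trans[OF assms(1)]) (simp_all)
  then show ?thesis using assms by (simp add: over_residual)
qed

section \<open>The two negations as a Galois connection, and the closure \<gamma>\<close>

lemma rneg_closed [simp]: "x \<in> carrier A \<Longrightarrow> rneg A x \<in> carrier A"
  and lneg_closed [simp]: "x \<in> carrier A \<Longrightarrow> lneg A x \<in> carrier A"
  by (simp_all add: rneg_def lneg_def)

lemma star_closed [simp]: "x \<in> carrier A \<Longrightarrow> star A x \<in> carrier A"
  and gamma_closed [simp]: "x \<in> carrier A \<Longrightarrow> gamma A x \<in> carrier A"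
  by (simp_all add: star_def gamma_def)

lemma le_rneg_iff: "\<lbrakk>x \<in> carrier A; y \<in> carrier A\<rbrakk> \<Longrightarrow> y \<preceq> rneg A x \<longleftrightarrow> x \<otimes> y \<preceq> \<one>"
  and le_lneg_iff: "\<lbrakk>x \<in> carrier A; y \<in> carrier A\<rbrakk> \<Longrightarrow> y \<preceq> lneg A x \<longleftrightarrow> y \<otimes> x \<preceq> \<one>"
  by (simp_all add: rneg_def lneg_def under_residual over_residual)

lemma le_rneg_iff_le_lneg:
  "\<lbrakk>x \<in> carrier A; y \<in> carrier A\<rbrakk> \<Longrightarrow> y \<preceq> rneg A x \<longleftrightarrow> x \<preceq> lneg A y"
  by (simp add: le_rneg_iff le_lneg_iff)

lemma rneg_one: "rneg A \<one> = \<one>" and lneg_one: "lneg A \<one> = \<one>"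
  by (auto simp: rneg_def lneg_def intro!: under_eqI over_eqI)

lemma le_rneg_lneg: "x \<in> carrier A \<Longrightarrow> x \<preceq> rneg A (lneg A x)"
  by (simp add: le_rneg_iff_le_lneg le_refl)

lemma le_lneg_rneg: "x \<in> carrier A \<Longrightarrow> x \<preceq> lneg A (rneg A x)"
  by (simp add: le_refl flip: le_rneg_iff_le_lneg)

lemma rneg_antimono:
  assumes "x \<preceq> y" "x \<in> carrier A" "y \<in> carrier A"
  shows "rneg A y \<preceq> rneg A x"
  using le_trans[OF assms(1) le_lneg_rneg] assms
  by (simp add: le_rneg_iff_le_lneg)

lemma lneg_antimono:
  assumes "x \<preceq> y" "x \<in> carrier A" "y \<in> carrier A"
  shows "lneg A y \<preceq> lneg A x"
  using le_trans[OF assms(1) le_rneg_lneg] assms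
  by (simp flip: le_rneg_iff_le_lneg)

lemma rneg_lneg_rneg: "x \<in> carrier A \<Longrightarrow> rneg A (lneg A (rneg A x)) = rneg A x"
  by (simp add: le_antisym le_lneg_rneg le_rneg_lneg rneg_antimono)

lemma lneg_rneg_lneg: "x \<in> carrier A \<Longrightarrow> lneg A (rneg A (lneg A x)) = lneg A x"
  by (simp add: le_antisym le_lneg_rneg le_rneg_lneg lneg_antimono)

lemma gamma_rneg: "x \<in> carrier A \<Longrightarrow> gamma A (rneg A x) = rneg A x"
  using le_lneg_rneg[of "rneg A x"]
  by (simp add: gamma_def rneg_lneg_rneg flip: rl_le_def)

lemma gamma_lneg: "x \<in> carrier A \<Longrightarrow> gamma A (lneg A x) = lneg A x"
  using le_rneg_lneg[of "lneg A x"]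
  by (simp add: gamma_def lneg_rneg_lneg meet_comm rl_le_def)

lemma le_gamma: "x \<in> carrier A \<Longrightarrow> x \<preceq> gamma A x"
  by (simp add: gamma_def le_meet_iff le_lneg_rneg le_rneg_lneg)

lemma gamma_mono:
  assumes "x \<preceq> y" "x \<in> carrier A" "y \<in> carrier A"
  shows "gamma A x \<preceq> gamma A y"
proof -
  have "rneg A (lneg A x) \<preceq> rneg A (lneg A y)" "lneg A (rneg A x) \<preceq> lneg A (rneg A y)"
    using assms by (simp_all add: lneg_antimono rneg_antimono)
  moreover have "gamma A x \<preceq> rneg A (lneg A x)" "gamma A x \<preceq> lneg A (rneg A x)"
    using assms by (simp_all add: gamma_def meet_lower)
  ultimately have "gamma A x \<preceq> rneg A (lneg A y)" "gamma A x \<preceq> lneg A (rneg A y)"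
    using assms by (blast intro: le_trans gamma_closed lneg_closed rneg_closed)+
  then show ?thesis
    using assms by (simp add: gamma_def[of A y] le_meet_iff)
qed

lemma gamma_one: "gamma A \<one> = \<one>"
  by (metis gamma_rneg one_closed rneg_one)

end

text \<open>Reversing the product exchanges the residuals and the two negations but keeps the
  lattice, \<open>star\<close> and \<gamma>. Interpreting the theory in the opposite algebra gives
  the mirror image of each result.\<close>

definition opposite :: "('a, 'm) residuated_lattice_scheme \<Rightarrow> ('a, 'm) residuated_lattice_scheme"
  where "opposite A = A\<lparr>mult := \<lambda>x y. y \<otimes>\<^bsub>A\<^esub> x,
    under := \<lambda>x z. z \<sslash>\<^bsub>A\<^esub> x, over := \<lambda>z x. x \<setminus>\<^bsub>A\<^esub> z\<rparr>"

lemma opposite_simps [simp]: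
  "carrier (opposite A) = carrier A"
  "x \<otimes>\<^bsub>opposite A\<^esub> y = y \<otimes>\<^bsub>A\<^esub> x"
  "\<one>\<^bsub>opposite A\<^esub> = \<one>\<^bsub>A\<^esub>"
  "x \<curlywedge>\<^bsub>opposite A\<^esub> y = x \<curlywedge>\<^bsub>A\<^esub> y"
  "x \<curlyvee>\<^bsub>opposite A\<^esub> y = x \<curlyvee>\<^bsub>A\<^esub> y"
  "x \<setminus>\<^bsub>opposite A\<^esub> z = z \<sslash>\<^bsub>A\<^esub> x"
  "z \<sslash>\<^bsub>opposite A\<^esub> x = x \<setminus>\<^bsub>A\<^esub> z"
  "rl_le (opposite A) x y = rl_le A x y"
  "rneg (opposite A) x = lneg A x"
  "lneg (opposite A) x = rneg A x"
  by (simp_all add: opposite_def rl_le_def rneg_def lneg_def)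

section \<open>Products by the signs of the factors, and the position of the negations\<close>

context conic_idempotent_residuated_lattice
begin

lemma opposite_conic_idempotent: "conic_idempotent_residuated_lattice (opposite A)"
  by unfold_locales (simp_all add: m_assoc meet_assoc join_assoc meet_join_absorb join_meet_absorb under_residual over_residual mult_idem
    conic, simp_all add: meet_comm join_comm)

text \<open>A product of negative elements lies below both factors; conversely the meet, being
  idempotent, is a product of two lower bounds.\<close>

lemma mult_neg_neg:
  assumes "x \<in> carrier A" "y \<in> carrier A" "x \<preceq> \<one>" "y \<preceq> \<one>"
  shows "x \<otimes> y = x \<curlywedge> y"
proof (rule le_antisym)
  show "x \<otimes> y \<preceq> x \<curlywedge> y"
    using assms mult_mono_left[of x \<one> y] mult_mono_right[of y \<one> x] by (simp add: le_meet_iff)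
  have "(x \<curlywedge> y) \<otimes> (x \<curlywedge> y) \<preceq> x \<otimes> y"
    using assms
    by (intro le_trans[OF mult_mono_left mult_mono_right, of _ x _ y]) (simp_all add: meet_lower)
  then show "x \<curlywedge> y \<preceq> x \<otimes> y" using assms by (simp add: mult_idem)
qed (use assms in \<open>simp_all\<close>)

lemma mult_pos_pos:
  assumes "x \<in> carrier A" "y \<in> carrier A" "\<one> \<preceq> x" "\<one> \<preceq> y"
  shows "x \<otimes> y = x \<curlyvee> y"
proof (rule le_antisym)
  show "x \<curlyvee> y \<preceq> x \<otimes> y"
    using assms mult_mono_left[of \<one> x y] mult_mono_right[of \<one> y x] by (simp add: join_le_iff)
  have "x \<otimes> y \<preceq> (x \<curlyvee> y) \<otimes> (x \<curlyvee> y)"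
    using assms
    by (intro le_trans[OF mult_mono_left mult_mono_right, of _ "x \<curlyvee> y"]) (simp_all add: join_upper)
  then show "x \<otimes> y \<preceq> x \<curlyvee> y" using assms by (simp add: mult_idem)
qed (use assms in \<open>simp_all\<close>)

text \<open>The product \<open>w\<close> lies between \<open>x\<close> and \<open>y\<close>, and
  idempotence gives \<open>x \<otimes> w = w = w \<otimes> y\<close>. If \<open>w\<close> is
  negative, the first product is a meet and equals \<open>x\<close>; if it is positive, the second
  is a join and equals \<open>y\<close>.\<close>

lemma mult_neg_pos:
  assumes "x \<in> carrier A" "y \<in> carrier A" "x \<preceq> \<one>" "\<one> \<preceq> y"
  shows "x \<otimes> y = (if y \<preceq> rneg A x then x else y)"
proof -
  have lo: "x \<preceq> x \<otimes> y" and up: "x \<otimes> y \<preceq> y"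
    using assms mult_mono_left[of x \<one> y] mult_mono_right[of \<one> y x] by simp_all
  show ?thesis
  proof (cases "x \<otimes> y \<preceq> \<one>")
    case True
    have "x \<otimes> y = x \<otimes> (x \<otimes> y)" using assms by (metis m_assoc mult_idem)
    also have "\<dots> = x \<curlywedge> (x \<otimes> y)" using assms True by (simp add: mult_neg_neg)
    also have "\<dots> = x" using lo by (simp add: rl_le_def)
    finally show ?thesis using True assms by (simp add: le_rneg_iff)
  next
    case False
    then have "\<one> \<preceq> x \<otimes> y" using assms conic by blast
    have "x \<otimes> y = (x \<otimes> y) \<otimes> y" using assms by (metis m_assoc mult_idem)
    also have "\<dots> = (x \<otimes> y) \<curlyvee> y" using assms \<open>\<one> \<preceq> x \<otimes> y\<close> by (simp add: mult_pos_pos)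
    also have "\<dots> = y" using up assms le_join_iff by simp
    finally show ?thesis using False assms by (simp add: le_rneg_iff)
  qed
qed

lemma mult_pos_neg:
  assumes "x \<in> carrier A" "y \<in> carrier A" "\<one> \<preceq> x" "y \<preceq> \<one>"
  shows "x \<otimes> y = (if x \<preceq> lneg A y then y else x)"
proof -
  interpret op: conic_idempotent_residuated_lattice "opposite A" by (rule opposite_conic_idempotent)
  show ?thesis using op.mult_neg_pos[of y x] assms by simp
qed

lemma neg_lneg_pos: "\<lbrakk>x \<in> carrier A; x \<preceq> \<one>\<rbrakk> \<Longrightarrow> \<one> \<preceq> lneg A x"
  and neg_rneg_pos: "\<lbrakk>x \<in> carrier A; x \<preceq> \<one>\<rbrakk> \<Longrightarrow> \<one> \<preceq> rneg A x"
  and pos_lneg_neg: "\<lbrakk>x \<in> carrier A; \<one> \<preceq> x\<rbrakk> \<Longrightarrow> lneg A x \<preceq> \<one>"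
  and pos_rneg_neg: "\<lbrakk>x \<in> carrier A; \<one> \<preceq> x\<rbrakk> \<Longrightarrow> rneg A x \<preceq> \<one>"
  using lneg_antimono[of x \<one>] rneg_antimono[of x \<one>] lneg_antimono[of \<one> x] rneg_antimono[of \<one> x]
  by (simp_all add: lneg_one rneg_one)

lemma neg_le_pos:
  "\<lbrakk>x \<preceq> \<one>; \<one> \<preceq> y; x \<in> carrier A; y \<in> carrier A\<rbrakk> \<Longrightarrow> x \<preceq> y"
  using le_trans[of x \<one> y] by simp

lemma below_neg: "\<lbrakk>x \<preceq> y; y \<preceq> \<one>; x \<in> carrier A; y \<in> carrier A\<rbrakk> \<Longrightarrow> x \<preceq> \<one>"
  using le_trans[of x y \<one>] by simp

lemma above_pos: "\<lbrakk>x \<preceq> y; \<one> \<preceq> x; x \<in> carrier A; y \<in> carrier A\<rbrakk> \<Longrightarrow> \<one> \<preceq> y"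
  using le_trans[of \<one> x y] by simp

text \<open>Both comparability of negations with all elements and their near-coincidence are
  consequences of associativity for products of three elements of mixed sign.\<close>

lemma lneg_comparable_neg:
  assumes "p \<in> carrier A" "x \<in> carrier A" "y \<in> carrier A" "\<one> \<preceq> p" "x \<preceq> \<one>" "y \<preceq> \<one>"
    and "x \<preceq> lneg A p" "\<not> y \<preceq> lneg A p"
  shows "x \<preceq> y"
proof -
  have xp: "x \<otimes> p = x" and yp: "y \<otimes> p = p"
    using assms by (simp_all add: mult_neg_pos le_rneg_iff_le_lneg)
  have "x \<curlywedge> y \<preceq> lneg A p"
    using assms by (blast intro: le_trans meet_lower meet_closed lneg_closed)
  moreover have "x \<curlywedge> y \<preceq> \<one>"
    using assms by (blast intro: le_trans meet_lower meet_closed one_closed)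
  ultimately have "(x \<curlywedge> y) \<otimes> p = x \<curlywedge> y"
    using assms by (simp add: mult_neg_pos le_rneg_iff_le_lneg)
  moreover have "(x \<otimes> y) \<otimes> p = x" using assms xp yp by (simp add: m_assoc)
  ultimately show ?thesis using assms by (simp add: mult_neg_neg rl_le_def)
qed

text \<open>Put \<open>r = rneg A p\<close>. Associativity gives
  \<open>p \<otimes> (r \<otimes> x) = x\<close>, where \<open>r \<otimes> x\<close> is the join of
  \<open>r\<close> and \<open>x\<close>. This join is not below \<open>r\<close>, so multiplying it
  by \<open>p\<close> returns the join itself; hence it equals \<open>x\<close>.\<close>

lemma rneg_comparable_pos:
  assumes "p \<in> carrier A" "x \<in> carrier A" "p \<preceq> \<one>" "\<one> \<preceq> x" "\<not> x \<preceq> rneg A p"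
  shows "rneg A p \<preceq> x"
proof -
  have r: "\<one> \<preceq> rneg A p" using assms neg_rneg_pos by blast
  have "p \<otimes> rneg A p = p" "p \<otimes> x = x"
    using assms r by (simp_all add: mult_neg_pos le_refl)
  then have "p \<otimes> (rneg A p \<otimes> x) = x" using assms by (metis m_assoc rneg_closed)
  moreover have "rneg A p \<otimes> x = rneg A p \<curlyvee> x" using assms r by (simp add: mult_pos_pos)
  moreover have "\<not> rneg A p \<curlyvee> x \<preceq> rneg A p"
    using assms by (simp add: join_le_iff)
  moreover have "\<one> \<preceq> rneg A p \<curlyvee> x"
    using assms r above_pos[of x "rneg A p \<curlyvee> x"] by (simp add: join_upper)
  ultimately have "rneg A p \<curlyvee> x = x"
    using assms by (simp add: mult_neg_pos)
  then show ?thesis using assms by (simp add: le_join_iff)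
qed

lemma lneg_comparable:
  assumes "p \<in> carrier A" "x \<in> carrier A"
  shows "x \<preceq> lneg A p \<or> lneg A p \<preceq> x"
proof -
  interpret op: conic_idempotent_residuated_lattice "opposite A" by (rule opposite_conic_idempotent)
  have l: "lneg A p \<in> carrier A" using assms lneg_closed by blast
  show ?thesis
  proof (cases "p \<preceq> \<one>")
    case True
    then show ?thesis
      using assms l op.rneg_comparable_pos[of p x] conic[of x] neg_le_pos[of x "lneg A p"] neg_lneg_pos[of p]
      by auto
  next
    case False
    then have "lneg A p \<preceq> \<one>" "\<one> \<preceq> p" using assms conic pos_lneg_neg by blast+
    then show ?thesis
      using assms l lneg_comparable_neg[of p "lneg A p" x] conic[of x] neg_le_pos[of "lneg A p" x] le_refl[of "lneg A p"]
      by auto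
  qed
qed

lemma rneg_comparable:
  assumes "p \<in> carrier A" "x \<in> carrier A"
  shows "x \<preceq> rneg A p \<or> rneg A p \<preceq> x"
proof -
  interpret op: conic_idempotent_residuated_lattice "opposite A" by (rule opposite_conic_idempotent)
  show ?thesis using op.lneg_comparable[of p x] assms by simp
qed

text \<open>Both bracketings of \<open>x \<otimes> p \<otimes> y\<close> are evaluated. For negative
  \<open>p\<close> and positive \<open>x\<close>, \<open>y\<close> they give
  \<open>x \<otimes> y = y\<close>, a join; for positive \<open>p\<close> and negative
  \<open>x\<close>, \<open>y\<close> they give \<open>x \<otimes> y = x\<close>, a meet. The
  remaining sign patterns are decided by the unit. Thus nothing can lie strictly between the two
  negations of \<open>p\<close>.\<close>

lemma lneg_rneg_adjacent:
  assumes "p \<in> carrier A" "x \<in> carrier A" "y \<in> carrier A" "x \<preceq> lneg A p" "\<not> y \<preceq> rneg A p"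
  shows "x \<preceq> y"
proof (cases "p \<preceq> \<one>")
  case True
  then have y: "\<one> \<preceq> y"
    using assms conic[of y] neg_rneg_pos neg_le_pos[of y "rneg A p"] by auto
  show ?thesis
  proof (cases "x \<preceq> \<one>")
    case False
    then have x: "\<one> \<preceq> x" using assms conic by blast
    have "x \<otimes> p = p" "p \<otimes> y = y"
      using assms x y True by (simp_all add: mult_pos_neg mult_neg_pos)
    then have "x \<otimes> y = y" using assms by (metis m_assoc)
    then show ?thesis using x y assms by (simp add: mult_pos_pos le_join_iff)
  qed (use y assms neg_le_pos in blast)
next
  case False
  then have p: "\<one> \<preceq> p" using assms conic by blast
  then have x: "x \<preceq> \<one>"
    using assms pos_lneg_neg[of p] below_neg[of x "lneg A p"] by simp
  show ?thesis
  proof (cases "\<one> \<preceq> y")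
    case False
    then have y: "y \<preceq> \<one>" using assms conic by blast
    have "x \<otimes> p = x" "p \<otimes> y = p"
      using assms x y p by (simp_all add: mult_pos_neg mult_neg_pos le_rneg_iff_le_lneg)
    then have "x \<otimes> y = x" using assms by (metis m_assoc)
    then show ?thesis using x y assms by (simp add: mult_neg_neg rl_le_def)
  qed (use x assms neg_le_pos in blast)
qed

lemma rneg_lneg_adjacent:
  assumes "p \<in> carrier A" "x \<in> carrier A" "y \<in> carrier A" "x \<preceq> rneg A p" "\<not> y \<preceq> lneg A p"
  shows "x \<preceq> y"
proof -
  interpret op: conic_idempotent_residuated_lattice "opposite A" by (rule opposite_conic_idempotent)
  show ?thesis using op.lneg_rneg_adjacent[of p x y] assms by simp
qed

section \<open>Residuals by the signs of the arguments\<close>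

lemma under_neg_neg:
  assumes "x \<in> carrier A" "z \<in> carrier A" "x \<preceq> z" "z \<preceq> \<one>"
  shows "x \<setminus> z = rneg A x"
proof (rule under_eqI)
  fix y assume y: "y \<in> carrier A"
  have x: "x \<preceq> \<one>" using assms below_neg by blast
  show "y \<preceq> rneg A x \<longleftrightarrow> x \<otimes> y \<preceq> z"
  proof (cases "y \<preceq> \<one>")
    case True
    have "y \<preceq> rneg A x" using True x y assms neg_le_pos neg_rneg_pos by simp
    moreover have "x \<curlywedge> y \<preceq> z"
      using le_trans[OF meet_lower(1)] x y assms by simp
    ultimately show ?thesis using True x y assms by (simp add: mult_neg_neg)
  next
    case False
    then have "\<one> \<preceq> y" "\<not> y \<preceq> z" using y assms conic below_neg by blast+
    then show ?thesis using x y assms by (simp add: mult_neg_pos)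
  qed
qed (use assms in \<open>simp_all\<close>)

text \<open>If \<open>y\<close> is not negative, the product is \<open>x\<close> or \<open>y\<close>
  and the meet is \<open>x\<close>; none of these is below \<open>z\<close>. So inside the negative
  cone the residual is the relative pseudocomplement, the one residual that is not read off from
  order and negations.\<close>

lemma mult_le_neg_iff:
  assumes "x \<in> carrier A" "y \<in> carrier A" "z \<in> carrier A" "x \<preceq> \<one>" "z \<preceq> \<one>" "\<not> x \<preceq> z"
  shows "x \<otimes> y \<preceq> z \<longleftrightarrow> x \<curlywedge> y \<preceq> z"
proof (cases "y \<preceq> \<one>")
  case True
  then show ?thesis using assms by (simp add: mult_neg_neg)
next
  case False
  then have y: "\<one> \<preceq> y" "\<not> y \<preceq> z" using assms conic below_neg by blast+
  then have "x \<preceq> y" using assms neg_le_pos by blast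
  then have "x \<curlywedge> y = x" by (simp add: rl_le_def)
  then show ?thesis using y assms by (simp add: mult_neg_pos)
qed

lemma le_under_neg_iff:
  assumes "x \<in> carrier A" "y \<in> carrier A" "z \<in> carrier A" "x \<preceq> \<one>" "z \<preceq> \<one>" "\<not> x \<preceq> z"
  shows "y \<preceq> x \<setminus> z \<longleftrightarrow> x \<curlywedge> y \<preceq> z"
  using assms mult_le_neg_iff by (simp add: under_residual)

text \<open>The meet condition of \<open>mult_le_neg_iff\<close> is the same in the opposite
  algebra.\<close>

lemma over_eq_under:
  assumes "x \<in> carrier A" "z \<in> carrier A" "x \<preceq> \<one>" "z \<preceq> \<one>" "\<not> x \<preceq> z"
  shows "z \<sslash> x = x \<setminus> z"
proof (rule over_eqI)
  interpret op: conic_idempotent_residuated_lattice "opposite A" by (rule opposite_conic_idempotent)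
  show "y \<preceq> x \<setminus> z \<longleftrightarrow> y \<otimes> x \<preceq> z" if "y \<in> carrier A" for y
    using op.mult_le_neg_iff[of x y z] le_under_neg_iff[of x y z] assms that by simp
qed (use assms in \<open>simp_all\<close>)

lemma under_neg_pos:
  assumes "x \<in> carrier A" "z \<in> carrier A" "x \<preceq> \<one>" "\<one> \<preceq> z"
  shows "x \<setminus> z = rneg A x \<curlyvee> z"
proof (rule under_eqI)
  fix y assume y: "y \<in> carrier A"
  have r: "rneg A x \<in> carrier A" using assms rneg_closed by blast
  \<comment> \<open>\<open>rneg A x\<close> is comparable with \<open>z\<close>, so the join is the
    larger of the two, and being below it is a disjunction.\<close>
  have c: "y \<preceq> rneg A x \<curlyvee> z \<longleftrightarrow> y \<preceq> rneg A x \<or> y \<preceq> z"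
  proof (cases "z \<preceq> rneg A x")
    case True
    then have "rneg A x \<curlyvee> z = rneg A x" using r assms by (metis join_comm le_join_iff)
    then show ?thesis using True y r assms le_trans by metis
  next
    case False
    then have "rneg A x \<preceq> z" using assms rneg_comparable by blast
    then have "rneg A x \<curlyvee> z = z" using r assms by (metis le_join_iff)
    then show ?thesis using \<open>rneg A x \<preceq> z\<close> y r assms le_trans by metis
  qed
  have xz: "x \<preceq> z" using assms neg_le_pos by blast
  show "y \<preceq> rneg A x \<curlyvee> z \<longleftrightarrow> x \<otimes> y \<preceq> z"
  proof (cases "y \<preceq> \<one>")
    case True
    have "y \<preceq> z" using True y assms neg_le_pos by blast
    moreover have "x \<curlywedge> y \<preceq> z"
      using le_trans[OF meet_lower(1) xz] y assms by simp
    ultimately show ?thesis using True y assms c by (simp add: mult_neg_neg)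
  next
    case False
    then have "\<one> \<preceq> y" using y conic by blast
    then show ?thesis using y assms c xz by (simp add: mult_neg_pos)
  qed
qed (use assms in \<open>simp_all\<close>)

lemma under_pos_neg:
  assumes "x \<in> carrier A" "z \<in> carrier A" "\<one> \<preceq> x" "x \<noteq> \<one>" "z \<preceq> \<one>"
  shows "x \<setminus> z = rneg A x \<curlywedge> z"
proof (rule under_eqI)
  fix y assume y: "y \<in> carrier A"
  have x: "\<not> x \<preceq> \<one>" using assms le_antisym by blast
  then have xz: "\<not> x \<preceq> z" using assms below_neg by blast
  have r: "rneg A x \<preceq> \<one>" using assms pos_rneg_neg by blast
  show "y \<preceq> rneg A x \<curlywedge> z \<longleftrightarrow> x \<otimes> y \<preceq> z"
  proof (cases "y \<preceq> \<one>")
    case True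
    then show ?thesis
      using y assms xz by (simp add: mult_pos_neg le_meet_iff le_rneg_iff_le_lneg)
  next
    case False
    then have "\<not> y \<preceq> rneg A x" "\<one> \<preceq> y" using assms y r below_neg[of y "rneg A x"] conic by auto
    then show ?thesis
      using y assms xz by (simp add: mult_pos_pos le_meet_iff join_le_iff)
  qed
qed (use assms in \<open>simp_all\<close>)

lemma under_pos_pos:
  assumes "x \<in> carrier A" "z \<in> carrier A" "\<one> \<preceq> x" "\<one> \<preceq> z"
  shows "x \<setminus> z = (if x \<preceq> z then z else rneg A x)"
proof (rule under_eqI)
  fix y assume y: "y \<in> carrier A"
  have r: "rneg A x \<preceq> \<one>" using assms pos_rneg_neg by blast
  show "y \<preceq> (if x \<preceq> z then z else rneg A x) \<longleftrightarrow> x \<otimes> y \<preceq> z"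
  proof (cases "y \<preceq> \<one>")
    case True
    then have "y \<preceq> z" using y assms neg_le_pos by blast
    then show ?thesis
      using True y assms by (simp add: mult_pos_neg le_rneg_iff_le_lneg)
  next
    case False
    then have "\<not> y \<preceq> rneg A x" "\<one> \<preceq> y" using assms y r below_neg[of y "rneg A x"] conic by auto
    then show ?thesis
      using y assms by (simp add: mult_pos_pos join_le_iff)
  qed
qed (use assms in \<open>simp_all\<close>)

end

text \<open>The sign formulas express every product and every other residual by data that
  \<open>f\<close> preserves, and \<open>f\<close> reflects the order because it is injective.
  Residuals on the other side follow from the opposite algebras, or from
  \<open>over_eq_under\<close> in the case of two negative arguments that are not ordered.\<close>

lemma rl_embeddingI:
  fixes A (structure)
  assumes "conic_idempotent_residuated_lattice A" "conic_idempotent_residuated_lattice D"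
    and im: "f ` carrier A \<subseteq> carrier D" and inj: "inj_on f (carrier A)"
    and one: "f \<one> = \<one>\<^bsub>D\<^esub>"
    and meet: "\<And>x y. \<lbrakk>x \<in> carrier A; y \<in> carrier A\<rbrakk> \<Longrightarrow> f (x \<curlywedge> y) = f x \<curlywedge>\<^bsub>D\<^esub> f y"
    and join: "\<And>x y. \<lbrakk>x \<in> carrier A; y \<in> carrier A\<rbrakk> \<Longrightarrow> f (x \<curlyvee> y) = f x \<curlyvee>\<^bsub>D\<^esub> f y"
    and rneg: "\<And>x. x \<in> carrier A \<Longrightarrow> f (rneg A x) = rneg D (f x)"
    and lneg: "\<And>x. x \<in> carrier A \<Longrightarrow> f (lneg A x) = lneg D (f x)"
    and under: "\<And>x z. \<lbrakk>x \<in> carrier A; z \<in> carrier A; x \<preceq> \<one>; z \<preceq> \<one>; \<not> x \<preceq> z\<rbrakk>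
      \<Longrightarrow> f (x \<setminus> z) = f x \<setminus>\<^bsub>D\<^esub> f z"
  shows "rl_embedding A D f"
proof -
  interpret A: conic_idempotent_residuated_lattice A by fact
  interpret D: conic_idempotent_residuated_lattice D by fact
  interpret oA: conic_idempotent_residuated_lattice "opposite A" by (rule A.opposite_conic_idempotent)
  interpret oD: conic_idempotent_residuated_lattice "opposite D" by (rule D.opposite_conic_idempotent)
  have cl: "f x \<in> carrier D" if "x \<in> carrier A" for x using im that by blast
  have le: "x \<preceq> y \<longleftrightarrow> f x \<preceq>\<^bsub>D\<^esub> f y" if "x \<in> carrier A" "y \<in> carrier A" for x y
    using inj_on_eq_iff[OF inj, of "x \<curlywedge> y" x] that by (simp add: rl_le_def meet)
  have le1: "x \<preceq> \<one> \<longleftrightarrow> f x \<preceq>\<^bsub>D\<^esub> \<one>\<^bsub>D\<^esub>" "\<one> \<preceq> x \<longleftrightarrow> \<one>\<^bsub>D\<^esub> \<preceq>\<^bsub>D\<^esub> f x"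
    if "x \<in> carrier A" for x
    using le[of x "\<one>"] le[of "\<one>" x] that one by simp_all
  have ne1: "x \<noteq> \<one> \<longleftrightarrow> f x \<noteq> \<one>\<^bsub>D\<^esub>" if "x \<in> carrier A" for x
    using that one inj by (metis A.one_closed inj_onD)
  have ler: "y \<preceq> rneg A x \<longleftrightarrow> f y \<preceq>\<^bsub>D\<^esub> rneg D (f x)"
    "y \<preceq> lneg A x \<longleftrightarrow> f y \<preceq>\<^bsub>D\<^esub> lneg D (f x)" if "x \<in> carrier A" "y \<in> carrier A" for x y
    using that by (simp_all add: le rneg lneg)
  have mult: "f (x \<otimes> y) = f x \<otimes>\<^bsub>D\<^esub> f y" if xy: "x \<in> carrier A" "y \<in> carrier A" for x y
  proof -
    note xy' = xy cl[OF xy(1)] cl[OF xy(2)] le1[OF xy(1)] le1[OF xy(2)] ler[OF xy] ler[OF xy(2,1)]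
    consider "x \<preceq> \<one>" "y \<preceq> \<one>" | "x \<preceq> \<one>" "\<one> \<preceq> y"
      | "\<one> \<preceq> x" "y \<preceq> \<one>" | "\<one> \<preceq> x" "\<one> \<preceq> y"
      using A.conic xy by blast
    then show ?thesis
      by cases (use xy' in \<open>simp_all add: A.mult_neg_neg D.mult_neg_neg A.mult_neg_pos D.mult_neg_pos
        A.mult_pos_neg D.mult_pos_neg A.mult_pos_pos D.mult_pos_pos meet join\<close>)
  qed
  have res: "f (x \<setminus> z) = f x \<setminus>\<^bsub>D\<^esub> f z \<and> f (z \<sslash> x) = f z \<sslash>\<^bsub>D\<^esub> f x"
    if xz: "x \<in> carrier A" "z \<in> carrier A" for x z
  proof -
    note xz' = xz cl[OF xz(1)] cl[OF xz(2)] le1[OF xz(1)] le1[OF xz(2)] le[OF xz] ne1[OF xz(1)]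
      rneg lneg meet join under A.rneg_closed A.lneg_closed
    consider "x \<preceq> \<one>" "z \<preceq> \<one>" "x \<preceq> z" | "x \<preceq> \<one>" "z \<preceq> \<one>" "\<not> x \<preceq> z"
      | "x \<preceq> \<one>" "\<one> \<preceq> z" | "x \<noteq> \<one>" "\<one> \<preceq> x" "z \<preceq> \<one>"
      | "\<one> \<preceq> x" "\<one> \<preceq> z"
      using A.conic[OF xz(1)] A.conic[OF xz(2)] A.le_refl[OF A.one_closed] by blast
    then show ?thesis
    proof cases
      case 1
      then show ?thesis
        using xz' A.under_neg_neg[of x z] D.under_neg_neg[of "f x" "f z"]
          oA.under_neg_neg[of x z] oD.under_neg_neg[of "f x" "f z"] by simp
    next
      case 2
      then show ?thesis
        using xz' A.over_eq_under[of x z] D.over_eq_under[of "f x" "f z"] by simp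
    next
      case 3
      then show ?thesis
        using xz' A.under_neg_pos[of x z] D.under_neg_pos[of "f x" "f z"]
          oA.under_neg_pos[of x z] oD.under_neg_pos[of "f x" "f z"] by simp
    next
      case 4
      then show ?thesis
        using xz' A.under_pos_neg[of x z] D.under_pos_neg[of "f x" "f z"]
          oA.under_pos_neg[of x z] oD.under_pos_neg[of "f x" "f z"] by simp
    next
      case 5
      then show ?thesis
        using xz' A.under_pos_pos[of x z] D.under_pos_pos[of "f x" "f z"]
          oA.under_pos_pos[of x z] oD.under_pos_pos[of "f x" "f z"] by simp
    qed
  qed
  show ?thesis
    unfolding rl_embedding_def using im inj by (simp add: one mult meet join res)
qed

section \<open>Construction from a lattice with two negations\<close>

text \<open>\<open>ls\<close> and \<open>rs\<close> are the two negations.\<close>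

locale negation_lattice =
  fixes L :: "'d set" and le :: "'d \<Rightarrow> 'd \<Rightarrow> bool" (infix "\<sqsubseteq>" 50)
    and e :: 'd and ls rs :: "'d \<Rightarrow> 'd"
  assumes refl: "x \<in> L \<Longrightarrow> x \<sqsubseteq> x"
    and antisym: "\<lbrakk>x \<sqsubseteq> y; y \<sqsubseteq> x; x \<in> L; y \<in> L\<rbrakk> \<Longrightarrow> x = y"
    and trans: "\<lbrakk>x \<sqsubseteq> y; y \<sqsubseteq> z; x \<in> L; y \<in> L; z \<in> L\<rbrakk> \<Longrightarrow> x \<sqsubseteq> z"
    and glb_ex: "\<lbrakk>x \<in> L; y \<in> L\<rbrakk> \<Longrightarrow> \<exists>w. w \<in> L \<and> (\<forall>z\<in>L. z \<sqsubseteq> w \<longleftrightarrow> z \<sqsubseteq> x \<and> z \<sqsubseteq> y)"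
    and lub_ex: "\<lbrakk>x \<in> L; y \<in> L\<rbrakk> \<Longrightarrow> \<exists>w. w \<in> L \<and> (\<forall>z\<in>L. w \<sqsubseteq> z \<longleftrightarrow> x \<sqsubseteq> z \<and> y \<sqsubseteq> z)"
    and e_closed: "e \<in> L"
    and ls_closed: "x \<in> L \<Longrightarrow> ls x \<in> L" and rs_closed: "x \<in> L \<Longrightarrow> rs x \<in> L"
    and ls_e: "ls e = e" and rs_e: "rs e = e"
    and conic: "x \<in> L \<Longrightarrow> x \<sqsubseteq> e \<or> e \<sqsubseteq> x"
    and galois: "\<lbrakk>x \<in> L; y \<in> L\<rbrakk> \<Longrightarrow> y \<sqsubseteq> rs x \<longleftrightarrow> x \<sqsubseteq> ls y"
    and ls_comparable: "\<lbrakk>p \<in> L; x \<in> L\<rbrakk> \<Longrightarrow> x \<sqsubseteq> ls p \<or> ls p \<sqsubseteq> x"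
    and rs_comparable: "\<lbrakk>p \<in> L; x \<in> L\<rbrakk> \<Longrightarrow> x \<sqsubseteq> rs p \<or> rs p \<sqsubseteq> x"
    and ls_irreducible: "\<lbrakk>p \<in> L; x \<in> L; y \<in> L; \<not> x \<sqsubseteq> ls p; \<not> y \<sqsubseteq> ls p\<rbrakk>
      \<Longrightarrow> \<exists>z\<in>L. z \<sqsubseteq> x \<and> z \<sqsubseteq> y \<and> \<not> z \<sqsubseteq> ls p"
    and rs_irreducible: "\<lbrakk>p \<in> L; x \<in> L; y \<in> L; \<not> x \<sqsubseteq> rs p; \<not> y \<sqsubseteq> rs p\<rbrakk>
      \<Longrightarrow> \<exists>z\<in>L. z \<sqsubseteq> x \<and> z \<sqsubseteq> y \<and> \<not> z \<sqsubseteq> rs p"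
    and ls_rs_adjacent: "\<lbrakk>p \<in> L; x \<in> L; y \<in> L; x \<sqsubseteq> ls p; \<not> y \<sqsubseteq> rs p\<rbrakk> \<Longrightarrow> x \<sqsubseteq> y"
    and rs_ls_adjacent: "\<lbrakk>p \<in> L; x \<in> L; y \<in> L; x \<sqsubseteq> rs p; \<not> y \<sqsubseteq> ls p\<rbrakk> \<Longrightarrow> x \<sqsubseteq> y"
    and rpc_ex: "\<lbrakk>x \<in> L; z \<in> L; x \<sqsubseteq> e; z \<sqsubseteq> e; \<not> x \<sqsubseteq> z\<rbrakk>
      \<Longrightarrow> \<exists>w. w \<in> L \<and> (\<forall>y\<in>L. y \<sqsubseteq> w \<longleftrightarrow> (\<forall>u\<in>L. u \<sqsubseteq> x \<and> u \<sqsubseteq> y \<longrightarrow> u \<sqsubseteq> z))"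
begin

declare e_closed [simp] ls_closed [simp] rs_closed [simp]

definition glb :: "'d \<Rightarrow> 'd \<Rightarrow> 'd"
  where "glb x y = (SOME w. w \<in> L \<and> (\<forall>z\<in>L. z \<sqsubseteq> w \<longleftrightarrow> z \<sqsubseteq> x \<and> z \<sqsubseteq> y))"

definition lub :: "'d \<Rightarrow> 'd \<Rightarrow> 'd"
  where "lub x y = (SOME w. w \<in> L \<and> (\<forall>z\<in>L. w \<sqsubseteq> z \<longleftrightarrow> x \<sqsubseteq> z \<and> y \<sqsubseteq> z))"

text \<open>The formulas \<open>mult_neg_neg\<close>, \<open>mult_neg_pos\<close>,
  \<open>mult_pos_neg\<close> and \<open>mult_pos_pos\<close> leave no other choice. The unit is
  counted as negative.\<close>

definition prd :: "'d \<Rightarrow> 'd \<Rightarrow> 'd"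
  where "prd x y =
    (if x \<sqsubseteq> e then if y \<sqsubseteq> e then glb x y else if y \<sqsubseteq> rs x then x else y
     else if y \<sqsubseteq> e then if x \<sqsubseteq> ls y then y else x else lub x y)"

definition alg :: "'d residuated_lattice"
  where "alg = \<lparr>carrier = L, mult = prd, one = e, meet_op = glb, join_op = lub,
    under = \<lambda>x z. SOME w. w \<in> L \<and> (\<forall>y\<in>L. y \<sqsubseteq> w \<longleftrightarrow> prd x y \<sqsubseteq> z),
    over = \<lambda>z x. SOME w. w \<in> L \<and> (\<forall>y\<in>L. y \<sqsubseteq> w \<longleftrightarrow> prd y x \<sqsubseteq> z)\<rparr>"

lemma alg_simps [simp]:
  "carrier alg = L" "mult alg = prd" "one alg = e" "meet_op alg = glb" "join_op alg = lub"
  by (simp_all add: alg_def)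

lemma glb: "\<lbrakk>x \<in> L; y \<in> L\<rbrakk> \<Longrightarrow> glb x y \<in> L \<and> (\<forall>z\<in>L. z \<sqsubseteq> glb x y \<longleftrightarrow> z \<sqsubseteq> x \<and> z \<sqsubseteq> y)"
  unfolding glb_def by (rule someI_ex) (rule glb_ex)

lemma lub: "\<lbrakk>x \<in> L; y \<in> L\<rbrakk> \<Longrightarrow> lub x y \<in> L \<and> (\<forall>z\<in>L. lub x y \<sqsubseteq> z \<longleftrightarrow> x \<sqsubseteq> z \<and> y \<sqsubseteq> z)"
  unfolding lub_def by (rule someI_ex) (rule lub_ex)

lemma glb_closed [simp]: "\<lbrakk>x \<in> L; y \<in> L\<rbrakk> \<Longrightarrow> glb x y \<in> L"
  and lub_closed [simp]: "\<lbrakk>x \<in> L; y \<in> L\<rbrakk> \<Longrightarrow> lub x y \<in> L"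
  and le_glb_iff: "\<lbrakk>x \<in> L; y \<in> L; z \<in> L\<rbrakk> \<Longrightarrow> z \<sqsubseteq> glb x y \<longleftrightarrow> z \<sqsubseteq> x \<and> z \<sqsubseteq> y"
  and lub_le_iff: "\<lbrakk>x \<in> L; y \<in> L; z \<in> L\<rbrakk> \<Longrightarrow> lub x y \<sqsubseteq> z \<longleftrightarrow> x \<sqsubseteq> z \<and> y \<sqsubseteq> z"
  using glb lub by simp_all

lemma eq_if_same_lower:
  assumes "x \<in> L" "y \<in> L" "\<And>z. z \<in> L \<Longrightarrow> z \<sqsubseteq> x \<longleftrightarrow> z \<sqsubseteq> y"
  shows "x = y"
  using assms refl antisym by blast

lemma eq_if_same_upper:
  assumes "x \<in> L" "y \<in> L" "\<And>z. z \<in> L \<Longrightarrow> x \<sqsubseteq> z \<longleftrightarrow> y \<sqsubseteq> z"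
  shows "x = y"
  using assms refl antisym by blast

lemma glb_comm: "\<lbrakk>x \<in> L; y \<in> L\<rbrakk> \<Longrightarrow> glb x y = glb y x"
  by (rule eq_if_same_lower) (auto simp: le_glb_iff)

lemma lub_comm: "\<lbrakk>x \<in> L; y \<in> L\<rbrakk> \<Longrightarrow> lub x y = lub y x"
  by (rule eq_if_same_upper) (auto simp: lub_le_iff)

lemma glb_assoc: "\<lbrakk>x \<in> L; y \<in> L; z \<in> L\<rbrakk> \<Longrightarrow> glb (glb x y) z = glb x (glb y z)"
  by (rule eq_if_same_lower) (auto simp: le_glb_iff)

lemma lub_assoc: "\<lbrakk>x \<in> L; y \<in> L; z \<in> L\<rbrakk> \<Longrightarrow> lub (lub x y) z = lub x (lub y z)"
  by (rule eq_if_same_upper) (auto simp: lub_le_iff)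

lemma glb_lower: "\<lbrakk>x \<in> L; y \<in> L\<rbrakk> \<Longrightarrow> glb x y \<sqsubseteq> x" "\<lbrakk>x \<in> L; y \<in> L\<rbrakk> \<Longrightarrow> glb x y \<sqsubseteq> y"
  using le_glb_iff[of x y "glb x y"] by (simp_all add: refl)

lemma lub_upper: "\<lbrakk>x \<in> L; y \<in> L\<rbrakk> \<Longrightarrow> x \<sqsubseteq> lub x y" "\<lbrakk>x \<in> L; y \<in> L\<rbrakk> \<Longrightarrow> y \<sqsubseteq> lub x y"
  using lub_le_iff[of x y "lub x y"] by (simp_all add: refl)

lemma glb_absorb: "\<lbrakk>x \<in> L; y \<in> L; x \<sqsubseteq> y\<rbrakk> \<Longrightarrow> glb x y = x"
  by (rule eq_if_same_lower) (auto simp: le_glb_iff intro: trans)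

lemma lub_absorb: "\<lbrakk>x \<in> L; y \<in> L; x \<sqsubseteq> y\<rbrakk> \<Longrightarrow> lub x y = y"
  by (rule eq_if_same_upper) (auto simp: lub_le_iff intro: trans)

lemma rl_le_alg [simp]: "\<lbrakk>x \<in> L; y \<in> L\<rbrakk> \<Longrightarrow> rl_le alg x y \<longleftrightarrow> x \<sqsubseteq> y"
  unfolding rl_le_def using glb_lower(2) glb_absorb by fastforce

lemma prd_closed [simp]: "\<lbrakk>x \<in> L; y \<in> L\<rbrakk> \<Longrightarrow> prd x y \<in> L"
  by (simp add: prd_def)

text \<open>The assumptions are symmetric in the two negations up to the direction of the Galois
  connection. By \<open>dual_prd\<close> the exchange reverses the product, so mirrored cases of
  associativity and the second residual come from the first.\<close>

lemma dual: "negation_lattice L le e rs ls"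
proof
  show "y \<sqsubseteq> ls x \<longleftrightarrow> x \<sqsubseteq> rs y" if "x \<in> L" "y \<in> L" for x y
    using galois[of y x] that by simp
qed (fact refl antisym trans glb_ex lub_ex e_closed ls_closed rs_closed ls_e rs_e conic
    ls_comparable rs_comparable ls_irreducible rs_irreducible ls_rs_adjacent rs_ls_adjacent rpc_ex)+

lemma dual_prd:
  assumes "x \<in> L" "y \<in> L"
  shows "negation_lattice.prd L le e rs ls x y = prd y x"
proof -
  interpret d: negation_lattice L le e rs ls by (rule dual)
  show ?thesis using assms by (simp add: prd_def d.prd_def glb_comm lub_comm)
qed

lemma rs_antimono: "\<lbrakk>x \<sqsubseteq> y; x \<in> L; y \<in> L\<rbrakk> \<Longrightarrow> rs y \<sqsubseteq> rs x"
  by (metis galois ls_closed refl rs_closed trans)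

lemma pos_if: "\<lbrakk>x \<in> L; \<not> x \<sqsubseteq> e\<rbrakk> \<Longrightarrow> e \<sqsubseteq> x"
  using conic by blast

lemma not_neg_lub: "\<lbrakk>x \<in> L; y \<in> L; \<not> x \<sqsubseteq> e\<rbrakk> \<Longrightarrow> \<not> lub x y \<sqsubseteq> e"
  "\<lbrakk>x \<in> L; y \<in> L; \<not> y \<sqsubseteq> e\<rbrakk> \<Longrightarrow> \<not> lub x y \<sqsubseteq> e"
  by (simp_all add: lub_le_iff)

lemma neg_glb: "\<lbrakk>x \<in> L; y \<in> L; x \<sqsubseteq> e\<rbrakk> \<Longrightarrow> glb x y \<sqsubseteq> e"
  by (rule trans[OF glb_lower(1)]) (simp_all)

lemma neg_le_pos: "\<lbrakk>x \<sqsubseteq> e; e \<sqsubseteq> y; x \<in> L; y \<in> L\<rbrakk> \<Longrightarrow> x \<sqsubseteq> y"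
  using trans e_closed by blast

lemma neg_le_notneg: "\<lbrakk>x \<sqsubseteq> e; \<not> y \<sqsubseteq> e; x \<in> L; y \<in> L\<rbrakk> \<Longrightarrow> x \<sqsubseteq> y"
  using neg_le_pos pos_if by blast

text \<open>Whether a negative factor survives multiplication by \<open>z\<close> depends on whether
  it is below \<open>ls z\<close>. If exactly one of \<open>x\<close>, \<open>y\<close> is below it,
  comparability makes that one the meet. If neither is, the meet is not below either, which is what
  \<open>ls_irreducible\<close> provides.\<close>

lemma assoc_nnp:
  assumes L: "x \<in> L" "y \<in> L" "z \<in> L" and s: "x \<sqsubseteq> e" "y \<sqsubseteq> e" "\<not> z \<sqsubseteq> e"
  shows "prd (prd x y) z = prd x (prd y z)"
proof -
  note g = glb_closed[OF L(1,2)]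
  have n: "glb x y \<sqsubseteq> e" using neg_glb L s by blast
  show ?thesis
  proof (cases "z \<sqsubseteq> rs y")
    case True
    then have "z \<sqsubseteq> rs (glb x y)"
      using L g trans[OF True rs_antimono[OF glb_lower(2)]] by simp
    then show ?thesis using True L s n g by (simp add: prd_def)
  next
    case y: False
    show ?thesis
    proof (cases "z \<sqsubseteq> rs x")
      case True
      then have "z \<sqsubseteq> rs (glb x y)"
        using L g trans[OF True rs_antimono[OF glb_lower(1)]] by simp
      moreover have "x \<sqsubseteq> y"
        using True y L ls_comparable[of z y] trans[of x "ls z" y] by (auto simp: galois)
      ultimately show ?thesis using True y L s n g by (simp add: prd_def glb_absorb)
    next
      case False
      then have "\<not> glb x y \<sqsubseteq> ls z"
        using y L g ls_irreducible[of z x y] trans[of _ "glb x y" "ls z"]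
        by (auto simp: galois le_glb_iff)
      then show ?thesis using False y L s n g by (simp add: prd_def galois)
    qed
  qed
qed

lemma assoc_npp:
  assumes L: "x \<in> L" "y \<in> L" "z \<in> L" and s: "x \<sqsubseteq> e" "\<not> y \<sqsubseteq> e" "\<not> z \<sqsubseteq> e"
  shows "prd (prd x y) z = prd x (prd y z)"
proof -
  note n = not_neg_lub(1)[OF L(2,3) s(2)]
  have le: "lub y z \<sqsubseteq> rs x \<longleftrightarrow> y \<sqsubseteq> rs x \<and> z \<sqsubseteq> rs x" using L by (simp add: lub_le_iff)
  show ?thesis
  proof (cases "y \<sqsubseteq> rs x \<and> \<not> z \<sqsubseteq> rs x")
    case True
    then have "y \<sqsubseteq> z"
      using L rs_comparable[of x z] trans[of y "rs x" z] by auto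
    then show ?thesis using True L s n le by (simp add: prd_def lub_absorb)
  next
    case False
    then show ?thesis using L s n le by (auto simp: prd_def)
  qed
qed

text \<open>With factors of alternating sign the two bracketings can select different outer factors.
  They then agree only because adjacency of \<open>ls y\<close> and \<open>rs y\<close> orders
  \<open>x\<close> and \<open>z\<close>, so these assumptions are the converse of
  \<open>lneg_rneg_adjacent\<close> and \<open>rneg_lneg_adjacent\<close>.\<close>

lemma assoc_npn:
  assumes L: "x \<in> L" "y \<in> L" "z \<in> L" and s: "x \<sqsubseteq> e" "\<not> y \<sqsubseteq> e" "z \<sqsubseteq> e"
  shows "prd (prd x y) z = prd x (prd y z)"
proof -
  have "z \<sqsubseteq> x" if "z \<sqsubseteq> rs y" "\<not> x \<sqsubseteq> ls y" using that L rs_ls_adjacent by blast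
  moreover have "x \<sqsubseteq> z" if "x \<sqsubseteq> ls y" "\<not> z \<sqsubseteq> rs y" using that L ls_rs_adjacent by blast
  ultimately show ?thesis
    using L s by (auto simp: prd_def galois glb_absorb glb_comm[of x z])
qed

lemma assoc_pnp:
  assumes L: "x \<in> L" "y \<in> L" "z \<in> L" and s: "\<not> x \<sqsubseteq> e" "y \<sqsubseteq> e" "\<not> z \<sqsubseteq> e"
  shows "prd (prd x y) z = prd x (prd y z)"
proof -
  have "z \<sqsubseteq> x" if "z \<sqsubseteq> rs y" "\<not> x \<sqsubseteq> ls y" using that L rs_ls_adjacent by blast
  moreover have "x \<sqsubseteq> z" if "x \<sqsubseteq> ls y" "\<not> z \<sqsubseteq> rs y" using that L ls_rs_adjacent by blast
  ultimately show ?thesis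
    using L s by (auto simp: prd_def lub_absorb lub_comm[of x z])
qed

lemma prd_assoc:
  assumes L: "x \<in> L" "y \<in> L" "z \<in> L"
  shows "prd (prd x y) z = prd x (prd y z)"
proof -
  interpret d: negation_lattice L le e rs ls by (rule dual)
  have d: "d.prd (d.prd z y) x = d.prd z (d.prd y x) \<longleftrightarrow> prd x (prd y z) = prd (prd x y) z"
    using L by (simp add: dual_prd)
  consider "x \<sqsubseteq> e" "y \<sqsubseteq> e" "z \<sqsubseteq> e" | "x \<sqsubseteq> e" "y \<sqsubseteq> e" "\<not> z \<sqsubseteq> e" | "x \<sqsubseteq> e" "\<not> y \<sqsubseteq> e" "z \<sqsubseteq> e"
    | "x \<sqsubseteq> e" "\<not> y \<sqsubseteq> e" "\<not> z \<sqsubseteq> e" | "\<not> x \<sqsubseteq> e" "y \<sqsubseteq> e" "z \<sqsubseteq> e" | "\<not> x \<sqsubseteq> e" "y \<sqsubseteq> e" "\<not> z \<sqsubseteq> e"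
    | "\<not> x \<sqsubseteq> e" "\<not> y \<sqsubseteq> e" "z \<sqsubseteq> e" | "\<not> x \<sqsubseteq> e" "\<not> y \<sqsubseteq> e" "\<not> z \<sqsubseteq> e"
    by blast
  then show ?thesis
  proof cases
    case 1
    then show ?thesis using L neg_glb[of x y] neg_glb[of y z] by (simp add: prd_def glb_assoc)
  next
    case 8
    then show ?thesis
      using L not_neg_lub(1)[of x y] not_neg_lub(1)[of y z] by (simp add: prd_def lub_assoc)
  next
    case 5
    then show ?thesis using d.assoc_nnp[of z y x] L d by simp
  next
    case 7
    then show ?thesis using d.assoc_npp[of z y x] L d by simp
  qed (simp_all add: L assoc_nnp assoc_npp assoc_npn assoc_pnp)
qed

section \<open>Existence of residuals, and the algebra obtained\<close>

lemma rs_pos: "\<lbrakk>x \<in> L; x \<sqsubseteq> e\<rbrakk> \<Longrightarrow> e \<sqsubseteq> rs x"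
  using rs_antimono[of x e] by (simp add: rs_e)

lemma rs_neg: "\<lbrakk>x \<in> L; \<not> x \<sqsubseteq> e\<rbrakk> \<Longrightarrow> rs x \<sqsubseteq> e"
  using rs_antimono[of e x] pos_if by (simp add: rs_e)

lemma under_ex:
  assumes "x \<in> L" "z \<in> L"
  shows "\<exists>w. w \<in> L \<and> (\<forall>y\<in>L. y \<sqsubseteq> w \<longleftrightarrow> prd x y \<sqsubseteq> z)"
proof -
  have r: "rs x \<in> L" using assms rs_closed by blast
  consider "x \<sqsubseteq> e" "z \<sqsubseteq> e" "x \<sqsubseteq> z" | "x \<sqsubseteq> e" "z \<sqsubseteq> e" "\<not> x \<sqsubseteq> z" | "x \<sqsubseteq> e" "\<not> z \<sqsubseteq> e"
    | "\<not> x \<sqsubseteq> e" "z \<sqsubseteq> e" | "\<not> x \<sqsubseteq> e" "\<not> z \<sqsubseteq> e"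
    by blast
  then show ?thesis
  proof cases
    case 1
    have "y \<sqsubseteq> rs x \<longleftrightarrow> prd x y \<sqsubseteq> z" if y: "y \<in> L" for y
    proof (cases "y \<sqsubseteq> e")
      case True
      have "y \<sqsubseteq> rs x" using True 1 y assms neg_le_pos rs_pos r by blast
      moreover have "glb x y \<sqsubseteq> z"
        using 1 y assms trans[OF glb_lower(1)] by simp
      ultimately show ?thesis using True 1 by (simp add: prd_def)
    next
      case False
      then have "\<not> y \<sqsubseteq> z" using 1 y assms trans e_closed by blast
      then show ?thesis using False 1 by (simp add: prd_def)
    qed
    then show ?thesis using r by blast
  next
    case 2
    then obtain w where w: "w \<in> L" "\<forall>y\<in>L. y \<sqsubseteq> w \<longleftrightarrow> (\<forall>u\<in>L. u \<sqsubseteq> x \<and> u \<sqsubseteq> y \<longrightarrow> u \<sqsubseteq> z)"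
      using rpc_ex assms by blast
    have "y \<sqsubseteq> w \<longleftrightarrow> prd x y \<sqsubseteq> z" if y: "y \<in> L" for y
    proof -
      have "y \<sqsubseteq> w \<longleftrightarrow> glb x y \<sqsubseteq> z"
      proof
        assume "y \<sqsubseteq> w"
        then show "glb x y \<sqsubseteq> z" using w y assms glb_lower[of x y] glb_closed by blast
      next
        assume g: "glb x y \<sqsubseteq> z"
        have "u \<sqsubseteq> z" if "u \<in> L" "u \<sqsubseteq> x" "u \<sqsubseteq> y" for u
          using trans[OF _ g, of u] that y assms by (simp add: le_glb_iff)
        then show "y \<sqsubseteq> w" using w y by blast
      qed
      moreover have "\<not> y \<sqsubseteq> z" "glb x y = x" if "\<not> y \<sqsubseteq> e"
        using that 2 y assms trans[of y z e] glb_absorb[of x y] neg_le_notneg[of x y]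
        by auto
      ultimately show ?thesis using 2 by (auto simp: prd_def)
    qed
    then show ?thesis using w(1) by blast
  next
    case 3
    \<comment> \<open>The larger of \<open>rs x\<close> and \<open>z\<close>, which are comparable:
      the join in \<open>under_neg_pos\<close>.\<close>
    let ?w = "if z \<sqsubseteq> rs x then rs x else z"
    have xz: "x \<sqsubseteq> z" using 3 assms neg_le_notneg by blast
    have "y \<sqsubseteq> ?w \<longleftrightarrow> prd x y \<sqsubseteq> z" if y: "y \<in> L" for y
    proof -
      have w: "y \<sqsubseteq> ?w \<longleftrightarrow> y \<sqsubseteq> rs x \<or> y \<sqsubseteq> z"
        using r y assms rs_comparable[of x z] trans[of y z "rs x"] trans[of y "rs x" z] by auto
      have "glb x y \<sqsubseteq> z" "y \<sqsubseteq> z" if "y \<sqsubseteq> e"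
        using that 3 y assms xz trans[OF glb_lower(1)] neg_le_notneg[of y z] by auto
      then show ?thesis unfolding w using xz 3 by (simp add: prd_def)
    qed
    moreover have "?w \<in> L" using r assms by simp
    ultimately show ?thesis by blast
  next
    case 4
    \<comment> \<open>The smaller of \<open>rs x\<close> and \<open>z\<close>: the meet in
      \<open>under_pos_neg\<close>.\<close>
    let ?w = "if z \<sqsubseteq> rs x then z else rs x"
    have xz: "\<not> x \<sqsubseteq> z" using 4 assms trans e_closed by blast
    have "y \<sqsubseteq> ?w \<longleftrightarrow> prd x y \<sqsubseteq> z" if y: "y \<in> L" for y
    proof -
      have w: "y \<sqsubseteq> ?w \<longleftrightarrow> y \<sqsubseteq> rs x \<and> y \<sqsubseteq> z"
        using r y assms rs_comparable[of x z] trans[of y z "rs x"] trans[of y "rs x" z] by auto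
      have "\<not> y \<sqsubseteq> z" if "\<not> y \<sqsubseteq> e" using that 4 y assms trans e_closed by blast
      then show ?thesis unfolding w using xz 4 y assms by (auto simp: prd_def galois lub_le_iff)
    qed
    moreover have "?w \<in> L" using r assms by simp
    ultimately show ?thesis by blast
  next
    case 5
    let ?w = "if x \<sqsubseteq> z then z else rs x"
    have "y \<sqsubseteq> ?w \<longleftrightarrow> prd x y \<sqsubseteq> z" if y: "y \<in> L" for y
    proof (cases "y \<sqsubseteq> e")
      case True
      then have "y \<sqsubseteq> z" using 5 y assms neg_le_notneg by blast
      then show ?thesis using True 5 y assms by (simp add: prd_def galois)
    next
      case False
      then have "\<not> y \<sqsubseteq> rs x" using y assms 5 rs_neg trans r e_closed by blast
      then show ?thesis using False 5 y assms by (simp add: prd_def lub_le_iff)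
    qed
    moreover have "?w \<in> L" using r assms by simp
    ultimately show ?thesis by blast
  qed
qed

lemma over_ex:
  assumes "x \<in> L" "z \<in> L"
  shows "\<exists>w. w \<in> L \<and> (\<forall>y\<in>L. y \<sqsubseteq> w \<longleftrightarrow> prd y x \<sqsubseteq> z)"
proof -
  interpret d: negation_lattice L le e rs ls by (rule dual)
  show ?thesis using d.under_ex[OF assms] assms by (simp add: dual_prd)
qed

lemma under:
  "\<lbrakk>x \<in> L; z \<in> L\<rbrakk> \<Longrightarrow> under alg x z \<in> L \<and> (\<forall>y\<in>L. y \<sqsubseteq> under alg x z \<longleftrightarrow> prd x y \<sqsubseteq> z)"
  by (simp add: alg_def) (rule someI_ex, rule under_ex)

lemma over:
  "\<lbrakk>x \<in> L; z \<in> L\<rbrakk> \<Longrightarrow> over alg z x \<in> L \<and> (\<forall>y\<in>L. y \<sqsubseteq> over alg z x \<longleftrightarrow> prd y x \<sqsubseteq> z)"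
  by (simp add: alg_def) (rule someI_ex, rule over_ex)

lemma alg_conic_idempotent: "conic_idempotent_residuated_lattice alg"
proof
  fix x y z assume "x \<in> carrier alg" "y \<in> carrier alg" "z \<in> carrier alg"
  then show "y \<preceq>\<^bsub>alg\<^esub> x \<setminus>\<^bsub>alg\<^esub> z \<longleftrightarrow> x \<otimes>\<^bsub>alg\<^esub> y \<preceq>\<^bsub>alg\<^esub> z"
    "x \<preceq>\<^bsub>alg\<^esub> z \<sslash>\<^bsub>alg\<^esub> y \<longleftrightarrow> x \<otimes>\<^bsub>alg\<^esub> y \<preceq>\<^bsub>alg\<^esub> z"
    using under over by simp_all
next
  fix x y assume xy: "x \<in> carrier alg" "y \<in> carrier alg"
  show "x \<curlywedge>\<^bsub>alg\<^esub> (x \<curlyvee>\<^bsub>alg\<^esub> y) = x"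
    using xy by (simp add: glb_absorb lub_upper)
  show "x \<curlyvee>\<^bsub>alg\<^esub> (x \<curlywedge>\<^bsub>alg\<^esub> y) = x"
    using xy by (simp add: lub_comm[of x] lub_absorb glb_lower)
next
  fix x assume x: "x \<in> carrier alg"
  show "x \<otimes>\<^bsub>alg\<^esub> x = x" using x by (simp add: prd_def glb_absorb lub_absorb refl)
  show "\<one>\<^bsub>alg\<^esub> \<otimes>\<^bsub>alg\<^esub> x = x" "x \<otimes>\<^bsub>alg\<^esub> \<one>\<^bsub>alg\<^esub> = x"
    using x by (simp_all add: prd_def refl rs_e ls_e glb_comm[of e] glb_absorb)
  show "x \<preceq>\<^bsub>alg\<^esub> \<one>\<^bsub>alg\<^esub> \<or> \<one>\<^bsub>alg\<^esub> \<preceq>\<^bsub>alg\<^esub> x"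
    using x by (simp add: conic)
qed (use under over in \<open>simp_all add: prd_assoc glb_assoc lub_assoc\<close>, simp_all add: glb_comm lub_comm)

sublocale alg: conic_idempotent_residuated_lattice alg
  by (rule alg_conic_idempotent)

lemma rneg_alg:
  assumes x: "x \<in> L"
  shows "rneg alg x = rs x"
  unfolding rneg_def
proof (rule alg.under_eqI)
  fix y assume "y \<in> carrier alg"
  then have y: "y \<in> L" by simp
  have "y \<sqsubseteq> rs x" if "x \<sqsubseteq> e" "y \<sqsubseteq> e"
    using that x y neg_le_pos rs_pos rs_closed by blast
  moreover have "\<not> y \<sqsubseteq> rs x" if "\<not> x \<sqsubseteq> e" "\<not> y \<sqsubseteq> e"
    using that x y trans[of y "rs x" e] rs_neg by auto
  ultimately have "y \<sqsubseteq> rs x \<longleftrightarrow> prd x y \<sqsubseteq> e"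
    using x y by (simp add: prd_def neg_glb lub_le_iff flip: galois)
  then show "y \<preceq>\<^bsub>alg\<^esub> rs x \<longleftrightarrow> x \<otimes>\<^bsub>alg\<^esub> y \<preceq>\<^bsub>alg\<^esub> \<one>\<^bsub>alg\<^esub>"
    using x y by simp
qed (use x in \<open>simp_all\<close>)

lemma lneg_alg: "x \<in> L \<Longrightarrow> lneg alg x = ls x"
  using eq_if_same_lower[of "lneg alg x" "ls x"] alg.lneg_closed[of x] alg.le_rneg_iff_le_lneg[of _ x]
  by (simp add: rneg_alg galois)

lemma glb_absorb': "\<lbrakk>x \<in> L; y \<in> L; y \<sqsubseteq> x\<rbrakk> \<Longrightarrow> glb x y = y"
  by (simp add: glb_comm[of x y] glb_absorb)

lemma star_alg:
  assumes "x \<in> L"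
  shows "star alg x = (if ls x \<sqsubseteq> rs x then ls x else rs x)"
proof -
  have "ls x \<sqsubseteq> rs x \<or> rs x \<sqsubseteq> ls x" using assms ls_comparable ls_closed rs_closed by blast
  then show ?thesis
    using assms
    by (auto simp: star_def rneg_alg lneg_alg glb_absorb glb_absorb')
qed

text \<open>The closure \<open>g\<close> of the meet is the smaller of two comparable double
  negations, hence itself a negation. If neither \<open>x\<close> nor \<open>y\<close> were below
  \<open>g\<close>, irreducibility would give a common lower bound not below \<open>g\<close>,
  although all common lower bounds are below the meet. So one of the two closures is already below
  \<open>g\<close>.\<close>

lemma conjunctive_alg: "conjunctive alg"
  unfolding conjunctive_def
proof (intro ballI)
  fix x y assume "x \<in> carrier alg" "y \<in> carrier alg"
  then have L: "x \<in> L" "y \<in> L" by simp_all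
  define g where "g = gamma alg (glb x y)"
  have gL: "g \<in> L" "gamma alg x \<in> L" "gamma alg y \<in> L"
    using alg.gamma_closed L by (simp_all add: g_def)
  have g: "gamma alg g = g \<and> (x \<sqsubseteq> g \<or> y \<sqsubseteq> g)"
  proof -
    let ?m = "glb x y"
    have m: "?m \<in> L" "ls ?m \<in> L" "rs ?m \<in> L" "rs (ls ?m) \<in> L" "ls (rs ?m) \<in> L"
      using L by simp_all
    have "g = glb (rs (ls ?m)) (ls (rs ?m))"
      using m by (simp add: g_def gamma_def rneg_alg lneg_alg)
    then have "g = rs (ls ?m) \<or> g = ls (rs ?m)"
      using ls_comparable[OF m(3,4)] m glb_absorb glb_absorb' by auto
    then have "\<exists>p\<in>L. g = rs p \<or> g = ls p" using m by blast
    moreover have "glb x y \<sqsubseteq> g" using alg.le_gamma[of "glb x y"] gL L by (simp add: g_def)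
    then have "z \<sqsubseteq> g" if "z \<in> L" "z \<sqsubseteq> x" "z \<sqsubseteq> y" for z
      using that L gL trans[of z "glb x y" g] by (simp add: le_glb_iff)
    ultimately show ?thesis
      using rs_irreducible[OF _ L] ls_irreducible[OF _ L] alg.gamma_rneg alg.gamma_lneg rneg_alg lneg_alg
      by (metis alg_simps(1))
  qed
  then have "gamma alg x \<sqsubseteq> g \<or> gamma alg y \<sqsubseteq> g"
    using alg.gamma_mono[of x g] alg.gamma_mono[of y g] L gL by auto
  then have "glb (gamma alg x) (gamma alg y) \<sqsubseteq> g"
    using gL trans[OF glb_lower(1)] trans[OF glb_lower(2)] by auto
  moreover have "g \<sqsubseteq> glb (gamma alg x) (gamma alg y)"
    using alg.gamma_mono[of "glb x y" x] alg.gamma_mono[of "glb x y" y] L gL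
    by (simp add: le_glb_iff glb_lower g_def)
  ultimately have "g = glb (gamma alg x) (gamma alg y)"
    using antisym gL by simp
  then show "gamma alg (x \<curlywedge>\<^bsub>alg\<^esub> y) = gamma alg x \<curlywedge>\<^bsub>alg\<^esub> gamma alg y"
    by (simp add: g_def)
qed

lemma rigid_alg:
  fixes st
  defines "st \<equiv> \<lambda>x. if ls x \<sqsubseteq> rs x then ls x else rs x"
  assumes "\<And>x. x \<in> L \<Longrightarrow> st (st (rs x)) = rs x" "\<And>x. x \<in> L \<Longrightarrow> st (st (ls x)) = ls x"
  shows "rigid alg"
proof -
  have "star alg (star alg x) = st (st x)" if "x \<in> L" for x
    using that by (simp add: star_alg st_def)
  then show ?thesis using assms(2,3) by (simp add: rigid_def rneg_alg lneg_alg)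
qed

end

section \<open>Rigidity and conjunctivity\<close>

context conic_idempotent_residuated_lattice
begin

text \<open>Negations are comparable with everything, so the meet defining \<gamma> is one of its
  two terms.\<close>

lemma gamma_cases:
  assumes "x \<in> carrier A"
  shows "gamma A x = rneg A (lneg A x) \<or> gamma A x = lneg A (rneg A x)"
proof -
  have c: "rneg A (lneg A x) \<in> carrier A" "lneg A (rneg A x) \<in> carrier A"
    using assms by simp_all
  have "rneg A (lneg A x) \<preceq> lneg A (rneg A x) \<or> lneg A (rneg A x) \<preceq> rneg A (lneg A x)"
    using lneg_comparable[of "rneg A x"] c assms by simp
  then show ?thesis using meet_comm[OF c] by (auto simp: gamma_def rl_le_def)
qed

lemma gamma_idem: "x \<in> carrier A \<Longrightarrow> gamma A (gamma A x) = gamma A x"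
  using gamma_cases[of x] gamma_rneg[of "lneg A x"] gamma_lneg[of "rneg A x"]
  by auto

lemma le_gamma_fixed_iff:
  assumes "x \<in> carrier A" "s \<in> carrier A" "gamma A s = s"
  shows "gamma A x \<preceq> s \<longleftrightarrow> x \<preceq> s"
  using assms gamma_mono[of x s] le_trans[OF le_gamma, of x s] by auto

text \<open>A fixed point of \<gamma> is a negation by \<open>gamma_cases\<close>. So the fixed
  points form a chain, and moreover each of them cuts the whole algebra into the elements below it
  and those above it.\<close>

lemma gamma_fixed_comparable:
  assumes "x \<in> carrier A" "s \<in> carrier A" "gamma A s = s"
  shows "x \<preceq> s \<or> s \<preceq> x"
  using gamma_cases[OF assms(2)] assms rneg_comparable[of "lneg A s" x] lneg_comparable[of "rneg A s" x]
  by auto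

text \<open>The double negation of \<open>x\<close> is a fixed point above \<open>x\<close>, hence
  above \<open>gamma A x\<close>; the Galois connection turns this into the missing inequality. Both
  negations are therefore constant on each fibre of \<gamma>.\<close>

lemma rneg_gamma: "x \<in> carrier A \<Longrightarrow> rneg A (gamma A x) = rneg A x"
  and lneg_gamma: "x \<in> carrier A \<Longrightarrow> lneg A (gamma A x) = lneg A x"
proof -
  assume x: "x \<in> carrier A"
  have "rneg A x \<preceq> rneg A (gamma A x)"
    using x le_lneg_rneg[of x]
    by (simp add: le_rneg_iff_le_lneg le_gamma_fixed_iff gamma_lneg)
  then show "rneg A (gamma A x) = rneg A x"
    using x rneg_antimono[OF le_gamma] by (simp add: le_antisym)
  have "lneg A x \<preceq> lneg A (gamma A x)"
    using x le_rneg_lneg[of x]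
    by (simp add: le_gamma_fixed_iff gamma_rneg flip: le_rneg_iff_le_lneg)
  then show "lneg A (gamma A x) = lneg A x"
    using x lneg_antimono[OF le_gamma] by (simp add: le_antisym)
qed

lemma gamma_neg_iff: "x \<in> carrier A \<Longrightarrow> gamma A x \<preceq> \<one> \<longleftrightarrow> x \<preceq> \<one>"
  by (simp add: le_gamma_fixed_iff gamma_one)

lemma star_cases:
  assumes "x \<in> carrier A"
  shows "lneg A x \<preceq> rneg A x \<Longrightarrow> star A x = lneg A x"
    and "rneg A x \<preceq> lneg A x \<Longrightarrow> star A x = rneg A x"
  using assms by (simp_all add: star_def rl_le_def meet_comm)

lemma star_star_fixed:
  assumes "rigid A" "s \<in> carrier A" "gamma A s = s"
  shows "star A (star A s) = s"
  using assms gamma_cases[of s] unfolding rigid_def by (metis rneg_closed lneg_closed)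

text \<open>Hence a skeleton element lies in every subalgebra containing one of its negations.\<close>

lemma recover_from_rneg:
  assumes "rigid A" and s: "s \<in> carrier A" "gamma A s = s"
  shows "s = star A (rneg A s) \<or> s = lneg A (rneg A s)"
proof (cases "rneg A s \<preceq> lneg A s")
  case True
  then show ?thesis using star_star_fixed[OF assms] star_cases(2)[of s] s by simp
next
  case False
  then have ls: "lneg A s \<preceq> rneg A s"
    using s rneg_comparable[of s "lneg A s"] by simp
  \<comment> \<open>The largest element whose right negation is that of \<open>s\<close>. By
    adjacency its left negation also agrees with that of \<open>s\<close>, hence so does its
    \<open>star\<close>; applying \<open>star\<close> once more gives \<open>u = s\<close>.\<close>
  define u where "u = lneg A (rneg A s)"
  have u: "u \<in> carrier A" "gamma A u = u" "rneg A u = rneg A s" "s \<preceq> u"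
    using s by (simp_all add: u_def gamma_lneg rneg_lneg_rneg le_lneg_rneg)
  have lu: "lneg A u \<preceq> lneg A s" using u s by (simp add: lneg_antimono)
  have "lneg A s \<preceq> lneg A u"
    using rneg_lneg_adjacent[of u "rneg A s" "lneg A s"] u s False
    by (auto simp: le_refl)
  then have eq: "lneg A u = lneg A s" using lu u s by (simp add: le_antisym)
  then have "star A u = star A s" using star_cases(1)[of u] star_cases(1)[of s] u s ls by simp
  then have "u = s" using star_star_fixed[of s] star_star_fixed[of u] u s assms(1) by simp
  then show ?thesis by (simp add: u_def)
qed

lemma opposite_gamma: "x \<in> carrier A \<Longrightarrow> gamma (opposite A) x = gamma A x"
  and opposite_star: "x \<in> carrier A \<Longrightarrow> star (opposite A) x = star A x"
  by (simp_all add: gamma_def star_def meet_comm)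

lemma recover_from_lneg:
  assumes "rigid A" and s: "s \<in> carrier A" "gamma A s = s"
  shows "s = star A (lneg A s) \<or> s = rneg A (lneg A s)"
proof -
  interpret op: conic_idempotent_residuated_lattice "opposite A" by (rule opposite_conic_idempotent)
  have "rigid (opposite A)"
    using assms(1) by (simp add: rigid_def opposite_star)
  then show ?thesis
    using op.recover_from_rneg[of s] s by (simp add: opposite_gamma opposite_star)
qed

text \<open>Comparison with a fixed point only sees closures. Those of \<open>x\<close> and
  \<open>y\<close> lie in a chain, and conjunctivity makes the closure of the meet one of
  them.\<close>

lemma gamma_fixed_irreducible:
  assumes "conjunctive A" and s: "s \<in> carrier A" "gamma A s = s"
    and xy: "x \<in> carrier A" "y \<in> carrier A" "\<not> x \<preceq> s" "\<not> y \<preceq> s"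
  shows "\<not> x \<curlywedge> y \<preceq> s"
proof -
  have c: "gamma A x \<in> carrier A" "gamma A y \<in> carrier A" using xy gamma_closed by simp_all
  have "gamma A x \<preceq> gamma A y \<or> gamma A y \<preceq> gamma A x"
    using gamma_fixed_comparable[OF c] gamma_idem xy by simp
  then have "gamma A x \<curlywedge> gamma A y = gamma A x \<or> gamma A x \<curlywedge> gamma A y = gamma A y"
    using meet_comm[OF c] by (auto simp: rl_le_def)
  moreover have "gamma A (x \<curlywedge> y) = gamma A x \<curlywedge> gamma A y"
    using assms(1) xy unfolding conjunctive_def by blast
  ultimately have "\<not> gamma A (x \<curlywedge> y) \<preceq> s"
    using le_gamma_fixed_iff[OF _ s, of x] le_gamma_fixed_iff[OF _ s, of y] xy by auto
  then show ?thesis using le_gamma_fixed_iff[OF _ s, of "x \<curlywedge> y"] xy by simp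
qed

text \<open>An element of the fibre of the upper negation cannot be below the lower one, since its
  closure would be too. Adjacency then puts the whole upper negation below it.\<close>

lemma block_above_gap:
  assumes "p \<in> carrier A" "x \<in> carrier A"
  shows "\<lbrakk>\<not> lneg A p \<preceq> rneg A p; gamma A x = lneg A p\<rbrakk> \<Longrightarrow> x = lneg A p"
    and "\<lbrakk>\<not> rneg A p \<preceq> lneg A p; gamma A x = rneg A p\<rbrakk> \<Longrightarrow> x = rneg A p"
proof -
  assume *: "\<not> lneg A p \<preceq> rneg A p" "gamma A x = lneg A p"
  then have "\<not> x \<preceq> rneg A p"
    using le_gamma_fixed_iff[of x "rneg A p"] assms by (simp add: gamma_rneg)
  then have "lneg A p \<preceq> x"
    using lneg_rneg_adjacent[of p "lneg A p" x] assms by (simp add: le_refl)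
  then show "x = lneg A p" using le_gamma[of x] * assms by (simp add: le_antisym)
next
  assume *: "\<not> rneg A p \<preceq> lneg A p" "gamma A x = rneg A p"
  then have "\<not> x \<preceq> lneg A p"
    using le_gamma_fixed_iff[of x "lneg A p"] assms by (simp add: gamma_lneg)
  then have "rneg A p \<preceq> x"
    using rneg_lneg_adjacent[of p "rneg A p" x] assms by (simp add: le_refl)
  then show "x = rneg A p" using le_gamma[of x] * assms by (simp add: le_antisym)
qed

end

section \<open>Filters\<close>

text \<open>The operations are functions on the whole type and only the carrier \<open>L\<close>
  varies, so that two overlapping lattices can be interpreted with the same operations and the same
  top.\<close>

locale lattice_on =
  fixes le :: "'v \<Rightarrow> 'v \<Rightarrow> bool" (infix "\<sqsubseteq>" 50) and m j :: "'v \<Rightarrow> 'v \<Rightarrow> 'v" and t :: 'v and L :: "'v set"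
  assumes refl: "x \<in> L \<Longrightarrow> x \<sqsubseteq> x"
    and antisym: "\<lbrakk>x \<sqsubseteq> y; y \<sqsubseteq> x; x \<in> L; y \<in> L\<rbrakk> \<Longrightarrow> x = y"
    and trans: "\<lbrakk>x \<sqsubseteq> y; y \<sqsubseteq> z; x \<in> L; y \<in> L; z \<in> L\<rbrakk> \<Longrightarrow> x \<sqsubseteq> z"
    and m_closed: "\<lbrakk>x \<in> L; y \<in> L\<rbrakk> \<Longrightarrow> m x y \<in> L"
    and j_closed: "\<lbrakk>x \<in> L; y \<in> L\<rbrakk> \<Longrightarrow> j x y \<in> L"
    and le_m_iff: "\<lbrakk>x \<in> L; y \<in> L; z \<in> L\<rbrakk> \<Longrightarrow> z \<sqsubseteq> m x y \<longleftrightarrow> z \<sqsubseteq> x \<and> z \<sqsubseteq> y"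
    and j_le_iff: "\<lbrakk>x \<in> L; y \<in> L; z \<in> L\<rbrakk> \<Longrightarrow> j x y \<sqsubseteq> z \<longleftrightarrow> x \<sqsubseteq> z \<and> y \<sqsubseteq> z"
    and t_closed: "t \<in> L"
    and le_t: "x \<in> L \<Longrightarrow> x \<sqsubseteq> t"
begin

declare m_closed [simp] j_closed [simp]

definition lfilter :: "'v set \<Rightarrow> bool"
  where "lfilter F \<longleftrightarrow> F \<subseteq> L \<and> t \<in> F \<and> (\<forall>x\<in>F. \<forall>y\<in>L. x \<sqsubseteq> y \<longrightarrow> y \<in> F) \<and> (\<forall>x\<in>F. \<forall>y\<in>F. m x y \<in> F)"

definition prime_lfilter :: "'v set \<Rightarrow> bool"
  where "prime_lfilter F \<longleftrightarrow> lfilter F \<and> (\<forall>x\<in>L. \<forall>y\<in>L. j x y \<in> F \<longrightarrow> x \<in> F \<or> y \<in> F)"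

lemma lfilterI:
  assumes "F \<subseteq> L" "t \<in> F" "\<And>x y. \<lbrakk>x \<in> F; y \<in> L; x \<sqsubseteq> y\<rbrakk> \<Longrightarrow> y \<in> F"
    "\<And>x y. \<lbrakk>x \<in> F; y \<in> F\<rbrakk> \<Longrightarrow> m x y \<in> F"
  shows "lfilter F"
  using assms unfolding lfilter_def by blast

lemma lfilterD:
  assumes "lfilter F"
  shows "F \<subseteq> L" "t \<in> F" "\<And>x y. \<lbrakk>x \<in> F; y \<in> L; x \<sqsubseteq> y\<rbrakk> \<Longrightarrow> y \<in> F"
    "\<And>x y. \<lbrakk>x \<in> F; y \<in> F\<rbrakk> \<Longrightarrow> m x y \<in> F"
  using assms unfolding lfilter_def by blast+

lemma m_lower: "\<lbrakk>x \<in> L; y \<in> L\<rbrakk> \<Longrightarrow> m x y \<sqsubseteq> x" "\<lbrakk>x \<in> L; y \<in> L\<rbrakk> \<Longrightarrow> m x y \<sqsubseteq> y"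
  using le_m_iff[of x y "m x y"] by (simp_all add: refl)

lemma j_upper: "\<lbrakk>x \<in> L; y \<in> L\<rbrakk> \<Longrightarrow> x \<sqsubseteq> j x y" "\<lbrakk>x \<in> L; y \<in> L\<rbrakk> \<Longrightarrow> y \<sqsubseteq> j x y"
  using j_le_iff[of x y "j x y"] by (simp_all add: refl)

lemma le_iff_m: "\<lbrakk>x \<in> L; y \<in> L\<rbrakk> \<Longrightarrow> x \<sqsubseteq> y \<longleftrightarrow> m x y = x"
  by (metis antisym le_m_iff m_closed m_lower refl)

lemma m_mem_iff: "\<lbrakk>lfilter F; x \<in> L; y \<in> L\<rbrakk> \<Longrightarrow> m x y \<in> F \<longleftrightarrow> x \<in> F \<and> y \<in> F"
  using m_lower lfilterD(3,4) by blast

lemma lfilter_principal: "x \<in> L \<Longrightarrow> lfilter {y \<in> L. x \<sqsubseteq> y}"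
  by (rule lfilterI) (auto simp: t_closed le_t le_m_iff intro: trans)

lemma lfilter_L: "lfilter L"
  by (rule lfilterI) (auto simp: t_closed)

lemma prime_lfilter_L: "prime_lfilter L"
  by (simp add: prime_lfilter_def lfilter_L)

text \<open>\<open>G\<close> is assumed to be closed under meets only, because it will be the trace
  of a filter of the other lattice, which is not upward closed in \<open>L\<close>.\<close>

lemma lfilter_generated:
  assumes F: "lfilter F" and G: "G \<subseteq> L" "t \<in> G" "\<And>x y. \<lbrakk>x \<in> G; y \<in> G\<rbrakk> \<Longrightarrow> m x y \<in> G"
  defines "H \<equiv> {z \<in> L. \<exists>x\<in>F. \<exists>y\<in>G. m y x \<sqsubseteq> z}"
  shows "lfilter H" "F \<subseteq> H" "G \<subseteq> H"
proof -
  note FL = lfilterD[OF F]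
  show "lfilter H"
  proof (rule lfilterI)
    show "t \<in> H" using FL G t_closed le_t m_closed unfolding H_def by blast
  next
    fix z w assume "z \<in> H" "w \<in> L" "z \<sqsubseteq> w"
    then obtain x y where xy: "x \<in> F" "y \<in> G" "m y x \<sqsubseteq> z" "z \<in> L" unfolding H_def by blast
    moreover have "x \<in> L" "y \<in> L" using xy FL G by blast+
    ultimately have "m y x \<sqsubseteq> w"
      using trans[of "m y x" z w] \<open>z \<sqsubseteq> w\<close> \<open>w \<in> L\<close> by simp
    then show "w \<in> H" using xy \<open>w \<in> L\<close> unfolding H_def by blast
  next
    fix z z' assume "z \<in> H" "z' \<in> H"
    then obtain x y x' y' where xy: "x \<in> F" "y \<in> G" "m y x \<sqsubseteq> z" "z \<in> L"
      "x' \<in> F" "y' \<in> G" "m y' x' \<sqsubseteq> z'" "z' \<in> L"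
      unfolding H_def by blast
    have L: "x \<in> L" "y \<in> L" "x' \<in> L" "y' \<in> L" using xy FL(1) G(1) by blast+
    let ?w = "m (m y y') (m x x')"
    have wL: "?w \<in> L" using L by simp
    have w1: "?w \<sqsubseteq> m y y'" "?w \<sqsubseteq> m x x'" using L by (simp_all add: m_lower)
    then have "?w \<sqsubseteq> y" "?w \<sqsubseteq> y'" "?w \<sqsubseteq> x" "?w \<sqsubseteq> x'" using L wL by (simp_all add: le_m_iff)
    then have "?w \<sqsubseteq> m y x" "?w \<sqsubseteq> m y' x'" using L wL by (simp_all add: le_m_iff)
    then have "?w \<sqsubseteq> z" "?w \<sqsubseteq> z'"
      using trans[of ?w "m y x" z] trans[of ?w "m y' x'" z'] xy L wL by simp_all
    then have "?w \<sqsubseteq> m z z'" using wL xy by (simp add: le_m_iff)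
    moreover have "m x x' \<in> F" "m y y' \<in> G" "m z z' \<in> L"
      using xy FL(4) G(3) m_closed by simp_all
    ultimately show "m z z' \<in> H" unfolding H_def by blast
  qed (auto simp: H_def)
  show "F \<subseteq> H"
  proof
    fix x assume "x \<in> F"
    then have "x \<in> L" "m t x \<sqsubseteq> x" using FL(1) m_lower(2)[OF t_closed] by blast+
    then show "x \<in> H" using \<open>x \<in> F\<close> G(2) unfolding H_def by blast
  qed
  show "G \<subseteq> H"
  proof
    fix y assume "y \<in> G"
    then have "y \<in> L" "m y t \<sqsubseteq> y" using G(1) m_lower(1)[OF _ t_closed] by blast+
    then show "y \<in> H" using \<open>y \<in> G\<close> FL(2) unfolding H_def by blast
  qed
qed

end

locale heyting_on = lattice_on +
  fixes i :: "'a \<Rightarrow> 'a \<Rightarrow> 'a"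
  assumes i_closed: "\<lbrakk>x \<in> L; y \<in> L\<rbrakk> \<Longrightarrow> i x y \<in> L"
    and le_i_iff: "\<lbrakk>x \<in> L; y \<in> L; z \<in> L\<rbrakk> \<Longrightarrow> y \<sqsubseteq> i x z \<longleftrightarrow> m x y \<sqsubseteq> z"
begin

lemma m_comm: "\<lbrakk>x \<in> L; y \<in> L\<rbrakk> \<Longrightarrow> m x y = m y x"
  by (rule antisym) (simp_all add: le_m_iff m_lower)

lemma j_idem: "x \<in> L \<Longrightarrow> j x x = x"
  by (rule antisym) (simp_all add: j_le_iff j_upper refl)

lemma lfilter_adjoin:
  assumes F: "lfilter F" and x: "x \<in> L"
  defines "H \<equiv> {z \<in> L. \<exists>p\<in>F. m x p \<sqsubseteq> z}"
  shows "lfilter H" "F \<subseteq> H" "x \<in> H"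
proof -
  note FL = lfilterD[OF F]
  let ?G = "{y \<in> L. x \<sqsubseteq> y}"
  note P = lfilterD[OF lfilter_principal[OF x]]
  have "m x p \<sqsubseteq> z" if "y \<in> L" "x \<sqsubseteq> y" "p \<in> F" "m y p \<sqsubseteq> z" "z \<in> L" for p y z
  proof -
    have p: "p \<in> L" using that FL by blast
    have "m x p \<sqsubseteq> m y p"
      using that p x trans[OF m_lower(1), of x p y] m_lower(2)[of x p] by (simp add: le_m_iff)
    then show ?thesis using that p x trans[of "m x p" "m y p" z] by simp
  qed
  then have "H = {z \<in> L. \<exists>p\<in>F. \<exists>y\<in>?G. m y p \<sqsubseteq> z}"
    using x refl unfolding H_def by blast
  then show "lfilter H" "F \<subseteq> H" "x \<in> H"
    using lfilter_generated[OF F P(1,2,4)] x refl by auto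
qed

text \<open>A filter that is maximal among those containing \<open>F\<close> and missing
  \<open>J\<close> is prime. \<open>J\<close> is closed under joins without being an ideal: in the
  main use it consists of elements of the common part.\<close>

theorem prime_lfilter_extension:
  assumes F: "lfilter F" and J: "J \<subseteq> L" "\<And>x y. \<lbrakk>x \<in> J; y \<in> J\<rbrakk> \<Longrightarrow> j x y \<in> J" and FJ: "F \<inter> J = {}"
  shows "\<exists>P. prime_lfilter P \<and> F \<subseteq> P \<and> P \<inter> J = {}"
proof -
  define S where "S = {G. lfilter G \<and> F \<subseteq> G \<and> G \<inter> J = {}}"
  have "F \<in> S" using F FJ by (simp add: S_def)
  have "\<Union>C \<in> S" if C: "C \<noteq> {}" "subset.chain S C" for C
  proof -
    have CS: "\<And>G. G \<in> C \<Longrightarrow> lfilter G \<and> F \<subseteq> G \<and> G \<inter> J = {}"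
      using C unfolding subset_chain_def S_def by blast
    have "lfilter (\<Union>C)"
    proof (rule lfilterI)
      show "\<Union>C \<subseteq> L" using CS lfilterD(1) by blast
      show "t \<in> \<Union>C" using CS C lfilterD(2) by blast
      show "y \<in> \<Union>C" if "x \<in> \<Union>C" "y \<in> L" "x \<sqsubseteq> y" for x y using CS that lfilterD(3) by blast
      show "m x y \<in> \<Union>C" if xy: "x \<in> \<Union>C" "y \<in> \<Union>C" for x y
      proof -
        obtain G G' where G: "x \<in> G" "y \<in> G'" "G \<in> C" "G' \<in> C" using xy by blast
        then have "G \<subseteq> G' \<or> G' \<subseteq> G" using C unfolding subset_chain_def by blast
        then have "m x y \<in> G \<or> m x y \<in> G'" using CS G lfilterD(4) by (meson subsetD)
        then show ?thesis using G by blast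
      qed
    qed
    then show ?thesis using CS C by (auto simp: S_def)
  qed
  then obtain P where P: "P \<in> S" and max: "\<forall>G\<in>S. P \<subseteq> G \<longrightarrow> G = P"
    using subset_Zorn_nonempty[of S] \<open>F \<in> S\<close> by blast
  have Pf: "lfilter P" "F \<subseteq> P" "P \<inter> J = {}" using P by (simp_all add: S_def)
  note PL = lfilterD[OF Pf(1)]
  have ex: "\<exists>u\<in>J. \<exists>p\<in>P. m x p \<sqsubseteq> u" if x: "x \<in> L" "x \<notin> P" for x
  proof -
    let ?H = "{z \<in> L. \<exists>p\<in>P. m x p \<sqsubseteq> z}"
    note H = lfilter_adjoin[OF Pf(1) x(1)]
    have "?H \<notin> S" using max H x by blast
    then have "?H \<inter> J \<noteq> {}" using H Pf unfolding S_def by blast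
    then show ?thesis by blast
  qed
  have "x \<in> P \<or> y \<in> P" if xy: "x \<in> L" "y \<in> L" "j x y \<in> P" for x y
  proof (rule ccontr)
    assume "\<not> (x \<in> P \<or> y \<in> P)"
    then obtain u p v q where u: "u \<in> J" "p \<in> P" "m x p \<sqsubseteq> u" "v \<in> J" "q \<in> P" "m y q \<sqsubseteq> v"
      using ex xy by meson
    have L: "u \<in> L" "v \<in> L" "p \<in> L" "q \<in> L" using u J PL by blast+
    let ?w = "m p q" and ?v = "j u v"
    have w: "?w \<in> L" "?v \<in> L" "?w \<sqsubseteq> p" "?w \<sqsubseteq> q" "?w \<in> P"
      using L u PL(4) by (simp_all add: m_lower)
    have "m x ?w \<sqsubseteq> m x p" "m y ?w \<sqsubseteq> m y q"
      using xy L w trans[OF m_lower(2)[of x ?w], of p] trans[OF m_lower(2)[of y ?w], of q]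
      by (simp_all add: le_m_iff m_lower)
    moreover have "m x p \<sqsubseteq> ?v" "m y q \<sqsubseteq> ?v"
      using xy L w u trans[OF u(3) j_upper(1)[of u v]] trans[OF u(6) j_upper(2)[of u v]] by simp_all
    ultimately have "m x ?w \<sqsubseteq> ?v" "m y ?w \<sqsubseteq> ?v"
      using xy L w trans[of "m x ?w" "m x p" ?v] trans[of "m y ?w" "m y q" ?v] by simp_all
    \<comment> \<open>Residuation replaces the distributive law: both \<open>x\<close> and
      \<open>y\<close>, hence their join, are below the implication from \<open>?w\<close> to
      \<open>?v\<close>.\<close>
    then have "x \<sqsubseteq> i ?w ?v" "y \<sqsubseteq> i ?w ?v"
      using xy w by (simp_all add: le_i_iff m_comm[of ?w])
    then have "j x y \<sqsubseteq> i ?w ?v" using xy w by (simp add: j_le_iff i_closed)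
    then have "m ?w (j x y) \<sqsubseteq> ?v" using xy w by (simp add: le_i_iff)
    moreover have "m ?w (j x y) \<in> P" using xy w PL(4) by blast
    ultimately have "?v \<in> P" using w PL(3) by blast
    then show False using Pf(3) J(2) u by blast
  qed
  then show ?thesis using Pf unfolding prime_lfilter_def by blast
qed

end

section \<open>Amalgamation of fibres\<close>

text \<open>Two lattices with a common top that share their operations on the intersection, which is then a
  common sublattice, are amalgamated. A point is a set that restricts to a filter on both sides, a prime
  filter in the Heyting case; an element is mapped to the set of points that contain it. In the Heyting
  case this is Esakia duality; otherwise the amalgam is dual to the lattice of all points. The
  improper filter counts as prime since there need not be a bottom.\<close>

locale block_pair = X: lattice_on le m j t L1 + Y: lattice_on le m j t L2
  for le :: "'v \<Rightarrow> 'v \<Rightarrow> bool" (infix "\<sqsubseteq>" 50) and m j :: "'v \<Rightarrow> 'v \<Rightarrow> 'v" and t :: 'v and L1 L2 :: "'v set" +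
  fixes i :: "'v \<Rightarrow> 'v \<Rightarrow> 'v" and heyting :: bool
  assumes heyting1: "heyting \<Longrightarrow> heyting_on le m j t L1 i"
    and heyting2: "heyting \<Longrightarrow> heyting_on le m j t L2 i"
begin

definition points :: "'v set set"
  where "points = {P. P \<subseteq> L1 \<union> L2 \<and> X.lfilter (P \<inter> L1) \<and> Y.lfilter (P \<inter> L2) \<and>
    (heyting \<longrightarrow> X.prime_lfilter (P \<inter> L1) \<and> Y.prime_lfilter (P \<inter> L2))}"

text \<open>In the Heyting case these are up-sets of points. Demanding the improper point excludes
  the empty up-set, so that trivial fibres have a trivial amalgam, as gaps require. Otherwise each
  set is the principal up-set of the point generated by \<open>S\<close>; a union of two such sets
  is not of this form in general, so joins are formed by closing it.\<close>

definition block :: "'v set set set"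
  where "block = (if heyting
    then {U. U \<subseteq> points \<and> L1 \<union> L2 \<in> U \<and> (\<forall>P\<in>U. \<forall>Q\<in>points. P \<subseteq> Q \<longrightarrow> Q \<in> U)}
    else (\<lambda>S. {P \<in> points. S \<subseteq> P}) ` Pow (L1 \<union> L2))"

lemma block_if_heyting:
  "heyting \<Longrightarrow> block = {U. U \<subseteq> points \<and> L1 \<union> L2 \<in> U \<and> (\<forall>P\<in>U. \<forall>Q\<in>points. P \<subseteq> Q \<longrightarrow> Q \<in> U)}"
  unfolding block_def by (rule if_P)

lemma block_if_not_heyting: "\<not> heyting \<Longrightarrow> block = (\<lambda>S. {P \<in> points. S \<subseteq> P}) ` Pow (L1 \<union> L2)"
  unfolding block_def by (rule if_not_P)

lemma blockE:
  assumes "Z \<in> block" "\<not> heyting"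
  obtains S where "S \<subseteq> L1 \<union> L2" "Z = {P \<in> points. S \<subseteq> P}"
proof -
  have "Z \<in> (\<lambda>S. {P \<in> points. S \<subseteq> P}) ` Pow (L1 \<union> L2)"
    using assms(1) unfolding block_if_not_heyting[OF assms(2)] .
  then show ?thesis using that by (elim imageE) (simp only: Pow_iff)
qed

definition pts :: "'v \<Rightarrow> 'v set set"
  where "pts x = {P \<in> points. x \<in> P}"

lemma swap: "block_pair le m j t L2 L1 i heyting"
  by (intro block_pair.intro block_pair_axioms.intro X.lattice_on_axioms Y.lattice_on_axioms
    heyting1 heyting2)

lemma swap_points: "block_pair.points le m j t L2 L1 heyting = points"
proof -
  interpret s: block_pair le m j t L2 L1 i heyting by (rule swap)
  show ?thesis unfolding points_def s.points_def by blast
qed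

lemma swap_pts: "block_pair.pts le m j t L2 L1 heyting = pts"
proof -
  interpret s: block_pair le m j t L2 L1 i heyting by (rule swap)
  show ?thesis unfolding pts_def s.pts_def swap_points ..
qed

lemma swap_block: "block_pair.block le m j t L2 L1 heyting = block"
proof -
  interpret s: block_pair le m j t L2 L1 i heyting by (rule swap)
  show ?thesis unfolding block_def s.block_def swap_points by (simp add: Un_commute)
qed

lemma points_mono:
  assumes "P \<in> points" "x \<in> P" "x \<sqsubseteq> y" "x \<in> L1 \<and> y \<in> L1 \<or> x \<in> L2 \<and> y \<in> L2"
  shows "y \<in> P"
  using assms X.lfilterD(3)[of "P \<inter> L1" x y] Y.lfilterD(3)[of "P \<inter> L2" x y]
  unfolding points_def by blast

lemma top_point: "L1 \<union> L2 \<in> points"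
proof -
  have "(L1 \<union> L2) \<inter> L1 = L1" "(L1 \<union> L2) \<inter> L2 = L2" by blast+
  then show ?thesis
    by (simp add: points_def X.prime_lfilter_L Y.prime_lfilter_L X.lfilter_L Y.lfilter_L)
qed

lemma points_in_block: "points \<in> block"
proof (cases heyting)
  case True
  then show ?thesis using top_point unfolding block_if_heyting[OF True] by blast
next
  case False
  show ?thesis unfolding block_if_not_heyting[OF False] by (rule image_eqI[of _ _ "{}"]) simp_all
qed

lemma block_le_points: "U \<in> block \<Longrightarrow> U \<subseteq> points"
proof (cases heyting)
  case True
  then show "U \<in> block \<Longrightarrow> U \<subseteq> points" unfolding block_if_heyting[OF True] by blast
next
  case False
  then show "U \<in> block \<Longrightarrow> U \<subseteq> points" unfolding block_if_not_heyting[OF False] by blast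
qed

lemma block_Int:
  assumes "U \<in> block" "V \<in> block"
  shows "U \<inter> V \<in> block"
proof (cases heyting)
  case False
  obtain S where "S \<subseteq> L1 \<union> L2" "U = {P \<in> points. S \<subseteq> P}" using assms(1) False by (rule blockE)
  moreover obtain S' where "S' \<subseteq> L1 \<union> L2" "V = {P \<in> points. S' \<subseteq> P}" using assms(2) False by (rule blockE)
  ultimately have "S \<union> S' \<in> Pow (L1 \<union> L2)" "U \<inter> V = {P \<in> points. S \<union> S' \<subseteq> P}" by auto
  then show ?thesis unfolding block_if_not_heyting[OF False] by blast
next
  case True
  then show ?thesis using assms unfolding block_if_heyting[OF True] by blast
qed

lemma block_lub:
  assumes "U \<in> block" "V \<in> block"
  shows "\<exists>W. W \<in> block \<and> (\<forall>Z\<in>block. W \<subseteq> Z \<longleftrightarrow> U \<subseteq> Z \<and> V \<subseteq> Z)"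
proof (cases heyting)
  case True
  then have "U \<union> V \<in> block" using assms unfolding block_if_heyting[OF True] by blast
  then show ?thesis by blast
next
  case False
  \<comment> \<open>The closure of the union of \<open>U\<close> and \<open>V\<close>: all points
    containing the elements common to every point of both.\<close>
  define W where "W = {P \<in> points. \<Inter>U \<inter> \<Inter>V \<inter> (L1 \<union> L2) \<subseteq> P}"
  have "W \<in> block" unfolding W_def block_if_not_heyting[OF False] by blast
  moreover have "W \<subseteq> Z \<longleftrightarrow> U \<subseteq> Z \<and> V \<subseteq> Z" if "Z \<in> block" for Z
  proof -
    obtain S where S: "S \<subseteq> L1 \<union> L2" "Z = {P \<in> points. S \<subseteq> P}"
      by (rule blockE[OF \<open>Z \<in> block\<close> False])
    have "U \<subseteq> points" "V \<subseteq> points" using assms block_le_points by blast+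
    then have "U \<subseteq> W" "V \<subseteq> W" unfolding W_def by blast+
    moreover have "W \<subseteq> Z" if "U \<subseteq> Z" "V \<subseteq> Z"
    proof -
      have "S \<subseteq> \<Inter>U \<inter> \<Inter>V \<inter> (L1 \<union> L2)" using that S by blast
      then show ?thesis unfolding W_def S(2) by blast
    qed
    ultimately show ?thesis by blast
  qed
  ultimately show ?thesis by blast
qed

lemma block_rpc:
  assumes heyting "U \<in> block" "Z \<in> block"
  shows "\<exists>W. W \<in> block \<and> (\<forall>V\<in>block. V \<subseteq> W \<longleftrightarrow> U \<inter> V \<subseteq> Z)"
proof -
  \<comment> \<open>Implication of up-sets as in Kripke semantics. The improper point belongs to it
    because it is the greatest point and lies in \<open>Z\<close>.\<close>
  define W where "W = {P \<in> points. \<forall>Q\<in>U. P \<subseteq> Q \<longrightarrow> Q \<in> Z}"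
  have B: "V \<in> block \<longleftrightarrow> V \<subseteq> points \<and> L1 \<union> L2 \<in> V \<and> (\<forall>P\<in>V. \<forall>Q\<in>points. P \<subseteq> Q \<longrightarrow> Q \<in> V)" for V
    unfolding block_if_heyting[OF assms(1)] by simp
  have "Q = L1 \<union> L2" if "Q \<in> U" "L1 \<union> L2 \<subseteq> Q" for Q
    using that assms(2) unfolding B points_def by blast
  then have "L1 \<union> L2 \<in> W" using assms(3) top_point unfolding W_def B by blast
  then have "W \<in> block" unfolding B by (auto simp: W_def)
  moreover have "V \<subseteq> W \<longleftrightarrow> U \<inter> V \<subseteq> Z" if "V \<in> block" for V
  proof
    assume "V \<subseteq> W"
    then show "U \<inter> V \<subseteq> Z" unfolding W_def by blast
  next
    assume *: "U \<inter> V \<subseteq> Z"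
    show "V \<subseteq> W"
    proof
      fix P assume P: "P \<in> V"
      have "Q \<in> Z" if Q: "Q \<in> U" "P \<subseteq> Q" for Q
      proof -
        have "Q \<in> points" using Q(1) assms(2) unfolding B by blast
        then have "Q \<in> V" using P Q(2) \<open>V \<in> block\<close> unfolding B by blast
        then show ?thesis using * Q(1) by blast
      qed
      moreover have "P \<in> points" using P \<open>V \<in> block\<close> unfolding B by blast
      ultimately show "P \<in> W" unfolding W_def by blast
    qed
  qed
  ultimately show ?thesis by blast
qed

lemma block_trivial:
  assumes "L1 = {t}" "L2 = {t}" "U \<in> block"
  shows "U = points"
proof -
  have "points \<subseteq> {{t}}" using assms unfolding points_def X.lfilter_def by auto
  then have "points = {{t}}" using top_point assms by auto
  then have P: "points = {L1 \<union> L2}" using assms by simp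
  show ?thesis
  proof (cases heyting)
    case True
    then show ?thesis using assms(3) unfolding block_if_heyting[OF True] P by auto
  next
    case False
    then show ?thesis using assms(3) unfolding block_if_not_heyting[OF False] P by auto
  qed
qed

lemma pts_top: "pts t = points"
  using X.lfilterD(2) unfolding pts_def points_def by blast

lemma pts_m:
  assumes "x \<in> L1" "y \<in> L1"
  shows "pts (m x y) = pts x \<inter> pts y"
proof -
  have "m x y \<in> P \<longleftrightarrow> x \<in> P \<and> y \<in> P" if "P \<in> points" for P
    using X.m_mem_iff[of "P \<inter> L1" x y] that assms X.m_closed[of x y] unfolding points_def by auto
  then show ?thesis unfolding pts_def by blast
qed

lemma pts_in_block: "x \<in> L1 \<Longrightarrow> pts x \<in> block"
proof (cases heyting)
  case True
  show "x \<in> L1 \<Longrightarrow> pts x \<in> block"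
    using top_point unfolding block_if_heyting[OF True] pts_def by blast
next
  case False
  show "x \<in> L1 \<Longrightarrow> pts x \<in> block"
    unfolding block_if_not_heyting[OF False] pts_def by (rule image_eqI[of _ _ "{x}"]) simp_all
qed

definition closure_point :: "'v \<Rightarrow> 'v set"
  where "closure_point x = {y \<in> L1. x \<sqsubseteq> y} \<union> {z \<in> L2. \<exists>a\<in>L1 \<inter> L2. x \<sqsubseteq> a \<and> a \<sqsubseteq> z}"

lemma closure_point_inter:
  assumes x: "x \<in> L1"
  shows "closure_point x \<inter> L1 = {y \<in> L1. x \<sqsubseteq> y}"
    and "closure_point x \<inter> L2 = {z \<in> L2. \<exists>a\<in>L1 \<inter> L2. x \<sqsubseteq> a \<and> a \<sqsubseteq> z}"
  using x Y.refl X.trans unfolding closure_point_def by blast+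

lemma lfilter_above:
  assumes x: "x \<in> L1"
  shows "Y.lfilter {z \<in> L2. \<exists>a\<in>L1 \<inter> L2. x \<sqsubseteq> a \<and> a \<sqsubseteq> z}"
proof (rule Y.lfilterI)
  show "t \<in> {z \<in> L2. \<exists>a\<in>L1 \<inter> L2. x \<sqsubseteq> a \<and> a \<sqsubseteq> z}"
    using x X.t_closed Y.t_closed X.le_t Y.refl by blast
next
  fix y z assume "y \<in> {z \<in> L2. \<exists>a\<in>L1 \<inter> L2. x \<sqsubseteq> a \<and> a \<sqsubseteq> z}" "z \<in> L2" "y \<sqsubseteq> z"
  then show "z \<in> {z \<in> L2. \<exists>a\<in>L1 \<inter> L2. x \<sqsubseteq> a \<and> a \<sqsubseteq> z}" using Y.trans by blast
next
  fix y z assume "y \<in> {z \<in> L2. \<exists>a\<in>L1 \<inter> L2. x \<sqsubseteq> a \<and> a \<sqsubseteq> z}" "z \<in> {z \<in> L2. \<exists>a\<in>L1 \<inter> L2. x \<sqsubseteq> a \<and> a \<sqsubseteq> z}"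
  then obtain a b where ab: "y \<in> L2" "z \<in> L2" "a \<in> L1" "a \<in> L2" "x \<sqsubseteq> a" "a \<sqsubseteq> y"
    "b \<in> L1" "b \<in> L2" "x \<sqsubseteq> b" "b \<sqsubseteq> z" by blast
  have "x \<sqsubseteq> m a b" using ab x by (simp add: X.le_m_iff)
  moreover have "m a b \<sqsubseteq> m y z"
    using ab Y.trans[OF Y.m_lower(1), of a b y] Y.trans[OF Y.m_lower(2), of a b z]
    by (simp add: Y.le_m_iff)
  ultimately show "m y z \<in> {z \<in> L2. \<exists>a\<in>L1 \<inter> L2. x \<sqsubseteq> a \<and> a \<sqsubseteq> z}"
    using ab X.m_closed Y.m_closed by blast
qed blast

lemma closure_point_in_pts:
  assumes "\<not> heyting" "x \<in> L1"
  shows "closure_point x \<in> pts x"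
proof -
  have "closure_point x \<subseteq> L1 \<union> L2" "x \<in> closure_point x"
    using assms X.refl unfolding closure_point_def by blast+
  moreover have "X.lfilter (closure_point x \<inter> L1)" "Y.lfilter (closure_point x \<inter> L2)"
    using assms(2) by (simp_all add: X.lfilter_principal lfilter_above closure_point_inter)
  ultimately show ?thesis using assms(1) unfolding pts_def points_def by blast
qed

text \<open>The filter \<open>H\<close> generated by \<open>G\<close> and the trace of
  \<open>F\<close> adds no common element to \<open>F\<close>: if \<open>m y x\<close> is below a
  common \<open>z\<close>, with \<open>y\<close> in \<open>F\<close> and \<open>x\<close> in
  \<open>G\<close>, then \<open>x\<close> is below the implication from \<open>y\<close> to
  \<open>z\<close>. That implication is again a common element, so it lies in \<open>F\<close>, and
  modus ponens in \<open>F\<close> yields \<open>z\<close>. A prime extension of \<open>H\<close>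
  can then avoid the common elements outside \<open>F\<close>.\<close>

lemma prime_point_extension:
  assumes heyting and F: "X.prime_lfilter F" and G: "Y.lfilter G" and GF: "G \<inter> L1 \<subseteq> F"
  shows "\<exists>P\<in>points. P \<inter> L1 = F \<and> G \<subseteq> P"
proof -
  interpret HX: heyting_on le m j t L1 i by (rule heyting1) fact
  interpret HY: heyting_on le m j t L2 i by (rule heyting2) fact
  have F': "X.lfilter F" using F unfolding X.prime_lfilter_def by blast
  note FL = X.lfilterD[OF F'] and GL = Y.lfilterD[OF G]
  define H where "H = {z \<in> L2. \<exists>x\<in>G. \<exists>y\<in>F \<inter> L2. m y x \<sqsubseteq> z}"
  have H: "Y.lfilter H" "G \<subseteq> H" "F \<inter> L2 \<subseteq> H"
    using Y.lfilter_generated[OF G, of "F \<inter> L2"] FL(2,4) Y.t_closed Y.m_closed unfolding H_def by simp_all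
  \<comment> \<open>Missing these elements, while containing the trace of \<open>F\<close>, the
    prime filter has exactly the trace of \<open>F\<close> on the common part, so its union with
    \<open>F\<close> restricts to \<open>F\<close> on \<open>L1\<close>.\<close>
  let ?J = "(L1 \<inter> L2) - F"
  have "z \<in> F" if "z \<in> H" "z \<in> L1" for z
  proof -
    obtain x y where xy: "x \<in> G" "y \<in> F" "y \<in> L2" "m y x \<sqsubseteq> z" "z \<in> L2"
      using \<open>z \<in> H\<close> unfolding H_def by blast
    then have L: "x \<in> L2" "y \<in> L1" using FL GL by blast+
    then have i: "i y z \<in> L1" "i y z \<in> L2" using xy \<open>z \<in> L1\<close> HX.i_closed HY.i_closed by blast+
    have "x \<sqsubseteq> i y z" using xy L by (simp add: HY.le_i_iff)
    then have "i y z \<in> F" using GL(3) xy i GF by blast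
    then have "m y (i y z) \<in> F" using FL(4) xy by blast
    moreover have "m y (i y z) \<sqsubseteq> z"
      using HX.le_i_iff[of y "i y z" z] X.refl[OF i(1)] L i \<open>z \<in> L1\<close> by simp
    ultimately show "z \<in> F" using FL(3) \<open>z \<in> L1\<close> by blast
  qed
  then have "H \<inter> ?J = {}" by blast
  moreover have "j x y \<in> ?J" if "x \<in> ?J" "y \<in> ?J" for x y
    using that F X.j_closed Y.j_closed unfolding X.prime_lfilter_def by blast
  ultimately obtain G' where G': "Y.prime_lfilter G'" "H \<subseteq> G'" "G' \<inter> ?J = {}"
    using HY.prime_lfilter_extension[OF H(1), of ?J] by blast
  have "G' \<subseteq> L2" using G'(1) Y.lfilterD(1) unfolding Y.prime_lfilter_def by blast
  then have "(F \<union> G') \<inter> L1 = F" "(F \<union> G') \<inter> L2 = G'" "F \<union> G' \<subseteq> L1 \<union> L2"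
    using G' FL(1) H(3) by blast+
  moreover have "Y.lfilter G'" using G' unfolding Y.prime_lfilter_def by blast
  ultimately have "F \<union> G' \<in> points" using F F' G'(1) unfolding points_def by simp
  then show ?thesis using \<open>(F \<union> G') \<inter> L1 = F\<close> H(2) G'(2) by blast
qed

lemma pts_le_iff:
  assumes x: "x \<in> L1" and y: "y \<in> L1"
  shows "pts x \<subseteq> pts y \<longleftrightarrow> x \<sqsubseteq> y"
proof
  assume "x \<sqsubseteq> y"
  then show "pts x \<subseteq> pts y" using points_mono x y unfolding pts_def by blast
next
  assume sub: "pts x \<subseteq> pts y"
  show "x \<sqsubseteq> y"
  proof (cases heyting)
    case True
    interpret HX: heyting_on le m j t L1 i by (rule heyting1) fact
    show ?thesis
    proof (rule ccontr)
      assume "\<not> x \<sqsubseteq> y"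
      then have "\<exists>F. X.prime_lfilter F \<and> {z \<in> L1. x \<sqsubseteq> z} \<subseteq> F \<and> F \<inter> {y} = {}"
        using HX.prime_lfilter_extension[OF X.lfilter_principal[OF x], of "{y}"] y HX.j_idem by auto
      then obtain F where F: "X.prime_lfilter F" "x \<in> F" "y \<notin> F" using x X.refl by blast
      \<comment> \<open>The least filter, since nothing is prescribed on the side of
        \<open>L2\<close>.\<close>
      have "Y.lfilter {t}"
        using Y.t_closed Y.antisym Y.le_t Y.le_iff_m[of t t] Y.refl by (intro Y.lfilterI) auto
      moreover have "t \<in> F" using F X.lfilterD(2) unfolding X.prime_lfilter_def by blast
      ultimately obtain P where P: "P \<in> points" "P \<inter> L1 = F"
        using prime_point_extension[OF True F(1), of "{t}"] by blast
      then have "P \<in> pts x" "P \<notin> pts y" using F y unfolding pts_def by blast+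
      then show False using sub by blast
    qed
  next
    case False
    then have "y \<in> closure_point x \<inter> L1"
      using closure_point_in_pts[OF _ x] sub y unfolding pts_def by blast
    then show ?thesis using closure_point_inter[OF x] by blast
  qed
qed

text \<open>The elements of \<open>L2\<close> that lie above \<open>x\<close> through a common
  element form a filter. Without an interpolant it misses \<open>y\<close> and extends to a point
  that contains \<open>x\<close> but not \<open>y\<close>. So the amalgam relates the two sides only
  as the common part forces it to, which makes the amalgamation strong.\<close>

lemma pts_interpolation:
  assumes x: "x \<in> L1" and y: "y \<in> L2" and sub: "pts x \<subseteq> pts y"
  shows "\<exists>a\<in>L1 \<inter> L2. x \<sqsubseteq> a \<and> a \<sqsubseteq> y"
proof (cases heyting)
  case True
  interpret HY: heyting_on le m j t L2 i by (rule heyting2) fact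
  interpret s: block_pair le m j t L2 L1 i heyting by (rule swap)
  show ?thesis
  proof (rule ccontr)
    assume none: "\<not> ?thesis"
    let ?U = "{z \<in> L2. \<exists>a\<in>L1 \<inter> L2. x \<sqsubseteq> a \<and> a \<sqsubseteq> z}"
    have "?U \<inter> {y} = {}" using none by blast
    then have "\<exists>G. Y.prime_lfilter G \<and> ?U \<subseteq> G \<and> G \<inter> {y} = {}"
      using HY.prime_lfilter_extension[OF lfilter_above[OF x], of "{y}"] y HY.j_idem by auto
    then obtain G where G: "Y.prime_lfilter G" "?U \<subseteq> G" "y \<notin> G" by blast
    have "{z \<in> L1. x \<sqsubseteq> z} \<inter> L2 \<subseteq> G" using G(2) Y.refl by blast
    then obtain P where P: "P \<in> points" "P \<inter> L2 = G" "{z \<in> L1. x \<sqsubseteq> z} \<subseteq> P"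
      using s.prime_point_extension[OF True G(1) X.lfilter_principal[OF x]] swap_points by blast
    then have "P \<in> pts x" "P \<notin> pts y" using G x y X.refl unfolding pts_def by blast+
    then show False using sub by blast
  qed
next
  case False
  then have "y \<in> closure_point x \<inter> L2"
    using closure_point_in_pts[OF _ x] sub y unfolding pts_def by blast
  then show ?thesis using closure_point_inter[OF x] by blast
qed

text \<open>Against an arbitrary \<open>Z\<close> of the block this says that joins are preserved
  even where they are not unions. For prime filters it is primeness. Otherwise every generator of
  \<open>Z\<close> lies in the closure points of \<open>x\<close> and of \<open>y\<close>; if it
  lies beyond common elements \<open>a\<close> and \<open>b\<close>, then their join is common and
  interpolates as well.\<close>

lemma pts_j_le:
  assumes x: "x \<in> L1" and y: "y \<in> L1" and Z: "Z \<in> block" "pts x \<subseteq> Z" "pts y \<subseteq> Z"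
  shows "pts (j x y) \<subseteq> Z"
proof
  fix P assume "P \<in> pts (j x y)"
  then have P: "P \<in> points" "j x y \<in> P" by (simp_all add: pts_def)
  show "P \<in> Z"
  proof (cases heyting)
    case True
    then have "X.prime_lfilter (P \<inter> L1)" using P(1) unfolding points_def by blast
    then have "x \<in> P \<or> y \<in> P"
      using P x y X.j_closed[OF x y] unfolding X.prime_lfilter_def by blast
    then show ?thesis using P Z unfolding pts_def by blast
  next
    case False
    obtain S where S: "S \<subseteq> L1 \<union> L2" "Z = {P \<in> points. S \<subseteq> P}"
      by (rule blockE[OF Z(1) False])
    have cl: "S \<subseteq> closure_point x" "S \<subseteq> closure_point y"
      using closure_point_in_pts[OF False] x y Z(2,3) S(2) by blast+
    have "u \<in> P" if u: "u \<in> S" for u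
    proof (cases "u \<in> L1")
      case True
      then have "x \<sqsubseteq> u" "y \<sqsubseteq> u" using cl u closure_point_inter(1) x y by blast+
      then show ?thesis
        using points_mono[OF P(1,2), of u] True x y by (simp add: X.j_le_iff)
    next
      case False
      then have "u \<in> L2" using S u by blast
      then have "u \<in> closure_point x \<inter> L2" "u \<in> closure_point y \<inter> L2" using cl u by blast+
      then obtain a b where ab: "a \<in> L1" "a \<in> L2" "x \<sqsubseteq> a" "a \<sqsubseteq> u" "b \<in> L1" "b \<in> L2" "y \<sqsubseteq> b" "b \<sqsubseteq> u"
        unfolding closure_point_inter(2)[OF x] closure_point_inter(2)[OF y] by blast
      have "j x y \<sqsubseteq> j a b"
        using ab x y X.trans[OF _ X.j_upper(1), of x a b] X.trans[OF _ X.j_upper(2), of y b a]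
        by (simp add: X.j_le_iff)
      then have "j a b \<in> P"
        using points_mono[OF P, of "j a b"] ab x y by simp
      moreover have "j a b \<sqsubseteq> u" using ab \<open>u \<in> L2\<close> by (simp add: Y.j_le_iff)
      ultimately show ?thesis
        using points_mono[OF P(1), of "j a b" u] ab \<open>u \<in> L2\<close> by simp
    qed
    then show ?thesis using S(2) P(1) by blast
  qed
qed

text \<open>If a point \<open>P\<close> omits the implication, then adjoining \<open>x\<close> to
  its filter on \<open>L1\<close> does not yield \<open>z\<close>. A prime extension omitting
  \<open>z\<close> is completed by \<open>prime_point_extension\<close> to a point \<open>Q\<close>
  above \<open>P\<close>, and \<open>Q\<close> refutes the inclusion. Quantifying over the whole
  block makes the image a relative pseudocomplement there, not just among images.\<close>

lemma pts_i:
  assumes heyting and x: "x \<in> L1" and z: "z \<in> L1" and V: "V \<in> block"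
  shows "V \<subseteq> pts (i x z) \<longleftrightarrow> pts x \<inter> V \<subseteq> pts z"
proof -
  interpret HX: heyting_on le m j t L1 i by (rule heyting1) fact
  have ixz: "i x z \<in> L1" using x z HX.i_closed by blast
  have VP: "V \<subseteq> points" using V block_le_points by blast
  show ?thesis
  proof
    assume *: "V \<subseteq> pts (i x z)"
    have "m x (i x z) \<sqsubseteq> z" using HX.le_i_iff[of x "i x z" z] X.refl x z ixz by blast
    then have "pts x \<inter> pts (i x z) \<subseteq> pts z"
      using pts_le_iff[of "m x (i x z)" z] pts_m[OF x ixz] X.m_closed x z ixz by simp
    then show "pts x \<inter> V \<subseteq> pts z" using * by blast
  next
    assume *: "pts x \<inter> V \<subseteq> pts z"
    show "V \<subseteq> pts (i x z)"
    proof (rule ccontr)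
      assume "\<not> ?thesis"
      then obtain P where P: "P \<in> V" "P \<in> points" "i x z \<notin> P" using VP unfolding pts_def by blast
      then have F: "X.lfilter (P \<inter> L1)" "Y.lfilter (P \<inter> L2)" unfolding points_def by blast+
      let ?H = "{w \<in> L1. \<exists>p\<in>P \<inter> L1. m x p \<sqsubseteq> w}"
      note H = HX.lfilter_adjoin[OF F(1) x]
      have "z \<notin> ?H"
        using HX.le_i_iff[OF x _ z] X.lfilterD(3)[OF F(1), of _ "i x z"] ixz P(3) by blast
      then have "\<exists>F. X.prime_lfilter F \<and> ?H \<subseteq> F \<and> F \<inter> {z} = {}"
        using HX.prime_lfilter_extension[OF H(1), of "{z}"] z HX.j_idem by auto
      then obtain F' where F': "X.prime_lfilter F'" "?H \<subseteq> F'" "z \<notin> F'" by blast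
      then have "P \<inter> L1 \<subseteq> F'" "x \<in> F'" using H(2,3) by blast+
      then obtain Q where Q: "Q \<in> points" "Q \<inter> L1 = F'" "P \<inter> L2 \<subseteq> Q"
        using prime_point_extension[OF assms(1) F'(1) F(2)] by blast
      have "P \<subseteq> Q" using Q \<open>P \<inter> L1 \<subseteq> F'\<close> P(2) unfolding points_def by blast
      then have "Q \<in> V" using V Q(1) P(1) unfolding block_if_heyting[OF assms(1)] by blast
      moreover have "Q \<in> pts x" "Q \<notin> pts z" using Q \<open>x \<in> F'\<close> F'(3) z unfolding pts_def by blast+
      ultimately show False using * by blast
    qed
  qed
qed

text \<open>Interpolating both inclusions gives a cycle from \<open>x\<close> through
  \<open>a\<close>, \<open>y\<close> and \<open>b\<close> back to \<open>x\<close>. Transitivity is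
  available within each lattice only: \<open>L2\<close> puts \<open>a\<close> below
  \<open>b\<close>, \<open>L1\<close> puts \<open>b\<close> below \<open>a\<close>, and the cycle
  collapses.\<close>

lemma pts_eq_imp_eq:
  assumes x: "x \<in> L1" and y: "y \<in> L2" and eq: "pts x = pts y"
  shows "x = y"
proof -
  interpret s: block_pair le m j t L2 L1 i heyting by (rule swap)
  obtain a where a: "a \<in> L1" "a \<in> L2" "x \<sqsubseteq> a" "a \<sqsubseteq> y" using pts_interpolation x y eq by blast
  obtain b where b: "b \<in> L1" "b \<in> L2" "y \<sqsubseteq> b" "b \<sqsubseteq> x"
    using s.pts_interpolation[OF y x] eq swap_pts by auto
  have "a \<sqsubseteq> b" using Y.trans a b y by blast
  moreover have "b \<sqsubseteq> a" using X.trans a b x by blast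
  ultimately have "a = b" using X.antisym a b by blast
  then show ?thesis using X.antisym Y.antisym a b x y by metis
qed

end

section \<open>Ordinal sums\<close>

context conic_idempotent_residuated_lattice
begin

lemma gamma_meet_same:
  assumes "conjunctive A" "x \<in> carrier A" "y \<in> carrier A" "gamma A x = s" "gamma A y = s"
  shows "gamma A (x \<curlywedge> y) = s"
  using assms le_refl[of s] gamma_closed[of x] unfolding conjunctive_def by (auto simp: rl_le_def)

lemma gamma_join_same:
  assumes "x \<in> carrier A" "y \<in> carrier A" "gamma A x = s" "gamma A y = s"
  shows "gamma A (x \<curlyvee> y) = s"
proof -
  have s: "s \<in> carrier A" "gamma A s = s" using assms gamma_closed gamma_idem by auto
  have "gamma A (x \<curlyvee> y) \<preceq> s"
    using assms s le_gamma[of x] le_gamma[of y] le_gamma_fixed_iff[OF _ s, of "x \<curlyvee> y"]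
    by (simp add: join_le_iff)
  moreover have "s \<preceq> gamma A (x \<curlyvee> y)"
    using assms gamma_mono[of x "x \<curlyvee> y"] by (simp add: join_upper)
  ultimately show ?thesis using s assms by (simp add: le_antisym)
qed

text \<open>If the residual \<open>w\<close> were not below \<open>s\<close>, irreducibility of
  \<open>s\<close> would keep the meet of \<open>x\<close> and \<open>w\<close> from being below
  \<open>s\<close>. So \<open>w\<close> is below \<open>s\<close>, which is below \<open>x\<close>;
  the meet is \<open>w\<close> itself, and it is below \<open>z\<close>. Residuals between different
  fibres thus involve no structure inside them.\<close>

lemma under_below_fixed:
  assumes "conjunctive A" and s: "s \<in> carrier A" "gamma A s = s"
    and xz: "x \<in> carrier A" "z \<in> carrier A" "x \<preceq> \<one>" "z \<preceq> \<one>" "z \<preceq> s" "\<not> x \<preceq> s"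
  shows "x \<setminus> z = z"
proof (rule le_antisym)
  have nle: "\<not> x \<preceq> z" using xz s le_trans by blast
  let ?w = "x \<setminus> z"
  have w: "?w \<in> carrier A" using xz under_closed by blast
  have xw: "x \<curlywedge> ?w \<preceq> z" using le_under_neg_iff[of x ?w z] nle xz w le_refl by blast
  then have "x \<curlywedge> ?w \<preceq> s" using xz s w le_trans[of "x \<curlywedge> ?w" z s] by simp
  then have "?w \<preceq> s" using gamma_fixed_irreducible[OF assms(1) s, of x ?w] xz w by blast
  moreover have "s \<preceq> x" using gamma_fixed_comparable[OF _ s, of x] xz by blast
  ultimately have "?w \<preceq> x" using le_trans[of ?w s x] xz w s by blast
  then show "?w \<preceq> z" using xw w xz by (simp add: rl_le_def meet_comm[of x])
  show "z \<preceq> ?w" using le_under_neg_iff[of x z z] nle xz meet_lower by blast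
qed (use xz in \<open>simp_all\<close>)

text \<open>A residual not below \<open>s\<close> would be above \<open>s\<close>, hence above
  \<open>x\<close>, and then \<open>x\<close> would be below \<open>z\<close>.\<close>

lemma gamma_under_same:
  assumes xz: "x \<in> carrier A" "z \<in> carrier A" "gamma A x = s" "gamma A z = s" "s \<preceq> \<one>" "\<not> x \<preceq> z"
  shows "gamma A (x \<setminus> z) = s"
proof -
  let ?w = "x \<setminus> z"
  have s: "s \<in> carrier A" "gamma A s = s" using xz gamma_closed gamma_idem by auto
  have w: "?w \<in> carrier A" using xz under_closed by blast
  have n: "x \<preceq> \<one>" "z \<preceq> \<one>" using gamma_neg_iff[of x] gamma_neg_iff[of z] xz by simp_all
  have "z \<preceq> ?w" using le_under_neg_iff[of x z z] n xz meet_lower by blast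
  then have "s \<preceq> gamma A ?w" using gamma_mono[of z ?w] xz w by simp
  moreover have "?w \<preceq> s"
  proof (rule ccontr)
    assume "\<not> ?w \<preceq> s"
    then have "s \<preceq> ?w" using gamma_fixed_comparable[OF w s] by blast
    then have "x \<preceq> ?w" using le_gamma[of x] le_trans[of x s ?w] xz s w by simp
    then have "x \<curlywedge> ?w = x" by (simp add: rl_le_def)
    then show False using le_under_neg_iff[of x ?w z] n xz w le_refl[of ?w] by simp
  qed
  ultimately show ?thesis
    using s w by (simp add: le_antisym le_gamma_fixed_iff)
qed

lemma lattice_on_block:
  assumes "conjunctive A" and s: "s \<in> carrier A" "gamma A s = s"
  shows "lattice_on (rl_le A) (meet_op A) (join_op A) s {x \<in> carrier A. gamma A x = s}"
proof
  fix x assume "x \<in> {x \<in> carrier A. gamma A x = s}"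
  then show "x \<preceq> s" using le_gamma by auto
qed (use assms in \<open>auto simp: le_refl le_meet_iff join_le_iff gamma_meet_same
  gamma_join_same intro: le_trans le_antisym\<close>)

lemma heyting_on_block:
  assumes "conjunctive A" and s: "s \<in> carrier A" "gamma A s = s" and neg: "s \<preceq> \<one>"
  shows "heyting_on (rl_le A) (meet_op A) (join_op A) s {x \<in> carrier A. gamma A x = s}
    (\<lambda>x z. if x \<preceq> z then s else x \<setminus> z)"
proof (intro heyting_on.intro lattice_on_block[OF assms(1-3)] heyting_on_axioms.intro)
  fix x y assume "x \<in> {x \<in> carrier A. gamma A x = s}" "y \<in> {x \<in> carrier A. gamma A x = s}"
  then show "(if x \<preceq> y then s else x \<setminus> y) \<in> {x \<in> carrier A. gamma A x = s}"
    using s neg gamma_under_same[of x y s] by auto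
next
  fix x y z assume "x \<in> {x \<in> carrier A. gamma A x = s}" "y \<in> {x \<in> carrier A. gamma A x = s}"
    "z \<in> {x \<in> carrier A. gamma A x = s}"
  then have L: "x \<in> carrier A" "y \<in> carrier A" "z \<in> carrier A" "gamma A x = s" "gamma A y = s" "gamma A z = s"
    by simp_all
  then have n: "x \<preceq> \<one>" "z \<preceq> \<one>" "y \<preceq> s" using gamma_neg_iff[of x] gamma_neg_iff[of z] le_gamma[of y] neg by simp_all
  have "x \<curlywedge> y \<preceq> z" if "x \<preceq> z"
    using that L le_trans[OF meet_lower(1), of x y z] by simp
  then show "y \<preceq> (if x \<preceq> z then s else x \<setminus> z) \<longleftrightarrow> x \<curlywedge> y \<preceq> z"
    using n L le_under_neg_iff[of x y z] by simp
qed

text \<open>This serves a skeleton element that is missing in one factor: there its fibre is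
  replaced by the singleton.\<close>

lemma heyting_on_singleton:
  assumes "s \<in> carrier A"
  shows "heyting_on (rl_le A) (meet_op A) (join_op A) s {s} (\<lambda>x z. if x \<preceq> z then s else x \<setminus> z)"
proof -
  have "s \<curlywedge> s = s" "s \<curlyvee> s = s" "s \<preceq> s"
    using le_refl[OF assms] le_join_iff[OF assms assms] by (simp_all add: rl_le_def)
  then show ?thesis by unfold_locales auto
qed

end

text \<open>The assumptions on gaps ensure that nothing lies strictly between the two negations of an element,
  as associativity of the product requires.\<close>

locale ordinal_sum =
  fixes S :: "'s set" and sle :: "'s \<Rightarrow> 's \<Rightarrow> bool" (infix "\<unlhd>" 50)
    and e :: 's and ls rs :: "'s \<Rightarrow> 's"
    and K :: "'s \<Rightarrow> 'b set set" and T :: "'s \<Rightarrow> 'b set"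
  assumes sle_refl: "s \<in> S \<Longrightarrow> s \<unlhd> s"
    and sle_antisym: "\<lbrakk>s \<unlhd> u; u \<unlhd> s; s \<in> S; u \<in> S\<rbrakk> \<Longrightarrow> s = u"
    and sle_trans: "\<lbrakk>s \<unlhd> u; u \<unlhd> v; s \<in> S; u \<in> S; v \<in> S\<rbrakk> \<Longrightarrow> s \<unlhd> v"
    and sle_total: "\<lbrakk>s \<in> S; u \<in> S\<rbrakk> \<Longrightarrow> s \<unlhd> u \<or> u \<unlhd> s"
    and e_in: "e \<in> S" and ls_in: "s \<in> S \<Longrightarrow> ls s \<in> S" and rs_in: "s \<in> S \<Longrightarrow> rs s \<in> S"
    and ls_e: "ls e = e" and rs_e: "rs e = e"
    and sle_galois: "\<lbrakk>s \<in> S; u \<in> S\<rbrakk> \<Longrightarrow> u \<unlhd> rs s \<longleftrightarrow> s \<unlhd> ls u"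
    and gap_ls: "\<lbrakk>p \<in> S; s \<in> S; \<not> ls p \<unlhd> rs p; s \<unlhd> ls p\<rbrakk> \<Longrightarrow> s = ls p \<or> s \<unlhd> rs p"
    and gap_rs: "\<lbrakk>p \<in> S; s \<in> S; \<not> rs p \<unlhd> ls p; s \<unlhd> rs p\<rbrakk> \<Longrightarrow> s = rs p \<or> s \<unlhd> ls p"
    and T_in: "s \<in> S \<Longrightarrow> T s \<in> K s"
    and K_le: "\<lbrakk>s \<in> S; U \<in> K s\<rbrakk> \<Longrightarrow> U \<subseteq> T s"
    and K_Int: "\<lbrakk>s \<in> S; U \<in> K s; V \<in> K s\<rbrakk> \<Longrightarrow> U \<inter> V \<in> K s"
    and K_lub: "\<lbrakk>s \<in> S; U \<in> K s; V \<in> K s\<rbrakk> \<Longrightarrow> \<exists>W. W \<in> K s \<and> (\<forall>Z\<in>K s. W \<subseteq> Z \<longleftrightarrow> U \<subseteq> Z \<and> V \<subseteq> Z)"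
    and K_rpc: "\<lbrakk>s \<in> S; s \<unlhd> e; U \<in> K s; Z \<in> K s\<rbrakk>
      \<Longrightarrow> \<exists>W. W \<in> K s \<and> (\<forall>V\<in>K s. V \<subseteq> W \<longleftrightarrow> U \<inter> V \<subseteq> Z)"
    and K_gap_ls: "\<lbrakk>p \<in> S; \<not> ls p \<unlhd> rs p; U \<in> K (ls p)\<rbrakk> \<Longrightarrow> U = T (ls p)"
    and K_gap_rs: "\<lbrakk>p \<in> S; \<not> rs p \<unlhd> ls p; U \<in> K (rs p)\<rbrakk> \<Longrightarrow> U = T (rs p)"
begin

definition D :: "('s \<times> 'b set) set"
  where "D = Sigma S K"

definition dle :: "'s \<times> 'b set \<Rightarrow> 's \<times> 'b set \<Rightarrow> bool" (infix "\<sqsubseteq>" 50)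
  where "x \<sqsubseteq> y \<longleftrightarrow> (if fst x = fst y then snd x \<subseteq> snd y else fst x \<unlhd> fst y)"

definition top_of :: "'s \<Rightarrow> 's \<times> 'b set"
  where "top_of s = (s, T s)"

lemma dle_Pair: "(s, U) \<sqsubseteq> (u, V) \<longleftrightarrow> (if s = u then U \<subseteq> V else s \<unlhd> u)"
  by (simp add: dle_def)

lemma mem_D: "(s, U) \<in> D \<longleftrightarrow> s \<in> S \<and> U \<in> K s"
  by (simp add: D_def)

lemma fst_top_of [simp]: "fst (top_of s) = s"
  by (simp add: top_of_def)

lemma top_of_in: "s \<in> S \<Longrightarrow> top_of s \<in> D"
  by (simp add: top_of_def mem_D T_in)

lemma dle_top_of_iff: "x \<in> D \<Longrightarrow> s \<in> S \<Longrightarrow> x \<sqsubseteq> top_of s \<longleftrightarrow> fst x \<unlhd> s"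
  by (cases x) (auto simp: top_of_def dle_def mem_D sle_refl dest: K_le)

lemma top_of_comparable: "\<lbrakk>x \<in> D; s \<in> S\<rbrakk> \<Longrightarrow> x \<sqsubseteq> top_of s \<or> top_of s \<sqsubseteq> x"
  using sle_total[of "fst x" s] by (cases x) (auto simp: top_of_def dle_def mem_D dest: K_le)

lemma dle_refl: "x \<in> D \<Longrightarrow> x \<sqsubseteq> x"
  by (simp add: dle_def)

lemma dle_trans: "\<lbrakk>x \<sqsubseteq> y; y \<sqsubseteq> z; x \<in> D; y \<in> D; z \<in> D\<rbrakk> \<Longrightarrow> x \<sqsubseteq> z"
  by (cases x; cases y; cases z) (auto simp: dle_Pair mem_D split: if_splits dest: sle_antisym sle_trans)

lemma dle_antisym: "\<lbrakk>x \<sqsubseteq> y; y \<sqsubseteq> x; x \<in> D; y \<in> D\<rbrakk> \<Longrightarrow> x = y"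
  by (cases x; cases y) (auto simp: dle_Pair mem_D split: if_splits dest: sle_antisym)

lemma incomparable_same_block: "\<lbrakk>x \<in> D; y \<in> D; \<not> x \<sqsubseteq> y; \<not> y \<sqsubseteq> x\<rbrakk> \<Longrightarrow> fst x = fst y"
  using sle_total[of "fst x" "fst y"] by (cases x; cases y) (auto simp: dle_Pair mem_D split: if_splits)

lemma le_Int_iff:
  "\<lbrakk>z \<in> D; (s, U) \<in> D; (s, V) \<in> D\<rbrakk> \<Longrightarrow> z \<sqsubseteq> (s, U \<inter> V) \<longleftrightarrow> z \<sqsubseteq> (s, U) \<and> z \<sqsubseteq> (s, V)"
  by (cases z) (auto simp: dle_Pair)

lemma lub_le_iff_block:
  assumes "z \<in> D" "s \<in> S" "\<And>Z. Z \<in> K s \<Longrightarrow> W \<subseteq> Z \<longleftrightarrow> U \<subseteq> Z \<and> V \<subseteq> Z"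
  shows "(s, W) \<sqsubseteq> z \<longleftrightarrow> (s, U) \<sqsubseteq> z \<and> (s, V) \<sqsubseteq> z"
  using assms by (cases z) (auto simp: dle_Pair mem_D)

lemma glb_exists:
  assumes "x \<in> D" "y \<in> D"
  shows "\<exists>w. w \<in> D \<and> (\<forall>z\<in>D. z \<sqsubseteq> w \<longleftrightarrow> z \<sqsubseteq> x \<and> z \<sqsubseteq> y) \<and> (fst w = fst x \<or> fst w = fst y)"
proof (cases "x \<sqsubseteq> y \<or> y \<sqsubseteq> x")
  case True
  then show ?thesis using assms dle_trans by blast
next
  case False
  then obtain s U V where "x = (s, U)" "y = (s, V)"
    using incomparable_same_block assms by (metis prod.collapse)
  moreover from this have "(s, U \<inter> V) \<in> D" using assms by (simp add: mem_D K_Int)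
  ultimately show ?thesis using assms le_Int_iff by (intro exI[of _ "(s, U \<inter> V)"]) auto
qed

lemma lub_exists:
  assumes "x \<in> D" "y \<in> D"
  shows "\<exists>w. w \<in> D \<and> (\<forall>z\<in>D. w \<sqsubseteq> z \<longleftrightarrow> x \<sqsubseteq> z \<and> y \<sqsubseteq> z)"
proof (cases "x \<sqsubseteq> y \<or> y \<sqsubseteq> x")
  case True
  then show ?thesis using assms dle_trans by blast
next
  case False
  then obtain s U V where xy: "x = (s, U)" "y = (s, V)"
    using incomparable_same_block assms by (metis prod.collapse)
  then obtain W where "W \<in> K s" "\<forall>Z\<in>K s. W \<subseteq> Z \<longleftrightarrow> U \<subseteq> Z \<and> V \<subseteq> Z"
    using K_lub[of s U V] assms by (auto simp: mem_D)
  then show ?thesis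
    using assms lub_le_iff_block[of _ s W U V] unfolding xy
    by (intro exI[of _ "(s, W)"]) (auto simp: mem_D)
qed

text \<open>Being below \<open>top_of s\<close> depends on the fibre alone, and the greatest lower
  bound lies in the fibre of \<open>x\<close> or of \<open>y\<close>. This is what makes the sum
  conjunctive.\<close>

lemma irreducible:
  assumes "s \<in> S" "x \<in> D" "y \<in> D" "\<not> x \<sqsubseteq> top_of s" "\<not> y \<sqsubseteq> top_of s"
  shows "\<exists>z\<in>D. z \<sqsubseteq> x \<and> z \<sqsubseteq> y \<and> \<not> z \<sqsubseteq> top_of s"
proof -
  obtain w where w: "w \<in> D" "\<forall>z\<in>D. z \<sqsubseteq> w \<longleftrightarrow> z \<sqsubseteq> x \<and> z \<sqsubseteq> y" "fst w = fst x \<or> fst w = fst y"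
    using glb_exists assms by blast
  then have "w \<sqsubseteq> x" "w \<sqsubseteq> y" using dle_refl by blast+
  moreover have "\<not> w \<sqsubseteq> top_of s" using w assms by (auto simp: dle_top_of_iff)
  ultimately show ?thesis using w(1) by blast
qed

text \<open>The abstract pair \<open>a\<close>, \<open>b\<close> stands for the two negations of an
  element in either order. Only the case of \<open>a\<close> strictly above \<open>b\<close> is
  delicate: the fibre of \<open>y\<close> is then above \<open>a\<close> or equal to it, and in the
  latter case triviality forces \<open>y\<close> to be \<open>top_of a\<close>.\<close>

lemma gap:
  assumes "a \<in> S" "b \<in> S" and x: "x \<in> D" "x \<sqsubseteq> top_of a" and y: "y \<in> D" "\<not> y \<sqsubseteq> top_of b"
    and gap: "\<And>s. \<lbrakk>s \<in> S; \<not> a \<unlhd> b; s \<unlhd> a\<rbrakk> \<Longrightarrow> s = a \<or> s \<unlhd> b"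
    and K: "\<And>U. \<lbrakk>\<not> a \<unlhd> b; U \<in> K a\<rbrakk> \<Longrightarrow> U = T a"
  shows "x \<sqsubseteq> y"
proof -
  obtain s U where xs: "x = (s, U)" "s \<in> S" "U \<in> K s" using x(1) by (cases x) (auto simp: mem_D)
  obtain u V where yu: "y = (u, V)" "u \<in> S" "V \<in> K u" using y(1) by (cases y) (auto simp: mem_D)
  have s: "s \<unlhd> a" using x xs assms(1) by (simp add: dle_top_of_iff)
  have u: "\<not> u \<unlhd> b" using y yu assms(2) by (simp add: dle_top_of_iff)
  show ?thesis
  proof (cases "a \<unlhd> b")
    case True
    then have "s \<unlhd> b" using s xs assms(1,2) sle_trans by blast
    moreover from this have "s \<noteq> u" using u by blast
    moreover have "b \<unlhd> u" using u sle_total yu(2) assms(2) by blast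
    ultimately show ?thesis using sle_trans[of s b u] xs yu assms(2) by (simp add: dle_Pair)
  next
    case False
    show ?thesis
    proof (cases "u \<unlhd> a")
      case True
      then have "u = a" using gap[OF yu(2) False] u by blast
      then have "V = T a" using K False yu by blast
      then show ?thesis using x yu \<open>u = a\<close> by (simp add: top_of_def)
    next
      case ua: False
      then have "a \<unlhd> u" "s \<noteq> u" using sle_total yu(2) assms(1) s by blast+
      then show ?thesis using s sle_trans[of s a u] xs yu assms(1) by (simp add: dle_Pair)
    qed
  qed
qed

text \<open>Within one fibre the pseudocomplement of the fibre works for all \<open>y\<close>, as
  other fibres lie wholly above or below it. If the fibre of \<open>z\<close> is strictly below that
  of \<open>x\<close>, then \<open>z\<close> itself works: irreducibility forces an eligible
  \<open>y\<close> to be below \<open>x\<close>.\<close>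

lemma rpc_exists:
  assumes x: "x \<in> D" and z: "z \<in> D" and "x \<sqsubseteq> top_of e" "z \<sqsubseteq> top_of e" "\<not> x \<sqsubseteq> z"
  shows "\<exists>w. w \<in> D \<and> (\<forall>y\<in>D. y \<sqsubseteq> w \<longleftrightarrow> (\<forall>v\<in>D. v \<sqsubseteq> x \<and> v \<sqsubseteq> y \<longrightarrow> v \<sqsubseteq> z))"
proof -
  obtain s U where xs: "x = (s, U)" "s \<in> S" "U \<in> K s" using x(1) by (cases x) (auto simp: mem_D)
  obtain u V where zu: "z = (u, V)" "u \<in> S" "V \<in> K u" using z(1) by (cases z) (auto simp: mem_D)
  have se: "s \<unlhd> e" using assms xs e_in by (simp add: dle_top_of_iff)
  show ?thesis
  proof (cases "s = u")
    case True
    then have "\<exists>W. W \<in> K s \<and> (\<forall>Q\<in>K s. Q \<subseteq> W \<longleftrightarrow> U \<inter> Q \<subseteq> V)"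
      using K_rpc[OF xs(2) se xs(3), of V] zu(3) by simp
    then obtain W where W: "W \<in> K s" "\<And>Q. Q \<in> K s \<Longrightarrow> Q \<subseteq> W \<longleftrightarrow> U \<inter> Q \<subseteq> V"
      by blast
    have "y \<sqsubseteq> (s, W) \<longleftrightarrow> (\<forall>v\<in>D. v \<sqsubseteq> x \<and> v \<sqsubseteq> y \<longrightarrow> v \<sqsubseteq> z)" if y: "y \<in> D" for y
    proof -
      obtain q Q where yq: "y = (q, Q)" "q \<in> S" "Q \<in> K q" using y by (cases y) (auto simp: mem_D)
      consider "q = s" | "q \<noteq> s" "q \<unlhd> s" | "q \<noteq> s" "s \<unlhd> q" using sle_total yq(2) xs(2) by blast
      then show ?thesis
      proof cases
        case 1
        have Q: "(s, U \<inter> Q) \<in> D" using 1 xs yq by (simp add: mem_D K_Int)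
        have iff: "v \<sqsubseteq> x \<and> v \<sqsubseteq> y \<longleftrightarrow> v \<sqsubseteq> (s, U \<inter> Q)" if "v \<in> D" for v
          using le_Int_iff[of v s U Q] that x y xs yq 1 by simp
        have "(\<forall>v\<in>D. v \<sqsubseteq> x \<and> v \<sqsubseteq> y \<longrightarrow> v \<sqsubseteq> z) \<longleftrightarrow> (s, U \<inter> Q) \<sqsubseteq> z"
          using iff Q z dle_trans[of _ "(s, U \<inter> Q)" z] dle_refl[OF Q] by blast
        also have "\<dots> \<longleftrightarrow> U \<inter> Q \<subseteq> V" using zu True by (simp add: dle_Pair)
        finally show ?thesis using W(2)[of Q] yq 1 by (simp add: dle_Pair)
      next
        case 2
        then have yz: "y \<sqsubseteq> z" "y \<sqsubseteq> (s, W)" using yq zu True by (simp_all add: dle_Pair)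
        then show ?thesis using dle_trans[OF _ yz(1)] y z by blast
      next
        case 3
        then have "x \<sqsubseteq> y" "\<not> y \<sqsubseteq> (s, W)" using xs yq sle_antisym by (auto simp: dle_Pair)
        then show ?thesis using assms(5) x dle_refl by blast
      qed
    qed
    moreover have "(s, W) \<in> D" using W xs by (simp add: mem_D)
    ultimately show ?thesis by blast
  next
    case False
    then have us: "u \<unlhd> s" "\<not> s \<unlhd> u" using assms(5) xs zu sle_total by (auto simp: dle_Pair)
    have "y \<sqsubseteq> z \<longleftrightarrow> (\<forall>v\<in>D. v \<sqsubseteq> x \<and> v \<sqsubseteq> y \<longrightarrow> v \<sqsubseteq> z)" if y: "y \<in> D" for y
    proof
      assume "y \<sqsubseteq> z"
      then show "\<forall>v\<in>D. v \<sqsubseteq> x \<and> v \<sqsubseteq> y \<longrightarrow> v \<sqsubseteq> z" using y z dle_trans by blast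
    next
      assume *: "\<forall>v\<in>D. v \<sqsubseteq> x \<and> v \<sqsubseteq> y \<longrightarrow> v \<sqsubseteq> z"
      obtain q Q where yq: "y = (q, Q)" "q \<in> S" "Q \<in> K q" using y by (cases y) (auto simp: mem_D)
      have "y \<sqsubseteq> x"
      proof (rule ccontr)
        assume n: "\<not> y \<sqsubseteq> x"
        have "\<not> y \<sqsubseteq> top_of u"
        proof
          assume "y \<sqsubseteq> top_of u"
          moreover have "top_of u \<sqsubseteq> x" using us False xs by (simp add: top_of_def dle_Pair)
          ultimately show False using n dle_trans[of y "top_of u" x] x y zu(2) top_of_in by blast
        qed
        moreover have "\<not> x \<sqsubseteq> top_of u" using us x xs zu(2) by (simp add: dle_top_of_iff)
        ultimately obtain v where v: "v \<in> D" "v \<sqsubseteq> x" "v \<sqsubseteq> y" "\<not> v \<sqsubseteq> top_of u"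
          using irreducible[OF zu(2) x y] by blast
        moreover have "z \<sqsubseteq> top_of u" using z zu by (simp add: dle_top_of_iff sle_refl)
        ultimately show False using * dle_trans[of v z "top_of u"] z zu(2) top_of_in by blast
      qed
      then show "y \<sqsubseteq> z" using * y dle_refl by blast
    qed
    then show ?thesis using z by blast
  qed
qed

text \<open>The negations depend only on the fibre and take tops as values, in accordance with
  \<open>rneg_gamma\<close>, \<open>lneg_gamma\<close>, \<open>gamma_rneg\<close> and
  \<open>gamma_lneg\<close>.\<close>

sublocale negation_lattice D "(\<sqsubseteq>)" "top_of e" "\<lambda>x. top_of (ls (fst x))" "\<lambda>x. top_of (rs (fst x))"
proof
  fix x y assume xy: "x \<in> D" "y \<in> D"
  then have f: "fst x \<in> S" "fst y \<in> S" by (auto simp: D_def)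
  show "\<exists>w. w \<in> D \<and> (\<forall>z\<in>D. z \<sqsubseteq> w \<longleftrightarrow> z \<sqsubseteq> x \<and> z \<sqsubseteq> y)" using glb_exists xy by blast
  show "\<exists>w. w \<in> D \<and> (\<forall>z\<in>D. w \<sqsubseteq> z \<longleftrightarrow> x \<sqsubseteq> z \<and> y \<sqsubseteq> z)" using lub_exists xy by blast
  show "x \<sqsubseteq> top_of e \<or> top_of e \<sqsubseteq> x" using top_of_comparable xy e_in by blast
  show "y \<sqsubseteq> top_of (rs (fst x)) \<longleftrightarrow> x \<sqsubseteq> top_of (ls (fst y))"
    using xy f by (simp add: dle_top_of_iff ls_in rs_in sle_galois)
  show "y \<sqsubseteq> top_of (ls (fst x)) \<or> top_of (ls (fst x)) \<sqsubseteq> y"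
    "y \<sqsubseteq> top_of (rs (fst x)) \<or> top_of (rs (fst x)) \<sqsubseteq> y"
    using xy f by (simp_all add: top_of_comparable ls_in rs_in)
next
  fix x assume "x \<in> D"
  then have "fst x \<in> S" by (auto simp: D_def)
  then show "top_of (ls (fst x)) \<in> D" "top_of (rs (fst x)) \<in> D" by (simp_all add: top_of_in ls_in rs_in)
next
  fix p x y assume p: "p \<in> D" and xy: "x \<in> D" "y \<in> D"
  then have f: "fst p \<in> S" "ls (fst p) \<in> S" "rs (fst p) \<in> S" by (auto simp: D_def ls_in rs_in)
  show "\<not> x \<sqsubseteq> top_of (ls (fst p)) \<Longrightarrow> \<not> y \<sqsubseteq> top_of (ls (fst p)) \<Longrightarrow>
      \<exists>z\<in>D. z \<sqsubseteq> x \<and> z \<sqsubseteq> y \<and> \<not> z \<sqsubseteq> top_of (ls (fst p))"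
    "\<not> x \<sqsubseteq> top_of (rs (fst p)) \<Longrightarrow> \<not> y \<sqsubseteq> top_of (rs (fst p)) \<Longrightarrow>
      \<exists>z\<in>D. z \<sqsubseteq> x \<and> z \<sqsubseteq> y \<and> \<not> z \<sqsubseteq> top_of (rs (fst p))"
    using irreducible f xy by blast+
  show "x \<sqsubseteq> y" if "x \<sqsubseteq> top_of (ls (fst p))" "\<not> y \<sqsubseteq> top_of (rs (fst p))"
    using gap[OF f(2,3) xy(1) that(1) xy(2) that(2)] gap_ls[OF f(1)] K_gap_ls[OF f(1)] by blast
  show "x \<sqsubseteq> y" if "x \<sqsubseteq> top_of (rs (fst p))" "\<not> y \<sqsubseteq> top_of (ls (fst p))"
    using gap[OF f(3,2) xy(1) that(1) xy(2) that(2)] gap_rs[OF f(1)] K_gap_rs[OF f(1)] by blast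
next
  show "top_of e \<in> D" "top_of (ls (fst (top_of e))) = top_of e" "top_of (rs (fst (top_of e))) = top_of e"
    by (simp_all add: top_of_in e_in) (simp_all add: top_of_def ls_e rs_e)
qed (fact dle_refl dle_antisym dle_trans rpc_exists)+

lemma rigid_sum:
  assumes "\<And>s. s \<in> S \<Longrightarrow> st s = (if ls s \<unlhd> rs s then ls s else rs s)"
    and "\<And>s. s \<in> S \<Longrightarrow> st (st (rs s)) = rs s" "\<And>s. s \<in> S \<Longrightarrow> st (st (ls s)) = ls s"
  shows "rigid alg"
proof -
  define ST :: "'s \<times> 'b set \<Rightarrow> 's \<times> 'b set" where "ST = (\<lambda>x. if top_of (ls (fst x)) \<sqsubseteq> top_of (rs (fst x)) then top_of (ls (fst x))
    else top_of (rs (fst x)))"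
  have ST: "ST (top_of s) = top_of (st s) \<and> st s \<in> S" if "s \<in> S" for s
    using that assms(1)[OF that] ls_in rs_in
    by (simp add: ST_def dle_top_of_iff top_of_in)
  have "ST (ST (top_of (rs (fst x)))) = top_of (rs (fst x))"
    "ST (ST (top_of (ls (fst x)))) = top_of (ls (fst x))" if "x \<in> D" for x
  proof -
    have "fst x \<in> S" using that by (auto simp: D_def)
    then show "ST (ST (top_of (rs (fst x)))) = top_of (rs (fst x))"
      "ST (ST (top_of (ls (fst x)))) = top_of (ls (fst x))"
      using assms(2,3) by (simp_all add: ST rs_in ls_in)
  qed
  then show ?thesis unfolding ST_def by (rule rigid_alg)
qed

end

text \<open>Joins and residuals are tested against all of \<open>K s\<close>, since the image of a
  fibre need not exhaust it. The fibre maps \<open>E\<close> are kept abstract so that both factors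
  can be treated by one proof.\<close>

lemma (in ordinal_sum) embedding_into_sum:
  fixes A :: "('s, 'm) residuated_lattice_scheme" (structure) and E :: "'s \<Rightarrow> 's \<Rightarrow> 'b set"
  assumes "conic_idempotent_residuated_lattice A" and conj: "conjunctive A"
    and skel: "\<And>s. \<lbrakk>s \<in> carrier A; gamma A s = s\<rbrakk> \<Longrightarrow> s \<in> S \<and> ls s = lneg A s \<and> rs s = rneg A s \<and> E s s = T s"
    and sle: "\<And>s u. \<lbrakk>s \<in> carrier A; gamma A s = s; u \<in> carrier A; gamma A u = u\<rbrakk> \<Longrightarrow> s \<unlhd> u \<longleftrightarrow> s \<preceq> u"
    and e: "e = \<one>"
    and E_in: "\<And>x. x \<in> carrier A \<Longrightarrow> E (gamma A x) x \<in> K (gamma A x)"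
    and E_le: "\<And>s x y. \<lbrakk>x \<in> carrier A; y \<in> carrier A; gamma A x = s; gamma A y = s\<rbrakk>
      \<Longrightarrow> E s x \<subseteq> E s y \<longleftrightarrow> x \<preceq> y"
    and E_meet: "\<And>s x y. \<lbrakk>x \<in> carrier A; y \<in> carrier A; gamma A x = s; gamma A y = s\<rbrakk>
      \<Longrightarrow> E s (x \<curlywedge> y) = E s x \<inter> E s y"
    and E_join: "\<And>s x y Z. \<lbrakk>x \<in> carrier A; y \<in> carrier A; gamma A x = s; gamma A y = s; Z \<in> K s; E s x \<subseteq> Z; E s y \<subseteq> Z\<rbrakk>
      \<Longrightarrow> E s (x \<curlyvee> y) \<subseteq> Z"
    and E_under: "\<And>s x z V. \<lbrakk>x \<in> carrier A; z \<in> carrier A; gamma A x = s; gamma A z = s; V \<in> K s; s \<preceq> \<one>;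
      \<not> x \<preceq> z\<rbrakk> \<Longrightarrow> V \<subseteq> E s (x \<setminus> z) \<longleftrightarrow> E s x \<inter> V \<subseteq> E s z"
  shows "rl_embedding A alg (\<lambda>x. (gamma A x, E (gamma A x) x))"
proof -
  interpret A: conic_idempotent_residuated_lattice A by fact
  define g where "g = (\<lambda>x. (gamma A x, E (gamma A x) x))"
  have fg: "fst (g x) = gamma A x" for x by (simp add: g_def)
  have gs: "gamma A x \<in> carrier A" "gamma A (gamma A x) = gamma A x" "gamma A x \<in> S" if "x \<in> carrier A" for x
    using that skel[of "gamma A x"] by (simp_all add: A.gamma_idem)
  have gD: "g x \<in> D" if "x \<in> carrier A" for x
    using that gs E_in by (simp add: g_def mem_D)
  \<comment> \<open>Between different fibres the order is that of the skeleton, as in the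
    sum.\<close>
  have below: "x \<preceq> y \<longleftrightarrow> gamma A x \<preceq> gamma A y"
    if "x \<in> carrier A" "y \<in> carrier A" "gamma A x \<noteq> gamma A y" for x y
  proof
    assume le: "gamma A x \<preceq> gamma A y"
    have "\<not> y \<preceq> gamma A x"
      using le that A.le_gamma_fixed_iff[of y "gamma A x"] A.le_antisym gs by metis
    then have "gamma A x \<preceq> y" using A.gamma_fixed_comparable[of y "gamma A x"] that gs by blast
    then show "x \<preceq> y" using A.le_trans[OF A.le_gamma, of x y] that gs by blast
  qed (use that A.gamma_mono in blast)
  have g_le: "g x \<sqsubseteq> g y \<longleftrightarrow> x \<preceq> y" if xy: "x \<in> carrier A" "y \<in> carrier A" for x y
  proof (cases "gamma A x = gamma A y")
    case True
    then show ?thesis using E_le[OF xy HOL.refl] by (simp add: g_def dle_Pair)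
  next
    case False
    then show ?thesis using below[OF xy] sle[of "gamma A x" "gamma A y"] gs xy by (simp add: g_def dle_Pair)
  qed
  have inj: "inj_on g (carrier A)"
    by (rule inj_onI) (metis A.le_antisym A.le_refl g_le)
  have g_fix: "g s = top_of s" if "s \<in> carrier A" "gamma A s = s" for s
    using that skel by (simp add: g_def top_of_def)
  have g_one: "g \<one> = \<one>\<^bsub>alg\<^esub>" using g_fix[OF A.one_closed] A.gamma_one by (simp flip: e)
  have g_meet: "g (x \<curlywedge> y) = g x \<curlywedge>\<^bsub>alg\<^esub> g y" if xy: "x \<in> carrier A" "y \<in> carrier A" for x y
  proof -
    consider "x \<preceq> y" | "y \<preceq> x" | "\<not> x \<preceq> y" "\<not> y \<preceq> x" by blast
    then show ?thesis
    proof cases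
      case 1
      then show ?thesis using glb_absorb[of "g x" "g y"] gD xy g_le by (simp add: rl_le_def)
    next
      case 2
      then show ?thesis using glb_absorb'[of "g x" "g y"] gD xy g_le by (simp add: rl_le_def A.meet_comm[of x])
    next
      case 3
      then have s: "gamma A x = gamma A y"
        using incomparable_same_block[of "g x" "g y"] gD xy g_le fg by simp
      then have m: "g (x \<curlywedge> y) = (gamma A x, E (gamma A x) x \<inter> E (gamma A x) y)"
        using E_meet[OF xy HOL.refl] A.gamma_meet_same[OF conj xy HOL.refl] by (simp add: g_def)
      have gy: "g x = (gamma A x, E (gamma A x) x)" "g y = (gamma A x, E (gamma A x) y)"
        using s by (simp_all add: g_def)
      show ?thesis
      proof (simp, rule eq_if_same_lower)
        show "g (x \<curlywedge> y) \<in> D" using gD A.meet_closed xy by blast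
        show "glb (g x) (g y) \<in> D" using glb_closed gD xy by blast
        show "z \<sqsubseteq> g (x \<curlywedge> y) \<longleftrightarrow> z \<sqsubseteq> glb (g x) (g y)" if "z \<in> D" for z
          using le_Int_iff[OF that, of "gamma A x"] gD[OF xy(1)] gD[OF xy(2)] le_glb_iff[OF _ _ that, of "g x" "g y"]
          unfolding m gy by simp
      qed
    qed
  qed
  have g_join: "g (x \<curlyvee> y) = g x \<curlyvee>\<^bsub>alg\<^esub> g y" if xy: "x \<in> carrier A" "y \<in> carrier A" for x y
  proof -
    consider "x \<preceq> y" | "y \<preceq> x" | "\<not> x \<preceq> y" "\<not> y \<preceq> x" by blast
    then show ?thesis
    proof cases
      case 1
      then show ?thesis using lub_absorb[of "g x" "g y"] gD xy g_le by (simp add: A.le_join_iff)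
    next
      case 2
      then show ?thesis
        using lub_absorb[of "g y" "g x"] gD xy g_le by (simp add: A.le_join_iff A.join_comm[of x] lub_comm[of "g x"])
    next
      case 3
      then have s: "gamma A x = gamma A y"
        using incomparable_same_block[of "g x" "g y"] gD xy g_le fg by simp
      let ?s = "gamma A x"
      have gj: "gamma A (x \<curlyvee> y) = ?s" using A.gamma_join_same[OF xy HOL.refl] s by simp
      then have m: "g (x \<curlyvee> y) = (?s, E ?s (x \<curlyvee> y))" by (simp add: g_def)
      have gy: "g x = (?s, E ?s x)" "g y = (?s, E ?s y)" using s by (simp_all add: g_def)
      have iff: "E ?s (x \<curlyvee> y) \<subseteq> Z \<longleftrightarrow> E ?s x \<subseteq> Z \<and> E ?s y \<subseteq> Z" if "Z \<in> K ?s" for Z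
      proof -
        have "E ?s x \<subseteq> E ?s (x \<curlyvee> y)" "E ?s y \<subseteq> E ?s (x \<curlyvee> y)"
          using E_le[of x "x \<curlyvee> y" ?s] E_le[of y "x \<curlyvee> y" ?s] gj s xy
          by (simp_all add: A.join_upper)
        then show ?thesis using E_join[OF xy HOL.refl _ that] s by auto
      qed
      show ?thesis
      proof (simp, rule eq_if_same_upper)
        show "g (x \<curlyvee> y) \<in> D" using gD A.join_closed xy by blast
        show "lub (g x) (g y) \<in> D" using lub_closed gD xy by blast
        show "g (x \<curlyvee> y) \<sqsubseteq> z \<longleftrightarrow> lub (g x) (g y) \<sqsubseteq> z" if "z \<in> D" for z
          using lub_le_iff_block[OF that gs(3)[OF xy(1)] iff] gD[OF xy(1)] gD[OF xy(2)] lub_le_iff[OF _ _ that, of "g x" "g y"]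
          unfolding m gy by simp
      qed
    qed
  qed
  have g_neg: "g (rneg A x) = rneg alg (g x)" "g (lneg A x) = lneg alg (g x)" if x: "x \<in> carrier A" for x
    using x gs gD g_fix[of "rneg A x"] g_fix[of "lneg A x"] skel[of "gamma A x"]
    by (simp_all add: rneg_alg lneg_alg fg A.gamma_rneg A.gamma_lneg
      A.rneg_gamma A.lneg_gamma)
  have g_gamma: "g (gamma A x) = gamma alg (g x)" if "x \<in> carrier A" for x
    using that by (simp add: gamma_def g_neg[symmetric] g_meet[symmetric] del: alg_simps)
  have neg: "g x \<preceq>\<^bsub>alg\<^esub> \<one>\<^bsub>alg\<^esub> \<longleftrightarrow> x \<preceq> \<one>" if "x \<in> carrier A" for x
    using that g_le[of x "\<one>"] gD by (simp add: g_one[symmetric] del: alg_simps(3))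
  \<comment> \<open>For different fibres both residuals are trivial by
    \<open>under_below_fixed\<close>, used in \<open>A\<close> and in the sum. For equal fibres the
    two sides have the same lower bounds \<open>y\<close>, and only those \<open>y\<close> in the
    fibre itself need \<open>E_under\<close>.\<close>
  have g_under: "g (x \<setminus> z) = g x \<setminus>\<^bsub>alg\<^esub> g z"
    if xz: "x \<in> carrier A" "z \<in> carrier A" "x \<preceq> \<one>" "z \<preceq> \<one>" "\<not> x \<preceq> z" for x z
  proof (cases "gamma A x = gamma A z")
    case False
    let ?s = "gamma A z"
    note s = gs[OF xz(2)]
    have "\<not> x \<preceq> ?s"
      using below[OF xz(1,2) False] A.le_gamma_fixed_iff[of x ?s] xz s by simp
    moreover have "z \<preceq> ?s" using xz A.le_gamma by blast
    ultimately have "x \<setminus> z = z" and "\<not> g x \<sqsubseteq> g ?s" and "g z \<sqsubseteq> g ?s"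
      using A.under_below_fixed[OF conj s(1,2) xz(1-4)] g_le xz s by simp_all
    moreover have "gamma alg (g ?s) = g ?s" using g_gamma[OF s(1)] s by simp
    ultimately show ?thesis
      using alg.under_below_fixed[OF conjunctive_alg, of "g ?s" "g x" "g z"] gD xz s neg by simp
  next
    case True
    let ?s = "gamma A x" and ?w = "x \<setminus> z"
    have sneg: "?s \<preceq> \<one>" using A.gamma_neg_iff xz by blast
    have w: "?w \<in> carrier A" using xz A.under_closed by blast
    have gw: "gamma A ?w = ?s"
      by (rule A.gamma_under_same[OF xz(1,2) HOL.refl True[symmetric] sneg xz(5)])
    have g: "g x = (?s, E ?s x)" "g z = (?s, E ?s z)" "g ?w = (?s, E ?s ?w)"
      unfolding g_def gw True[symmetric] by (rule HOL.refl)+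
    have "y \<sqsubseteq> g ?w \<longleftrightarrow> glb (g x) y \<sqsubseteq> g z" if y: "y \<in> D" for y
    proof -
      obtain q Q where yq: "y = (q, Q)" "q \<in> S" "Q \<in> K q" using y by (cases y) (auto simp: mem_D)
      have "q \<unlhd> ?s \<or> ?s \<unlhd> q" using sle_total yq(2) gs(3)[OF xz(1)] by blast
      then consider "q = ?s" | "q \<noteq> ?s" "q \<unlhd> ?s" | "q \<noteq> ?s" "?s \<unlhd> q" by blast
      then show ?thesis
      proof cases
        case 1
        have int: "(?s, E ?s x \<inter> Q) \<in> D"
          using gD[OF xz(1)] yq 1 by (simp add: g mem_D K_Int)
        have "glb (g x) y = (?s, E ?s x \<inter> Q)"
        proof (rule eq_if_same_lower)
          show "v \<sqsubseteq> glb (g x) y \<longleftrightarrow> v \<sqsubseteq> (?s, E ?s x \<inter> Q)" if "v \<in> D" for v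
            using that le_glb_iff[OF gD[OF xz(1)] y that] le_Int_iff[OF that, of ?s "E ?s x" Q]
              gD[OF xz(1)] y yq 1 by (simp add: g)
        qed (use int y gD[OF xz(1)] glb_closed in auto)
        then show ?thesis
          using E_under[OF xz(1,2) HOL.refl True[symmetric] _ sneg xz(5), of Q] yq 1 by (simp add: g dle_Pair)
      next
        case 2
        then have "y \<sqsubseteq> g x" "y \<sqsubseteq> g z" "y \<sqsubseteq> g ?w" using yq by (simp_all add: g dle_Pair)
        then show ?thesis using glb_absorb'[of "g x" y] gD xz y by simp
      next
        case 3
        then have "\<not> q \<unlhd> ?s" using sle_antisym yq(2) gs(3)[OF xz(1)] by blast
        then have "g x \<sqsubseteq> y" "\<not> y \<sqsubseteq> g ?w" using 3 yq by (simp_all add: g dle_Pair)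
        then show ?thesis using glb_absorb[of "g x" y] gD xz y g_le by simp
      qed
    qed
    moreover have "y \<sqsubseteq> under alg (g x) (g z) \<longleftrightarrow> glb (g x) y \<sqsubseteq> g z" if y: "y \<in> D" for y
    proof -
      have "under alg (g x) (g z) \<in> D" using under gD xz by blast
      then show ?thesis
        using alg.le_under_neg_iff[of "g x" y "g z"] y gD[OF xz(1)] gD[OF xz(2)] neg[OF xz(1)] neg[OF xz(2)] xz g_le
        by simp
    qed
    ultimately show ?thesis
      using eq_if_same_lower[of "g ?w" "under alg (g x) (g z)"] gD[OF w] under[OF gD[OF xz(1)] gD[OF xz(2)]]
      by simp
  qed
  have "rl_embedding A alg g"
    by (rule rl_embeddingI) (use assms(1) alg_conic_idempotent gD inj g_one g_meet g_join g_neg g_under in \<open>auto simp del: alg_simps(3-)\<close>)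
  then show ?thesis by (simp add: g_def)
qed

section \<open>Amalgamation of skeletons\<close>

lemma carrier_update_simps [simp]:
  "rl_le (A\<lparr>carrier := Z\<rparr>) = rl_le A"
  "rneg (A\<lparr>carrier := Z\<rparr>) = rneg A"
  "lneg (A\<lparr>carrier := Z\<rparr>) = lneg A"
  "star (A\<lparr>carrier := Z\<rparr>) = star A"
  "gamma (A\<lparr>carrier := Z\<rparr>) = gamma A"
  by (simp_all add: fun_eq_iff rl_le_def rneg_def lneg_def star_def gamma_def)

text \<open>After renaming elements, the common subalgebra may be taken to be \<open>X \<inter> Y\<close>.\<close>

locale common_carrier =
  fixes R :: "'v residuated_lattice" (structure) and X Y :: "'v set"
  assumes X_conic: "conic_idempotent_residuated_lattice (R\<lparr>carrier := X\<rparr>)"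
    and X_rigid: "rigid (R\<lparr>carrier := X\<rparr>)" and X_conj: "conjunctive (R\<lparr>carrier := X\<rparr>)"
    and Y_conic: "conic_idempotent_residuated_lattice (R\<lparr>carrier := Y\<rparr>)"
    and Y_rigid: "rigid (R\<lparr>carrier := Y\<rparr>)" and Y_conj: "conjunctive (R\<lparr>carrier := Y\<rparr>)"
begin

sublocale X: conic_idempotent_residuated_lattice "R\<lparr>carrier := X\<rparr>"
  rewrites "carrier (R\<lparr>carrier := X\<rparr>) = X" and "one (R\<lparr>carrier := X\<rparr>) = \<one>"
    and "mult (R\<lparr>carrier := X\<rparr>) = mult R"
    and "meet_op (R\<lparr>carrier := X\<rparr>) = meet_op R" and "join_op (R\<lparr>carrier := X\<rparr>) = join_op R"
    and "under (R\<lparr>carrier := X\<rparr>) = under R" and "over (R\<lparr>carrier := X\<rparr>) = over R"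
    and "rl_le (R\<lparr>carrier := X\<rparr>) = rl_le R"
    and "rneg (R\<lparr>carrier := X\<rparr>) = rneg R" and "lneg (R\<lparr>carrier := X\<rparr>) = lneg R"
    and "star (R\<lparr>carrier := X\<rparr>) = star R" and "gamma (R\<lparr>carrier := X\<rparr>) = gamma R"
  by (rule X_conic) simp_all

sublocale Y: conic_idempotent_residuated_lattice "R\<lparr>carrier := Y\<rparr>"
  rewrites "carrier (R\<lparr>carrier := Y\<rparr>) = Y" and "one (R\<lparr>carrier := Y\<rparr>) = \<one>"
    and "mult (R\<lparr>carrier := Y\<rparr>) = mult R"
    and "meet_op (R\<lparr>carrier := Y\<rparr>) = meet_op R" and "join_op (R\<lparr>carrier := Y\<rparr>) = join_op R"
    and "under (R\<lparr>carrier := Y\<rparr>) = under R" and "over (R\<lparr>carrier := Y\<rparr>) = over R"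
    and "rl_le (R\<lparr>carrier := Y\<rparr>) = rl_le R"
    and "rneg (R\<lparr>carrier := Y\<rparr>) = rneg R" and "lneg (R\<lparr>carrier := Y\<rparr>) = lneg R"
    and "star (R\<lparr>carrier := Y\<rparr>) = star R" and "gamma (R\<lparr>carrier := Y\<rparr>) = gamma R"
  by (rule Y_conic) simp_all

lemma swap: "common_carrier R Y X"
  by unfold_locales (fact X_conj Y_conj X_rigid Y_rigid)+

definition skel :: "'v set"
  where "skel = {s \<in> X \<union> Y. gamma R s = s}"

text \<open>The inequalities that every amalgam must satisfy because a common element witnesses
  them; for elements of different factors \<open>x \<preceq> y\<close> by itself has no
  meaning.\<close>

definition sep :: "'v \<Rightarrow> 'v \<Rightarrow> bool"
  where "sep x y \<longleftrightarrow> (\<exists>a\<in>X \<inter> Y. x \<preceq> a \<and> a \<preceq> y)"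

text \<open>Elements of the two skeletons in the same cut of the common subalgebra are ordered by placing the
  negative elements of \<open>X\<close> below those of \<open>Y\<close>; the order of the positive ones has to be reversed,
  as the negations swap the two cones.\<close>

definition sle :: "'v \<Rightarrow> 'v \<Rightarrow> bool" (infix "\<unlhd>" 50)
  where "s \<unlhd> u \<longleftrightarrow>
    (if s \<in> X \<and> u \<in> X \<or> s \<in> Y \<and> u \<in> Y then s \<preceq> u
     else if s \<in> X then (if s \<preceq> \<one> \<and> u \<preceq> \<one> then \<not> sep u s else sep s u)
     else (if s \<preceq> \<one> \<and> u \<preceq> \<one> then sep s u else \<not> sep u s))"

lemma skelD: "s \<in> skel \<Longrightarrow> s \<in> X \<or> s \<in> Y" "s \<in> skel \<Longrightarrow> gamma R s = s"
  by (auto simp: skel_def)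

lemma one_in: "\<one> \<in> X" "\<one> \<in> Y"
  using X.one_closed Y.one_closed .

lemma sle_X: "\<lbrakk>s \<in> X; u \<in> X\<rbrakk> \<Longrightarrow> s \<unlhd> u \<longleftrightarrow> s \<preceq> u"
  and sle_Y: "\<lbrakk>s \<in> Y; u \<in> Y\<rbrakk> \<Longrightarrow> s \<unlhd> u \<longleftrightarrow> s \<preceq> u"
  by (simp_all add: sle_def)

lemma sep_X: "\<lbrakk>x \<in> X; y \<in> X; x \<in> Y \<or> y \<in> Y\<rbrakk> \<Longrightarrow> sep x y \<longleftrightarrow> x \<preceq> y"
  unfolding sep_def using X.le_trans X.le_refl by blast

lemma sep_Y: "\<lbrakk>x \<in> Y; y \<in> Y; x \<in> X \<or> y \<in> X\<rbrakk> \<Longrightarrow> sep x y \<longleftrightarrow> x \<preceq> y"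
  unfolding sep_def using Y.le_trans Y.le_refl by blast

lemma not_le_iff_X: "\<lbrakk>x \<in> X; y \<in> X; gamma R x = x; x \<noteq> y\<rbrakk> \<Longrightarrow> \<not> x \<preceq> y \<longleftrightarrow> y \<preceq> x"
  using X.gamma_fixed_comparable[of y x] X.le_antisym[of x y] by blast

lemma not_le_iff_Y: "\<lbrakk>x \<in> Y; y \<in> Y; gamma R x = x; x \<noteq> y\<rbrakk> \<Longrightarrow> \<not> x \<preceq> y \<longleftrightarrow> y \<preceq> x"
  using Y.gamma_fixed_comparable[of y x] Y.le_antisym[of x y] by blast

text \<open>If one of the elements is common, \<open>sep\<close> reduces to the order of a factor,
  so the clause for different factors covers this case too.\<close>

lemma sle_XY:
  assumes "s \<in> X" "u \<in> Y" "gamma R s = s" "gamma R u = u" "s \<notin> Y \<or> u \<notin> X"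
  shows "s \<unlhd> u \<longleftrightarrow> (if s \<preceq> \<one> \<and> u \<preceq> \<one> then \<not> sep u s else sep s u)"
    and "u \<unlhd> s \<longleftrightarrow> \<not> s \<unlhd> u"
proof -
  have ne: "s \<noteq> u" using assms by blast
  show "s \<unlhd> u \<longleftrightarrow> (if s \<preceq> \<one> \<and> u \<preceq> \<one> then \<not> sep u s else sep s u)"
    using assms ne not_le_iff_X[of u s] not_le_iff_Y[of u s] sep_X[of u s] sep_X[of s u] sep_Y[of u s] sep_Y[of s u]
    by (auto simp: sle_def)
  show "u \<unlhd> s \<longleftrightarrow> \<not> s \<unlhd> u"
    using assms ne not_le_iff_X[of s u] not_le_iff_Y[of s u]
    by (auto simp: sle_def)
qed

lemma sep_mono:
  "\<lbrakk>sep x y; y \<preceq> z; y \<in> X; z \<in> X\<rbrakk> \<Longrightarrow> sep x z"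
  "\<lbrakk>sep x y; y \<preceq> z; y \<in> Y; z \<in> Y\<rbrakk> \<Longrightarrow> sep x z"
  "\<lbrakk>sep y z; x \<preceq> y; x \<in> X; y \<in> X\<rbrakk> \<Longrightarrow> sep x z"
  "\<lbrakk>sep y z; x \<preceq> y; x \<in> Y; y \<in> Y\<rbrakk> \<Longrightarrow> sep x z"
  unfolding sep_def using X.le_trans Y.le_trans by blast+

lemma sep_neg: "\<lbrakk>sep x y; y \<preceq> \<one>; x \<in> X \<and> y \<in> Y \<or> x \<in> Y \<and> y \<in> X\<rbrakk> \<Longrightarrow> x \<preceq> \<one>"
  unfolding sep_def using X.below_neg Y.below_neg by blast

lemma sep_one: "\<lbrakk>x \<preceq> \<one>; \<one> \<preceq> y\<rbrakk> \<Longrightarrow> sep x y"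
  using one_in unfolding sep_def by blast

text \<open>Where the same clause of \<open>sle\<close> applies, this is monotonicity of
  \<open>sep\<close>. Where the clause changes with the sign, \<open>sep_neg\<close> decides, the
  unit being common.\<close>

lemma sle_trans_XXY:
  assumes "x \<in> X" "x' \<in> X" "y \<in> Y" "y \<notin> X" "gamma R x = x" "gamma R x' = x'" "gamma R y = y"
    and "x \<preceq> x'" "x' \<unlhd> y"
  shows "x \<unlhd> y"
proof -
  have "sep y x \<longrightarrow> sep y x'" "sep x' y \<longrightarrow> sep x y" using sep_mono assms by blast+
  moreover have "sep x' y \<longrightarrow> y \<preceq> \<one> \<longrightarrow> x' \<preceq> \<one>" using sep_neg assms by blast
  moreover have "x' \<preceq> \<one> \<longrightarrow> x \<preceq> \<one>" using X.below_neg assms by blast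
  ultimately show ?thesis
    using sle_XY(1)[of x y] sle_XY(1)[of x' y] assms
    by (cases "x \<preceq> \<one>"; cases "x' \<preceq> \<one>"; cases "y \<preceq> \<one>") simp_all
qed

lemma sle_trans_XYY:
  assumes "x \<in> X" "x \<notin> Y" "y \<in> Y" "y' \<in> Y" "gamma R x = x" "gamma R y = y" "gamma R y' = y'"
    and "y \<preceq> y'" "x \<unlhd> y"
  shows "x \<unlhd> y'"
proof -
  have "sep y' x \<longrightarrow> sep y x" "sep x y \<longrightarrow> sep x y'" using sep_mono assms by blast+
  moreover have "y' \<preceq> \<one> \<longrightarrow> y \<preceq> \<one>" using Y.below_neg assms by blast
  moreover have "x \<preceq> \<one> \<longrightarrow> \<not> y' \<preceq> \<one> \<longrightarrow> sep x y'" using sep_one Y.conic assms by blast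
  ultimately show ?thesis
    using sle_XY(1)[of x y] sle_XY(1)[of x y'] assms
    by (cases "x \<preceq> \<one>"; cases "y \<preceq> \<one>"; cases "y' \<preceq> \<one>") simp_all
qed

lemma skel_cases2:
  assumes "s \<in> skel" "u \<in> skel"
  obtains "s \<in> X" "u \<in> X" | "s \<in> Y" "u \<in> Y" | "s \<in> X" "s \<notin> Y" "u \<in> Y" "u \<notin> X"
    | "u \<in> X" "u \<notin> Y" "s \<in> Y" "s \<notin> X"
  using skelD(1)[OF assms(1)] skelD(1)[OF assms(2)] by blast

lemma sle_total:
  assumes "s \<in> skel" "u \<in> skel"
  shows "s \<unlhd> u \<or> u \<unlhd> s"
proof -
  note g = skelD(2)[OF assms(1)] skelD(2)[OF assms(2)]
  show ?thesis
    using assms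
  proof (cases rule: skel_cases2)
    case 1
    then show ?thesis using X.gamma_fixed_comparable[of s u] g by (simp add: sle_X)
  next
    case 2
    then show ?thesis using Y.gamma_fixed_comparable[of s u] g by (simp add: sle_Y)
  next
    case 3
    then show ?thesis using sle_XY(2)[of s u] g by blast
  next
    case 4
    then show ?thesis using sle_XY(2)[of u s] g by blast
  qed
qed

lemma sle_antisym:
  assumes "s \<unlhd> u" "u \<unlhd> s" "s \<in> skel" "u \<in> skel"
  shows "s = u"
proof -
  note g = skelD(2)[OF assms(3)] skelD(2)[OF assms(4)]
  show ?thesis
    using assms(3,4)
  proof (cases rule: skel_cases2)
    case 1
    then show ?thesis using X.le_antisym[of s u] assms by (simp add: sle_X)
  next
    case 2
    then show ?thesis using Y.le_antisym[of s u] assms by (simp add: sle_Y)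
  next
    case 3
    then show ?thesis using sle_XY(2)[of s u] g assms by blast
  next
    case 4
    then show ?thesis using sle_XY(2)[of u s] g assms by blast
  qed
qed

text \<open>By \<open>sle_XY(2)\<close> the order across the factors flips under logical negation.
  Hence all mixed patterns are instances or contrapositives of \<open>sle_trans_XXY\<close> and
  \<open>sle_trans_XYY\<close>.\<close>

lemma sle_trans:
  assumes su: "s \<unlhd> u" and uv: "u \<unlhd> v" and S: "s \<in> skel" "u \<in> skel" "v \<in> skel"
  shows "s \<unlhd> v"
proof -
  note g = skelD(2)[OF S(1)] skelD(2)[OF S(2)] skelD(2)[OF S(3)]
  note XY = sle_XY(2)
  consider "s \<in> X" "u \<in> X" "v \<in> X" | "s \<in> Y" "u \<in> Y" "v \<in> Y"
    | "s \<in> X" "u \<in> X" "v \<in> Y" "v \<notin> X" | "s \<in> Y" "u \<in> Y" "v \<in> X" "v \<notin> Y"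
    | "u \<in> X" "v \<in> X" "s \<in> Y" "s \<notin> X" | "u \<in> Y" "v \<in> Y" "s \<in> X" "s \<notin> Y"
    | "s \<in> X" "v \<in> X" "u \<in> Y" "u \<notin> X" | "s \<in> Y" "v \<in> Y" "u \<in> X" "u \<notin> Y"
    using skelD(1)[OF S(1)] skelD(1)[OF S(2)] skelD(1)[OF S(3)]
    by (cases "s \<in> X"; cases "u \<in> X"; cases "v \<in> X") auto
  then show ?thesis
  proof cases
    case 1
    then show ?thesis using su uv X.le_trans sle_X by blast
  next
    case 2
    then show ?thesis using su uv Y.le_trans sle_Y by blast
  next
    case 3
    then show ?thesis using sle_trans_XXY[of s u v] su uv g sle_X by blast
  next
    case 4
    then show ?thesis
      using sle_trans_XYY[of v s u] su uv g sle_Y[of s u] XY[of v u] XY[of v s] by blast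
  next
    case 5
    then show ?thesis
      using sle_trans_XXY[of u v s] su uv g sle_X[of u v] XY[of u s] XY[of v s] by blast
  next
    case 6
    then show ?thesis using sle_trans_XYY[of s u v] su uv g sle_Y by blast
  next
    case 7
    have "\<not> v \<unlhd> u" using XY[of v u] uv 7 g by blast
    then have "\<not> v \<preceq> s" using sle_trans_XXY[of v s u] su 7 g by blast
    then show ?thesis using 7 X.gamma_fixed_comparable[of s v] g sle_X by blast
  next
    case 8
    have "\<not> u \<unlhd> s" using XY[of u s] su 8 g by blast
    then have "\<not> v \<preceq> s" using sle_trans_XYY[of u v s] uv 8 g by blast
    then show ?thesis using 8 Y.gamma_fixed_comparable[of s v] g sle_Y by blast
  qed
qed

section \<open>The negations on the amalgamated skeleton\<close>

lemma neg_in_skel: "s \<in> skel \<Longrightarrow> lneg R s \<in> skel" "s \<in> skel \<Longrightarrow> rneg R s \<in> skel"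
  by (auto simp: skel_def X.gamma_lneg Y.gamma_lneg X.gamma_rneg Y.gamma_rneg)

text \<open>Rigidity recovers \<open>s\<close> from either negation by operations under which
  \<open>Y\<close> is closed.\<close>

lemma neg_notin:
  assumes "s \<in> X" "s \<notin> Y" "gamma R s = s"
  shows "lneg R s \<notin> Y" "rneg R s \<notin> Y"
  using X.recover_from_lneg[OF X_rigid assms(1,3)] X.recover_from_rneg[OF X_rigid assms(1,3)]
    assms(2) Y.star_closed Y.lneg_closed Y.rneg_closed by metis+

text \<open>The unit is common, so by \<open>neg_notin\<close> it is not a negation of
  \<open>p\<close>, and the cones are exchanged strictly.\<close>

lemma neg_sign:
  assumes "p \<in> X" "p \<notin> Y" "gamma R p = p"
  shows "rneg R p \<preceq> \<one> \<longleftrightarrow> \<not> p \<preceq> \<one>" (is ?r) and "lneg R p \<preceq> \<one> \<longleftrightarrow> \<not> p \<preceq> \<one>" (is ?l)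
proof -
  have "rneg R p \<noteq> \<one>" "lneg R p \<noteq> \<one>" using neg_notin[OF assms] one_in by auto
  then show ?r ?l
    using X.pos_rneg_neg[of p] X.neg_rneg_pos[of p] X.pos_lneg_neg[of p] X.neg_lneg_pos[of p]
      X.conic[of p] X.le_antisym[of "rneg R p" \<one>] X.le_antisym[of "lneg R p" \<one>] assms(1)
    by auto
qed

text \<open>The interpolant is negated. For the second equivalence the Galois connection points the
  wrong way; but a common element differs from the proper elements \<open>rneg R s\<close> and
  \<open>lneg R u\<close>, so the failing converse inequality can be transported, and comparability
  of negations turns it around.\<close>

lemma sep_galois:
  assumes s: "s \<in> X" "s \<notin> Y" "gamma R s = s" and u: "u \<in> Y" "u \<notin> X" "gamma R u = u"
  shows "sep u (rneg R s) \<longleftrightarrow> sep s (lneg R u)"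
    and "sep (rneg R s) u \<longleftrightarrow> sep (lneg R u) s"
proof -
  have c: "rneg R s \<in> X" "lneg R u \<in> Y" using s u X.rneg_closed Y.lneg_closed by blast+
  have "lneg R u \<notin> X"
    using common_carrier.neg_notin[OF swap] u by blast
  have "rneg R s \<notin> Y" using neg_notin s by blast
  show "sep u (rneg R s) \<longleftrightarrow> sep s (lneg R u)"
  proof
    assume "sep u (rneg R s)"
    then obtain a where a: "a \<in> X" "a \<in> Y" "u \<preceq> a" "a \<preceq> rneg R s" unfolding sep_def by blast
    then have "s \<preceq> lneg R a" "lneg R a \<preceq> lneg R u"
      using s u X.le_rneg_iff_le_lneg Y.lneg_antimono by blast+
    then show "sep s (lneg R u)" using a X.lneg_closed Y.lneg_closed unfolding sep_def by blast
  next
    assume "sep s (lneg R u)"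
    then obtain a where a: "a \<in> X" "a \<in> Y" "s \<preceq> a" "a \<preceq> lneg R u" unfolding sep_def by blast
    then have "u \<preceq> rneg R a" "rneg R a \<preceq> rneg R s"
      using s u Y.le_rneg_iff_le_lneg X.rneg_antimono by blast+
    then show "sep u (rneg R s)" using a X.rneg_closed Y.rneg_closed unfolding sep_def by blast
  qed
  show "sep (rneg R s) u \<longleftrightarrow> sep (lneg R u) s"
  proof
    assume "sep (rneg R s) u"
    then obtain a where a: "a \<in> X" "a \<in> Y" "rneg R s \<preceq> a" "a \<preceq> u" unfolding sep_def by blast
    then have "\<not> a \<preceq> rneg R s" using X.le_antisym c \<open>rneg R s \<notin> Y\<close> by blast
    then have "lneg R a \<preceq> s" using a s X.le_rneg_iff_le_lneg X.lneg_comparable[of a s] by blast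
    moreover have "lneg R u \<preceq> lneg R a" using a u Y.lneg_antimono by blast
    ultimately show "sep (lneg R u) s" using a X.lneg_closed Y.lneg_closed unfolding sep_def by blast
  next
    assume "sep (lneg R u) s"
    then obtain a where a: "a \<in> X" "a \<in> Y" "lneg R u \<preceq> a" "a \<preceq> s" unfolding sep_def by blast
    then have "\<not> a \<preceq> lneg R u" using Y.le_antisym c \<open>lneg R u \<notin> X\<close> by blast
    then have "rneg R a \<preceq> u" using a u Y.le_rneg_iff_le_lneg Y.rneg_comparable[of a u] by blast
    moreover have "rneg R s \<preceq> rneg R a" using a s X.rneg_antimono by blast
    ultimately show "sep (rneg R s) u" using a X.rneg_closed Y.rneg_closed unfolding sep_def by blast
  qed
qed

lemma swap_sep: "common_carrier.sep R Y X = sep"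
proof -
  interpret s: common_carrier R Y X by (rule swap)
  show ?thesis by (simp add: fun_eq_iff sep_def s.sep_def Int_commute)
qed

text \<open>If \<open>s\<close> and \<open>u\<close> have the same sign, the unit decides both
  sides. Otherwise one side compares negative elements and the other positive ones, and the opposite
  conventions of \<open>sle\<close> in the two cones make them matching statements about
  \<open>sep\<close>, both plain or both negated, to which \<open>sep_galois\<close>
  applies.\<close>

lemma sle_galois_mixed:
  assumes s: "s \<in> X" "s \<notin> Y" "gamma R s = s" and u: "u \<in> Y" "u \<notin> X" "gamma R u = u"
  shows "u \<unlhd> rneg R s \<longleftrightarrow> s \<unlhd> lneg R u" "s \<unlhd> rneg R u \<longleftrightarrow> u \<unlhd> lneg R s"
proof -
  interpret o: common_carrier R Y X by (rule swap)
  have c: "rneg R s \<in> X" "lneg R s \<in> X" "lneg R u \<in> Y" "rneg R u \<in> Y"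
    using s u X.rneg_closed X.lneg_closed Y.lneg_closed Y.rneg_closed by blast+
  have g: "gamma R (rneg R s) = rneg R s" "gamma R (lneg R s) = lneg R s" "gamma R (lneg R u) = lneg R u"
    "gamma R (rneg R u) = rneg R u"
    using s u X.gamma_rneg X.gamma_lneg Y.gamma_lneg Y.gamma_rneg by blast+
  have n: "rneg R s \<notin> Y" "lneg R s \<notin> Y" "lneg R u \<notin> X" "rneg R u \<notin> X"
    using neg_notin o.neg_notin s u by blast+
  note ns = neg_sign[OF s] o.neg_sign[OF u]
  have sg: "\<not> sep x y" if "\<not> x \<preceq> \<one>" "y \<preceq> \<one>" "x \<in> X \<and> y \<in> Y \<or> x \<in> Y \<and> y \<in> X" for x y
    using sep_neg that by blast
  have pos: "sep x y" if "x \<preceq> \<one>" "\<not> y \<preceq> \<one>" "y \<in> X \<or> y \<in> Y" for x y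
    using sep_one that X.conic Y.conic by blast
  note sep = sep_galois[OF s u] o.sep_galois[OF u s, unfolded swap_sep]
  show "u \<unlhd> rneg R s \<longleftrightarrow> s \<unlhd> lneg R u"
    using sle_XY[OF c(1) u(1) g(1) u(3)] sle_XY(1)[OF s(1) c(3) s(3) g(3)] s u c n ns sep
      sg[of "rneg R s" u] pos[of s "lneg R u"] pos[of "rneg R s" u] sg[of s "lneg R u"]
    by (cases "s \<preceq> \<one>"; cases "u \<preceq> \<one>") simp_all
  show "s \<unlhd> rneg R u \<longleftrightarrow> u \<unlhd> lneg R s"
    using sle_XY(1)[OF s(1) c(4) s(3) g(4)] sle_XY[OF c(2) u(1) g(2) u(3)] s u c n ns sep
      sg[of "lneg R s" u] pos[of s "rneg R u"] pos[of "lneg R s" u] sg[of s "rneg R u"]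
    by (cases "s \<preceq> \<one>"; cases "u \<preceq> \<one>") simp_all
qed

lemma sle_galois:
  assumes "s \<in> skel" "u \<in> skel"
  shows "u \<unlhd> rneg R s \<longleftrightarrow> s \<unlhd> lneg R u"
proof -
  note g = skelD[OF assms(1)] skelD[OF assms(2)]
  consider "s \<in> X" "u \<in> X" | "s \<in> Y" "u \<in> Y" | "s \<in> X" "s \<notin> Y" "u \<in> Y" "u \<notin> X"
    | "u \<in> X" "u \<notin> Y" "s \<in> Y" "s \<notin> X" using g by blast
  then show ?thesis
  proof cases
    case 1
    then show ?thesis using X.le_rneg_iff_le_lneg sle_X X.lneg_closed X.rneg_closed by simp
  next
    case 2
    then show ?thesis using Y.le_rneg_iff_le_lneg sle_Y Y.lneg_closed Y.rneg_closed by simp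
  next
    case 3
    then show ?thesis using sle_galois_mixed(1) g by blast
  next
    case 4
    then show ?thesis using sle_galois_mixed(2) g by blast
  qed
qed

text \<open>A common element is neither of the two negations, nor can it lie between them, so it
  stands on the same side of both.\<close>

lemma sep_adjacent:
  assumes p: "p \<in> X" "p \<notin> Y" "gamma R p = p"
  shows "sep u (lneg R p) \<longleftrightarrow> sep u (rneg R p)" (is ?A) and "sep (lneg R p) u \<longleftrightarrow> sep (rneg R p) u" (is ?B)
proof -
  have c: "rneg R p \<in> X" "lneg R p \<in> X" using p X.rneg_closed X.lneg_closed by blast+
  have n: "rneg R p \<notin> Y" "lneg R p \<notin> Y" using neg_notin p by blast+
  have "a \<preceq> lneg R p \<longleftrightarrow> a \<preceq> rneg R p" "lneg R p \<preceq> a \<longleftrightarrow> rneg R p \<preceq> a" if a: "a \<in> X" "a \<in> Y" for a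
  proof -
    have l: "a \<preceq> lneg R p \<longleftrightarrow> \<not> lneg R p \<preceq> a" and r: "a \<preceq> rneg R p \<longleftrightarrow> \<not> rneg R p \<preceq> a"
      using a n c X.le_antisym X.lneg_comparable[OF p(1) a(1)] X.rneg_comparable[OF p(1) a(1)] by blast+
    show eq: "a \<preceq> lneg R p \<longleftrightarrow> a \<preceq> rneg R p"
      using X.lneg_rneg_adjacent[OF p(1) c(2) a(1) X.le_refl] X.rneg_lneg_adjacent[OF p(1) c(1) a(1) X.le_refl]
        l r c by blast
    show "lneg R p \<preceq> a \<longleftrightarrow> rneg R p \<preceq> a" using eq l r by blast
  qed
  then show ?A ?B
    unfolding sep_def by blast+
qed

lemma sle_adjacent:
  assumes p: "p \<in> X" "p \<notin> Y" "gamma R p = p" and u: "u \<in> Y" "u \<notin> X" "gamma R u = u"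
  shows "u \<unlhd> lneg R p \<longleftrightarrow> u \<unlhd> rneg R p" "p \<unlhd> lneg R u \<longleftrightarrow> p \<unlhd> rneg R u"
proof -
  interpret o: common_carrier R Y X by (rule swap)
  note X = X.gamma_rneg[OF p(1)] X.gamma_lneg[OF p(1)] sep_adjacent[OF p, of u] neg_sign[OF p]
  show "u \<unlhd> lneg R p \<longleftrightarrow> u \<unlhd> rneg R p"
    using sle_XY[of "rneg R p" u] sle_XY[of "lneg R p" u] u p X by simp
  note Y = Y.gamma_rneg[OF u(1)] Y.gamma_lneg[OF u(1)] o.sep_adjacent[OF u, of p, unfolded swap_sep]
    o.neg_sign[OF u]
  show "p \<unlhd> lneg R u \<longleftrightarrow> p \<unlhd> rneg R u"
    using sle_XY(1)[of p "rneg R u"] sle_XY(1)[of p "lneg R u"] u p Y by simp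
qed

lemma gap:
  assumes p: "p \<in> skel" and s: "s \<in> skel"
  shows "(\<not> lneg R p \<unlhd> rneg R p \<longrightarrow> s \<unlhd> lneg R p \<longrightarrow> s = lneg R p \<or> s \<unlhd> rneg R p) \<and>
    (\<not> rneg R p \<unlhd> lneg R p \<longrightarrow> s \<unlhd> rneg R p \<longrightarrow> s = rneg R p \<or> s \<unlhd> lneg R p)"
proof -
  note g = skelD[OF p] skelD[OF s]
  consider "p \<in> X" "s \<in> X" | "p \<in> Y" "s \<in> Y" | "p \<in> X" "p \<notin> Y" "s \<in> Y" "s \<notin> X"
    | "s \<in> X" "s \<notin> Y" "p \<in> Y" "p \<notin> X" using g by blast
  then show ?thesis
  proof cases
    case 1
    then have c: "rneg R p \<in> X" "lneg R p \<in> X" using X.rneg_closed X.lneg_closed by blast+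
    show ?thesis
      using X.lneg_rneg_adjacent[OF 1(1) c(2) 1(2) X.le_refl[OF c(2)]]
        X.rneg_lneg_adjacent[OF 1(1) c(1) 1(2) X.le_refl[OF c(1)]]
        X.le_antisym[OF _ _ 1(2) c(1)] X.le_antisym[OF _ _ 1(2) c(2)] sle_X 1 c by blast
  next
    case 2
    then have c: "rneg R p \<in> Y" "lneg R p \<in> Y" using Y.rneg_closed Y.lneg_closed by blast+
    show ?thesis
      using Y.lneg_rneg_adjacent[OF 2(1) c(2) 2(2) Y.le_refl[OF c(2)]]
        Y.rneg_lneg_adjacent[OF 2(1) c(1) 2(2) Y.le_refl[OF c(1)]]
        Y.le_antisym[OF _ _ 2(2) c(1)] Y.le_antisym[OF _ _ 2(2) c(2)] sle_Y 2 c by blast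
  next
    case 3
    then show ?thesis using sle_adjacent(1) g by blast
  next
    case 4
    then show ?thesis using sle_adjacent(2) g by blast
  qed
qed

text \<open>If \<open>s \<notin> Z\<close> then the fibre is empty and is replaced by \<open>{s}\<close>.\<close>

definition blk :: "'v set \<Rightarrow> 'v \<Rightarrow> 'v set"
  where "blk Z s = insert s {x \<in> Z. gamma R x = s}"

text \<open>The implication of a fibre with top \<open>s\<close>; it differs from the residual when \<open>x \<preceq> z\<close>, where the
  residual is the negation of \<open>x\<close>.\<close>

definition imp :: "'v \<Rightarrow> 'v \<Rightarrow> 'v \<Rightarrow> 'v"
  where "imp s x z = (if x \<preceq> z then s else x \<setminus> z)"

definition blocks :: "'v \<Rightarrow> 'v set set set"
  where "blocks s = block_pair.block (rl_le R) (meet_op R) (join_op R) s (blk X s) (blk Y s) (s \<preceq> \<one>)"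

definition pnts :: "'v \<Rightarrow> 'v set set"
  where "pnts s = block_pair.points (rl_le R) (meet_op R) (join_op R) s (blk X s) (blk Y s) (s \<preceq> \<one>)"

definition emb :: "'v \<Rightarrow> 'v \<Rightarrow> 'v set set"
  where "emb s = block_pair.pts (rl_le R) (meet_op R) (join_op R) s (blk X s) (blk Y s) (s \<preceq> \<one>)"

lemma swap_skel: "common_carrier.skel R Y X = skel"
proof -
  interpret o: common_carrier R Y X by (rule swap)
  show ?thesis by (auto simp: skel_def o.skel_def)
qed

section \<open>The fibres of the two factors and their amalgams\<close>

lemma blk_X_eq:
  assumes "s \<in> skel"
  shows "s \<in> X \<Longrightarrow> blk X s = {x \<in> X. gamma R x = s}" and "s \<notin> X \<Longrightarrow> blk X s = {s}"
  using skelD(2)[OF assms] X.gamma_closed by (auto simp: blk_def)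

lemma lattice_on_blk_X:
  assumes "s \<in> skel"
  shows "lattice_on (rl_le R) (meet_op R) (join_op R) s (blk X s)"
proof (cases "s \<in> X")
  case True
  then show ?thesis
    using X.lattice_on_block[OF X_conj, of s] skelD(2)[OF assms] blk_X_eq(1)[OF assms] by simp
next
  case False
  then show ?thesis
    using heyting_on.axioms(1)[OF Y.heyting_on_singleton[of s]] skelD(1)[OF assms] blk_X_eq(2)[OF assms] by simp
qed

lemma heyting_on_blk_X:
  assumes "s \<in> skel" "s \<preceq> \<one>"
  shows "heyting_on (rl_le R) (meet_op R) (join_op R) s (blk X s) (imp s)"
proof (cases "s \<in> X")
  case True
  then show ?thesis
    using X.heyting_on_block[OF X_conj, of s] skelD(2)[OF assms(1)] assms(2) blk_X_eq(1)[OF assms(1)]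
    by (simp add: imp_def[abs_def])
next
  case False
  then show ?thesis
    using Y.heyting_on_singleton[of s] skelD(1)[OF assms(1)] blk_X_eq(2)[OF assms(1)]
    by (simp add: imp_def[abs_def])
qed

lemma block_pair:
  assumes "s \<in> skel"
  shows "block_pair (rl_le R) (meet_op R) (join_op R) s (blk X s) (blk Y s) (imp s) (s \<preceq> \<one>)"
proof -
  interpret o: common_carrier R Y X by (rule swap)
  have "s \<in> o.skel" using assms swap_skel by simp
  then show ?thesis
    using assms
    by (intro block_pair.intro block_pair_axioms.intro lattice_on_blk_X o.lattice_on_blk_X
      heyting_on_blk_X o.heyting_on_blk_X)
qed

lemma swap_blocks:
  assumes "s \<in> skel"
  shows "common_carrier.blocks R Y X s = blocks s" and "common_carrier.emb R Y X s = emb s"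
proof -
  interpret o: common_carrier R Y X by (rule swap)
  interpret b: block_pair "rl_le R" "meet_op R" "join_op R" s "blk X s" "blk Y s" "imp s" "s \<preceq> \<one>"
    by (rule block_pair) fact
  show "o.blocks s = blocks s" "o.emb s = emb s"
    unfolding blocks_def o.blocks_def emb_def o.emb_def by (rule b.swap_block b.swap_pts)+
qed

lemma sle_one: "s \<in> skel \<Longrightarrow> s \<unlhd> \<one> \<longleftrightarrow> s \<preceq> \<one>"
  using skelD(1)[of s] sle_X sle_Y one_in by blast

lemma sle_neg_iff:
  assumes "p \<in> skel"
  shows "lneg R p \<unlhd> rneg R p \<longleftrightarrow> lneg R p \<preceq> rneg R p" "rneg R p \<unlhd> lneg R p \<longleftrightarrow> rneg R p \<preceq> lneg R p"
  using skelD(1)[OF assms] by (auto simp: sle_X sle_Y)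

text \<open>If \<open>p\<close> is in \<open>X\<close>, this is \<open>block_above_gap\<close>. If
  not, then by rigidity of \<open>Y\<close> its negations are not in \<open>X\<close> either, and
  the fibre on this side is only the padding.\<close>

lemma blk_trivial_X:
  assumes p: "p \<in> skel"
  shows "\<not> lneg R p \<preceq> rneg R p \<Longrightarrow> blk X (lneg R p) = {lneg R p}" (is "_ \<Longrightarrow> ?l")
    and "\<not> rneg R p \<preceq> lneg R p \<Longrightarrow> blk X (rneg R p) = {rneg R p}" (is "_ \<Longrightarrow> ?r")
proof -
  interpret o: common_carrier R Y X by (rule swap)
  have "?l \<and> ?r" if "p \<notin> X"
    using o.neg_notin[of p] skelD[OF p] blk_X_eq(2) neg_in_skel[OF p] that by blast
  moreover have "x = lneg R p" if "p \<in> X" "\<not> lneg R p \<preceq> rneg R p" "x \<in> X" "gamma R x = lneg R p" for x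
    using X.block_above_gap(1) that by blast
  moreover have "x = rneg R p" if "p \<in> X" "\<not> rneg R p \<preceq> lneg R p" "x \<in> X" "gamma R x = rneg R p" for x
    using X.block_above_gap(2) that by blast
  ultimately show "\<not> lneg R p \<preceq> rneg R p \<Longrightarrow> ?l" "\<not> rneg R p \<preceq> lneg R p \<Longrightarrow> ?r"
    unfolding blk_def by blast+
qed

lemma blocks_trivial:
  assumes "s \<in> skel" "blk X s = {s}" "blk Y s = {s}" "U \<in> blocks s"
  shows "U = pnts s"
proof -
  interpret b: block_pair "rl_le R" "meet_op R" "join_op R" s "blk X s" "blk Y s" "imp s" "s \<preceq> \<one>"
    by (rule block_pair) fact
  show ?thesis using b.block_trivial assms unfolding blocks_def pnts_def by blast
qed

sublocale sum: ordinal_sum skel "(\<unlhd>)" \<one> "lneg R" "rneg R" blocks pnts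
proof
  interpret o: common_carrier R Y X by (rule swap)
  fix s u p U V Z
  show "\<one> \<in> skel" using one_in X.gamma_one by (simp add: skel_def)
  show "lneg R \<one> = \<one>" "rneg R \<one> = \<one>" using X.lneg_one X.rneg_one .
  {
    assume s: "s \<in> skel"
    interpret b: block_pair "rl_le R" "meet_op R" "join_op R" s "blk X s" "blk Y s" "imp s" "s \<preceq> \<one>"
      by (rule block_pair) fact
    show "s \<unlhd> s" using sle_total s by blast
    show "lneg R s \<in> skel" "rneg R s \<in> skel" using neg_in_skel s by blast+
    show "pnts s \<in> blocks s" unfolding pnts_def blocks_def by (rule b.points_in_block)
    show "U \<in> blocks s \<Longrightarrow> U \<subseteq> pnts s" unfolding pnts_def blocks_def by (rule b.block_le_points)
    show "U \<in> blocks s \<Longrightarrow> V \<in> blocks s \<Longrightarrow> U \<inter> V \<in> blocks s" unfolding blocks_def by (rule b.block_Int)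
    show "U \<in> blocks s \<Longrightarrow> V \<in> blocks s \<Longrightarrow> \<exists>W. W \<in> blocks s \<and> (\<forall>Z\<in>blocks s. W \<subseteq> Z \<longleftrightarrow> U \<subseteq> Z \<and> V \<subseteq> Z)"
      unfolding blocks_def by (rule b.block_lub)
    show "s \<unlhd> \<one> \<Longrightarrow> U \<in> blocks s \<Longrightarrow> Z \<in> blocks s \<Longrightarrow> \<exists>W. W \<in> blocks s \<and> (\<forall>V\<in>blocks s. V \<subseteq> W \<longleftrightarrow> U \<inter> V \<subseteq> Z)"
      unfolding blocks_def using b.block_rpc sle_one[OF s] by blast
  }
  show "s \<in> skel \<Longrightarrow> u \<in> skel \<Longrightarrow> u \<unlhd> rneg R s \<longleftrightarrow> s \<unlhd> lneg R u" by (rule sle_galois)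
  assume p: "p \<in> skel"
  show "s = lneg R p \<or> s \<unlhd> rneg R p" if "s \<in> skel" "\<not> lneg R p \<unlhd> rneg R p" "s \<unlhd> lneg R p"
    using gap[OF p that(1)] that by blast
  show "s = rneg R p \<or> s \<unlhd> lneg R p" if "s \<in> skel" "\<not> rneg R p \<unlhd> lneg R p" "s \<unlhd> rneg R p"
    using gap[OF p that(1)] that by blast
  from p have p': "p \<in> o.skel" by (simp add: swap_skel)
  show "U = pnts (lneg R p)" if "\<not> lneg R p \<unlhd> rneg R p" "U \<in> blocks (lneg R p)"
    using that blocks_trivial[OF neg_in_skel(1)[OF p] blk_trivial_X(1)[OF p] o.blk_trivial_X(1)[OF p']]
      sle_neg_iff[OF p] by blast
  show "U = pnts (rneg R p)" if "\<not> rneg R p \<unlhd> lneg R p" "U \<in> blocks (rneg R p)"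
    using that blocks_trivial[OF neg_in_skel(2)[OF p] blk_trivial_X(2)[OF p] o.blk_trivial_X(2)[OF p']]
      sle_neg_iff[OF p] by blast
qed (fact sle_antisym sle_trans sle_total)+

lemma mem_blk_X: "\<lbrakk>x \<in> X; gamma R x = s\<rbrakk> \<Longrightarrow> x \<in> blk X s"
  by (simp add: blk_def)

lemma gamma_in_skel: "x \<in> X \<Longrightarrow> gamma R x \<in> skel"
  using X.gamma_closed X.gamma_idem by (simp add: skel_def)

lemma emb_in_blocks: "x \<in> X \<Longrightarrow> emb (gamma R x) x \<in> blocks (gamma R x)"
  unfolding emb_def blocks_def
  by (rule block_pair.pts_in_block[OF block_pair]) (simp_all add: gamma_in_skel mem_blk_X)

lemma emb_top:
  assumes "s \<in> skel"
  shows "emb s s = pnts s"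
proof -
  interpret b: block_pair "rl_le R" "meet_op R" "join_op R" s "blk X s" "blk Y s" "imp s" "s \<preceq> \<one>"
    by (rule block_pair) fact
  show ?thesis unfolding emb_def pnts_def by (rule b.pts_top)
qed

lemma emb_props:
  assumes x: "x \<in> X" "gamma R x = s" and y: "y \<in> X" "gamma R y = s"
  shows "emb s x \<subseteq> emb s y \<longleftrightarrow> x \<preceq> y"
    and "emb s (x \<curlywedge> y) = emb s x \<inter> emb s y"
    and "\<lbrakk>Z \<in> blocks s; emb s x \<subseteq> Z; emb s y \<subseteq> Z\<rbrakk> \<Longrightarrow> emb s (x \<curlyvee> y) \<subseteq> Z"
    and "\<lbrakk>Z \<in> blocks s; s \<preceq> \<one>; \<not> x \<preceq> y\<rbrakk> \<Longrightarrow> Z \<subseteq> emb s (x \<setminus> y) \<longleftrightarrow> emb s x \<inter> Z \<subseteq> emb s y"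
proof -
  have "s \<in> skel" using gamma_in_skel x by blast
  then interpret b: block_pair "rl_le R" "meet_op R" "join_op R" s "blk X s" "blk Y s" "imp s" "s \<preceq> \<one>"
    by (rule block_pair)
  have m: "x \<in> blk X s" "y \<in> blk X s" using x y mem_blk_X by blast+
  show "emb s x \<subseteq> emb s y \<longleftrightarrow> x \<preceq> y" "emb s (x \<curlywedge> y) = emb s x \<inter> emb s y"
    unfolding emb_def using b.pts_le_iff m b.pts_m by blast+
  show "\<lbrakk>Z \<in> blocks s; emb s x \<subseteq> Z; emb s y \<subseteq> Z\<rbrakk> \<Longrightarrow> emb s (x \<curlyvee> y) \<subseteq> Z"
    unfolding emb_def blocks_def by (rule b.pts_j_le[OF m])
  show "\<lbrakk>Z \<in> blocks s; s \<preceq> \<one>; \<not> x \<preceq> y\<rbrakk> \<Longrightarrow> Z \<subseteq> emb s (x \<setminus> y) \<longleftrightarrow> emb s x \<inter> Z \<subseteq> emb s y"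
    using b.pts_i[OF _ m, of Z] unfolding emb_def blocks_def by (simp add: imp_def)
qed

text \<open>One map serves both factors, so it agrees on the common part by construction.\<close>

definition amalg :: "'v \<Rightarrow> 'v \<times> 'v set set"
  where "amalg x = (gamma R x, emb (gamma R x) x)"

lemma embedding_X: "rl_embedding (R\<lparr>carrier := X\<rparr>) sum.alg amalg"
proof -
  have "rl_embedding (R\<lparr>carrier := X\<rparr>) sum.alg (\<lambda>x. (gamma (R\<lparr>carrier := X\<rparr>) x, emb (gamma (R\<lparr>carrier := X\<rparr>) x) x))"
    by (rule sum.embedding_into_sum[OF X_conic X_conj])
      (simp_all add: skel_def emb_top sle_X emb_in_blocks emb_props)
  then show ?thesis by (simp add: amalg_def[abs_def])
qed

lemma embedding_Y: "rl_embedding (R\<lparr>carrier := Y\<rparr>) sum.alg amalg"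
proof -
  interpret o: common_carrier R Y X by (rule swap)
  have sk: "gamma R x \<in> skel" if "x \<in> Y" for x using o.gamma_in_skel[OF that] by (simp add: swap_skel)
  have in_b: "emb (gamma R x) x \<in> blocks (gamma R x)" if "x \<in> Y" for x
    using o.emb_in_blocks[OF that] sk[OF that] by (simp add: swap_blocks)
  have props: "emb s x \<subseteq> emb s y \<longleftrightarrow> x \<preceq> y"
    "emb s (x \<curlywedge> y) = emb s x \<inter> emb s y"
    "\<lbrakk>Z \<in> blocks s; emb s x \<subseteq> Z; emb s y \<subseteq> Z\<rbrakk> \<Longrightarrow> emb s (x \<curlyvee> y) \<subseteq> Z"
    "\<lbrakk>Z \<in> blocks s; s \<preceq> \<one>; \<not> x \<preceq> y\<rbrakk> \<Longrightarrow> Z \<subseteq> emb s (x \<setminus> y) \<longleftrightarrow> emb s x \<inter> Z \<subseteq> emb s y"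
    if "x \<in> Y" "gamma R x = s" "y \<in> Y" "gamma R y = s" for x y s Z
    using o.emb_props[OF that] sk[OF that(1)] that(2) by (simp_all add: swap_blocks)
  have "rl_embedding (R\<lparr>carrier := Y\<rparr>) sum.alg (\<lambda>x. (gamma (R\<lparr>carrier := Y\<rparr>) x, emb (gamma (R\<lparr>carrier := Y\<rparr>) x) x))"
    by (rule sum.embedding_into_sum[OF Y_conic Y_conj])
      (simp_all add: skel_def emb_top sle_Y in_b props)
  then show ?thesis by (simp add: amalg_def[abs_def])
qed

lemma amalg_eq:
  assumes "x \<in> X" "y \<in> Y" "amalg x = amalg y"
  shows "x = y"
proof -
  let ?s = "gamma R x"
  have "gamma R x = gamma R y" "emb (gamma R x) x = emb (gamma R y) y"
    using assms(3) unfolding amalg_def by blast+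
  then have s: "gamma R y = ?s" "emb ?s x = emb ?s y" by metis+
  interpret b: block_pair "rl_le R" "meet_op R" "join_op R" ?s "blk X ?s" "blk Y ?s" "imp ?s" "?s \<preceq> \<one>"
    by (rule block_pair) (rule gamma_in_skel[OF assms(1)])
  show ?thesis
    using b.pts_eq_imp_eq[of x y] s assms(1,2) by (simp add: emb_def blk_def)
qed

lemma rigid_sum_alg: "rigid sum.alg"
proof (rule sum.rigid_sum)
  fix s assume s: "s \<in> skel"
  show "star R s = (if lneg R s \<unlhd> rneg R s then lneg R s else rneg R s)"
    using sle_neg_iff[OF s] skelD(1)[OF s] X.star_cases[of s] Y.star_cases[of s]
      X.lneg_comparable[of s "rneg R s"] Y.lneg_comparable[of s "rneg R s"] by auto
  show "star R (star R (rneg R s)) = rneg R s" "star R (star R (lneg R s)) = lneg R s"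
    using skelD(1)[OF s] X_rigid Y_rigid unfolding rigid_def by auto
qed

end

section \<open>The strong amalgamation property\<close>

text \<open>Membership in the class at an arbitrary type: the amalgam is first built on pairs of a
  skeleton element and a set of points, and only later moved into the given universe.\<close>

definition rigid_conjunctive :: "('a, 'm) residuated_lattice_scheme \<Rightarrow> bool"
  where "rigid_conjunctive A \<longleftrightarrow> conic_idempotent_residuated_lattice A \<and> rigid A \<and> conjunctive A"

lemma rigid_conjunctive_isomorphic:
  fixes A (structure)
  assumes A: "rigid_conjunctive A" and f: "rl_embedding A B f" "f ` carrier A = carrier B"
  shows "rigid_conjunctive B"
proof -
  interpret A: conic_idempotent_residuated_lattice A using A by (simp add: rigid_conjunctive_def)
  have c: "carrier B = f ` carrier A" using f by simp
  have one: "\<one>\<^bsub>B\<^esub> = f \<one>" using f by (simp add: rl_embedding_def)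
  have ops: "f x \<otimes>\<^bsub>B\<^esub> f y = f (x \<otimes> y)" "f x \<curlywedge>\<^bsub>B\<^esub> f y = f (x \<curlywedge> y)"
    "f x \<curlyvee>\<^bsub>B\<^esub> f y = f (x \<curlyvee> y)" "f x \<setminus>\<^bsub>B\<^esub> f y = f (x \<setminus> y)" "f x \<sslash>\<^bsub>B\<^esub> f y = f (x \<sslash> y)"
    if "x \<in> carrier A" "y \<in> carrier A" for x y
    using f that by (simp_all add: rl_embedding_def)
  have eq: "f x = f y \<longleftrightarrow> x = y" if "x \<in> carrier A" "y \<in> carrier A" for x y
    using f that unfolding rl_embedding_def by (blast dest: inj_onD)
  have le: "f x \<preceq>\<^bsub>B\<^esub> f y \<longleftrightarrow> x \<preceq> y" if "x \<in> carrier A" "y \<in> carrier A" for x y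
    using that by (simp add: rl_le_def ops eq)
  have "conic_idempotent_residuated_lattice B"
    by unfold_locales (auto simp: c one ops eq le A.m_assoc A.meet_assoc A.join_assoc
      A.meet_join_absorb A.join_meet_absorb A.under_residual A.over_residual
      A.mult_idem A.conic, auto simp: A.meet_comm A.join_comm dest: A.conic)
  moreover have neg: "rneg B (f x) = f (rneg A x)" "lneg B (f x) = f (lneg A x)" if "x \<in> carrier A" for x
    using that by (simp_all add: rneg_def lneg_def one ops)
  have star: "star B (f x) = f (star A x)" "gamma B (f x) = f (gamma A x)" if "x \<in> carrier A" for x
    using that by (simp_all add: star_def gamma_def neg ops)
  have "rigid B"
    using A unfolding rigid_conjunctive_def rigid_def c
    by (auto simp: neg star)
  moreover have "conjunctive B"
    using A unfolding rigid_conjunctive_def conjunctive_def c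
    by (auto simp: star ops)
  ultimately show ?thesis by (simp add: rigid_conjunctive_def)
qed

lemma rl_embedding_comp:
  assumes "rl_embedding A B f" "rl_embedding B C g"
  shows "rl_embedding A C (g \<circ> f)"
proof -
  have "f x \<in> carrier B" if "x \<in> carrier A" for x using assms that by (auto simp: rl_embedding_def)
  moreover have "inj_on (g \<circ> f) (carrier A)"
    using assms unfolding rl_embedding_def by (meson comp_inj_on inj_on_subset)
  ultimately show ?thesis using assms unfolding rl_embedding_def by (auto simp: image_comp[symmetric])
qed

section \<open>Generated subalgebras, their cardinality, and transport into the universe\<close>

definition rl_ops :: "('a, 'm) residuated_lattice_scheme \<Rightarrow> ('a \<Rightarrow> 'a \<Rightarrow> 'a) set"
  where "rl_ops A = {mult A, meet_op A, join_op A, under A, over A}"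

lemma finite_rl_ops: "finite (rl_ops A)"
  by (simp add: rl_ops_def)

lemma (in residuated_lattice) rl_ops_closed:
  "\<lbrakk>f \<in> rl_ops A; x \<in> carrier A; y \<in> carrier A\<rbrakk> \<Longrightarrow> f x y \<in> carrier A"
  by (auto simp: rl_ops_def)

lemma rigid_conjunctive_subalgebra:
  assumes A: "rigid_conjunctive A" and G: "G \<subseteq> carrier A" "\<one>\<^bsub>A\<^esub> \<in> G"
    and cl: "\<And>f x y. \<lbrakk>f \<in> rl_ops A; x \<in> G; y \<in> G\<rbrakk> \<Longrightarrow> f x y \<in> G"
  shows "rigid_conjunctive (A\<lparr>carrier := G\<rparr>)"
proof -
  interpret A: conic_idempotent_residuated_lattice A using A by (simp add: rigid_conjunctive_def)
  have c: "x \<in> G \<Longrightarrow> x \<in> carrier A" for x using G by blast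
  have "conic_idempotent_residuated_lattice (A\<lparr>carrier := G\<rparr>)"
    by unfold_locales (auto simp: c G(2) cl rl_ops_def A.m_assoc
      A.meet_assoc A.join_assoc A.meet_join_absorb A.join_meet_absorb A.under_residual A.over_residual
      A.mult_idem A.conic, auto simp: c A.meet_comm A.join_comm)
  then show ?thesis
    using A c by (simp add: rigid_conjunctive_def rigid_def conjunctive_def)
qed

text \<open>Each closure step applies finitely many binary operations, and countably many steps
  suffice; neither exceeds an infinite cardinal bound.\<close>

lemma closure_card_ordLeq:
  fixes F :: "('a \<Rightarrow> 'a \<Rightarrow> 'a) set" and U :: "'u set"
  assumes U: "infinite U" and Z: "(card_of Z, card_of U) \<in> ordLeq" and F: "finite F" and ZC: "Z \<subseteq> C"
    and cl: "\<And>f x y. \<lbrakk>f \<in> F; x \<in> C; y \<in> C\<rbrakk> \<Longrightarrow> f x y \<in> C"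
  obtains G where "Z \<subseteq> G" "G \<subseteq> C" "\<And>f x y. \<lbrakk>f \<in> F; x \<in> G; y \<in> G\<rbrakk> \<Longrightarrow> f x y \<in> G"
    "(card_of G, card_of U) \<in> ordLeq"
proof -
  define step where "step V = V \<union> (\<Union>f\<in>F. (\<lambda>(x, y). f x y) ` (V \<times> V))" for V
  define G where "G n = (step ^^ n) Z" for n
  have G_Suc: "G (Suc n) = step (G n)" for n by (simp add: G_def)
  have UF: "infinite (Field (card_of U))" using U by (simp add: Field_card_of)
  have card_step: "(card_of (step V), card_of U) \<in> ordLeq" if V: "(card_of V, card_of U) \<in> ordLeq" for V
  proof -
    have "(card_of (V \<times> V), card_of U) \<in> ordLeq"
      using card_of_Times_ordLeq_infinite_Field[OF UF V V card_of_Card_order] .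
    then have "\<forall>f\<in>F. (card_of ((\<lambda>(x, y). f x y) ` (V \<times> V)), card_of U) \<in> ordLeq"
      using ordLeq_transitive[OF card_of_image] by blast
    moreover have "(card_of F, card_of U) \<in> ordLeq"
      using F UF by (intro ordLess_imp_ordLeq finite_ordLess_infinite card_of_Well_order)
        (simp_all add: Field_card_of)
    ultimately show ?thesis
      unfolding step_def
      by (intro card_of_Un_ordLeq_infinite_Field[OF UF V _ card_of_Card_order]
        card_of_UNION_ordLeq_infinite[OF U])
  qed
  have "(card_of (G n), card_of U) \<in> ordLeq" for n
    by (induction n) (simp_all add: Z card_step G_Suc, simp add: G_def Z)
  moreover have "(card_of (UNIV :: nat set), card_of U) \<in> ordLeq"
    using U infinite_iff_card_of_nat by blast
  ultimately have card: "(card_of (\<Union>n. G n), card_of U) \<in> ordLeq"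
    using card_of_UNION_ordLeq_infinite[OF U] by blast
  have sub: "G n \<subseteq> C" for n
  proof (induction n)
    case 0
    then show ?case using ZC by (simp add: G_def)
  next
    case (Suc n)
    then have "f x y \<in> C" if "f \<in> F" "x \<in> G n" "y \<in> G n" for f x y
      using cl[OF that(1)] that by blast
    then show ?case using Suc by (auto simp: G_Suc step_def)
  qed
  have "G n \<subseteq> G (Suc n)" for n by (auto simp: G_Suc step_def)
  then have mono: "G n \<subseteq> G k" if "n \<le> k" for n k using lift_Suc_mono_le[of G] that by blast
  have "f x y \<in> (\<Union>n. G n)" if f: "f \<in> F" and xy: "x \<in> (\<Union>n. G n)" "y \<in> (\<Union>n. G n)" for f x y
  proof -
    obtain k l where "x \<in> G k" "y \<in> G l" using xy by blast
    then have "x \<in> G (max k l)" "y \<in> G (max k l)" using mono[of k "max k l"] mono[of l "max k l"] by auto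
    then have "f x y \<in> G (Suc (max k l))" using f by (force simp: G_Suc step_def)
    then show ?thesis by blast
  qed
  moreover have "Z \<subseteq> (\<Union>n. G n)" using UN_upper[of 0 UNIV G] by (simp add: G_def)
  ultimately show ?thesis using that card sub by blast
qed

definition transport :: "('a \<Rightarrow> 'b) \<Rightarrow> ('a, 'm) residuated_lattice_scheme \<Rightarrow> 'b residuated_lattice"
  where "transport h A =
    (let lift = (\<lambda>f p q. h (f (inv_into (carrier A) h p) (inv_into (carrier A) h q)))
     in \<lparr>carrier = h ` carrier A, mult = lift (mult A), one = h \<one>\<^bsub>A\<^esub>, meet_op = lift (meet_op A),
       join_op = lift (join_op A), under = lift (under A), over = lift (over A)\<rparr>)"

lemma rl_embedding_transport:
  "inj_on h (carrier A) \<Longrightarrow> rl_embedding A (transport h A) h"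
  "carrier (transport h A) = h ` carrier A"
  by (simp_all add: rl_embedding_def transport_def Let_def)

lemma common_carrier_amalgam:
  fixes R :: "'v residuated_lattice"
  assumes X: "rigid_conjunctive (R\<lparr>carrier := X\<rparr>)" and Y: "rigid_conjunctive (R\<lparr>carrier := Y\<rparr>)"
    and U: "infinite (UNIV :: 'u set)" "(card_of (X \<union> Y), card_of (UNIV :: 'u set)) \<in> ordLeq"
  shows "\<exists>(D :: 'u residuated_lattice) g. rigid_conjunctive D \<and> rl_embedding (R\<lparr>carrier := X\<rparr>) D g \<and>
    rl_embedding (R\<lparr>carrier := Y\<rparr>) D g \<and> (\<forall>x\<in>X. \<forall>y\<in>Y. g x = g y \<longrightarrow> x = y)"
proof -
  interpret common_carrier R X Y
    using X Y by (simp add: common_carrier_def rigid_conjunctive_def)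
  have D: "rigid_conjunctive sum.alg"
    by (simp add: rigid_conjunctive_def sum.alg_conic_idempotent rigid_sum_alg sum.conjunctive_alg)
  let ?Z = "amalg ` (X \<union> Y)"
  have Z: "?Z \<subseteq> carrier sum.alg"
    using embedding_X embedding_Y unfolding rl_embedding_def by auto
  have cZ: "(card_of ?Z, card_of (UNIV :: 'u set)) \<in> ordLeq"
    using ordLeq_transitive[OF card_of_image U(2)] .
  obtain G where G: "?Z \<subseteq> G" "G \<subseteq> carrier sum.alg"
    and cl: "\<And>f x y. \<lbrakk>f \<in> rl_ops sum.alg; x \<in> G; y \<in> G\<rbrakk> \<Longrightarrow> f x y \<in> G"
    and card: "(card_of G, card_of (UNIV :: 'u set)) \<in> ordLeq"
    using closure_card_ordLeq[OF U(1) cZ finite_rl_ops[of sum.alg] Z] sum.alg.rl_ops_closed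
    by metis
  let ?G = "sum.alg\<lparr>carrier := G\<rparr>"
  have "amalg \<one>\<^bsub>R\<^esub> = \<one>\<^bsub>sum.alg\<^esub>" using embedding_X by (simp add: rl_embedding_def)
  then have "\<one>\<^bsub>sum.alg\<^esub> \<in> G" using G(1) one_in by (metis UnI1 image_subset_iff)
  then have sub: "rigid_conjunctive ?G"
    by (rule rigid_conjunctive_subalgebra[OF D G(2)]) (rule cl)
  obtain h :: "_ \<Rightarrow> 'u" where h: "inj_on h G" using card card_of_ordLeq[of G "UNIV :: 'u set"] by blast
  then have hG: "rl_embedding ?G (transport h ?G) h" using rl_embedding_transport(1)[of h ?G] by simp
  have "rigid_conjunctive (transport h ?G)"
    using rigid_conjunctive_isomorphic[OF sub hG] rl_embedding_transport(2)[of h ?G] by simp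
  moreover have "rl_embedding (R\<lparr>carrier := X\<rparr>) ?G amalg" "rl_embedding (R\<lparr>carrier := Y\<rparr>) ?G amalg"
    using embedding_X embedding_Y G(1) by (simp_all add: rl_embedding_def image_Un)
  then have "rl_embedding (R\<lparr>carrier := X\<rparr>) (transport h ?G) (h \<circ> amalg)"
    "rl_embedding (R\<lparr>carrier := Y\<rparr>) (transport h ?G) (h \<circ> amalg)"
    using rl_embedding_comp hG by blast+
  moreover have "x = y" if "x \<in> X" "y \<in> Y" "(h \<circ> amalg) x = (h \<circ> amalg) y" for x y
    using that amalg_eq inj_onD[OF h, of "amalg x" "amalg y"] G(1) by auto
  ultimately show ?thesis by blast
qed

theorem theorem5p8:
  assumes "infinite (UNIV :: 'u set)"
  shows "strong_amalgamation_property
    (rigid_conjunctive_conic_idempotent_RLs :: 'u residuated_lattice set)"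
  unfolding strong_amalgamation_property_def
proof (intro ballI allI impI, elim conjE)
  fix A B C :: "'u residuated_lattice" and fB fC
  assume "A \<in> rigid_conjunctive_conic_idempotent_RLs" "B \<in> rigid_conjunctive_conic_idempotent_RLs"
    "C \<in> rigid_conjunctive_conic_idempotent_RLs"
  then have A: "rigid_conjunctive A" and B: "rigid_conjunctive B" and C: "rigid_conjunctive C"
    by (simp_all add: rigid_conjunctive_conic_idempotent_RLs_def rigid_conjunctive_def)
  assume fB: "rl_embedding A B fB" and fC: "rl_embedding A C fC"
  interpret A: conic_idempotent_residuated_lattice A using A by (simp add: rigid_conjunctive_def)
  have inj: "inj_on fB (carrier A)" "inj_on fC (carrier A)"
    and im: "fB ` carrier A \<subseteq> carrier B" "fC ` carrier A \<subseteq> carrier C"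
    using fB fC by (simp_all add: rl_embedding_def)
  \<comment> \<open>\<open>B\<close> is copied by \<open>Inl\<close>. An element of \<open>C\<close>
    that comes from \<open>A\<close> is renamed to the copy of its counterpart in \<open>B\<close>,
    the others go to \<open>Inr\<close>; so the copies \<open>X\<close> and \<open>Y\<close> meet
    exactly in the image of \<open>A\<close>.\<close>
  define hC :: "'u \<Rightarrow> 'u + 'u" where
    "hC c = (if c \<in> fC ` carrier A then Inl (fB (inv_into (carrier A) fC c)) else Inr c)" for c
  have hC: "hC (fC a) = Inl (fB a)" if "a \<in> carrier A" for a using that inj by (simp add: hC_def)
  have hC_Inl: "\<exists>a\<in>carrier A. c = fC a \<and> b = fB a" if "hC c = Inl b" for b c
    using that hC by (auto simp: hC_def split: if_splits)
  have inj_hC: "inj_on hC (carrier C)"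
  proof (rule inj_onI)
    fix c d assume "hC c = hC d"
    then show "c = d"
      using hC_Inl[of c] hC_Inl[of d] inj by (cases "hC c") (auto simp: hC_def inj_on_eq_iff split: if_splits)
  qed
  define X :: "('u + 'u) set" where "X = Inl ` carrier B"
  define Y where "Y = hC ` carrier C"
  \<comment> \<open>On common elements both branches agree, as \<open>glue_C\<close> shows. When the
    arguments do not lie together in \<open>X\<close> or in \<open>Y\<close>, the value is
    arbitrary: the glued structure is only ever restricted to one of the two.\<close>
  define glue :: "('u \<Rightarrow> 'u \<Rightarrow> 'u) \<Rightarrow> ('u \<Rightarrow> 'u \<Rightarrow> 'u) \<Rightarrow> 'u + 'u \<Rightarrow> 'u + 'u \<Rightarrow> 'u + 'u" where
    "glue f g p q = (if p \<in> X \<and> q \<in> X then Inl (f (projl p) (projl q))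
      else hC (g (inv_into (carrier C) hC p) (inv_into (carrier C) hC q)))" for f g p q
  define R where "R = \<lparr>carrier = X \<union> Y, mult = glue (mult B) (mult C), one = Inl \<one>\<^bsub>B\<^esub>,
    meet_op = glue (meet_op B) (meet_op C), join_op = glue (join_op B) (join_op C),
    under = glue (under B) (under C), over = glue (over B) (over C)\<rparr>"
  have glue_B: "glue f g (Inl x) (Inl y) = Inl (f x y)" if "x \<in> carrier B" "y \<in> carrier B" for f g x y
    using that by (simp add: glue_def X_def)
  have glue_C: "glue f g (hC x) (hC y) = hC (g x y)" if xy: "x \<in> carrier C" "y \<in> carrier C"
    and fg: "\<And>a b. \<lbrakk>a \<in> carrier A; b \<in> carrier A\<rbrakk>
      \<Longrightarrow> k a b \<in> carrier A \<and> f (fB a) (fB b) = fB (k a b) \<and> g (fC a) (fC b) = fC (k a b)" for f g k x y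
  proof (cases "hC x \<in> X \<and> hC y \<in> X")
    case True
    then have "isl (hC x)" "isl (hC y)" by (auto simp: X_def)
    then have "hC x = Inl (projl (hC x))" "hC y = Inl (projl (hC y))" by simp_all
    from hC_Inl[OF this(1)] hC_Inl[OF this(2)]
    obtain a b where "a \<in> carrier A" "x = fC a" "b \<in> carrier A" "y = fC b" by (elim bexE conjE)
    then show ?thesis using True fg[of a b] by (simp add: glue_def hC)
  next
    case False
    have "glue f g (hC x) (hC y) = hC (g (inv_into (carrier C) hC (hC x)) (inv_into (carrier C) hC (hC y)))"
      unfolding glue_def by (rule if_not_P[OF False])
    then show ?thesis using xy inj_hC by simp
  qed
  have BX: "rl_embedding B (R\<lparr>carrier := X\<rparr>) Inl"
    using glue_B by (simp add: rl_embedding_def R_def X_def)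
  have "fB \<one>\<^bsub>A\<^esub> = \<one>\<^bsub>B\<^esub>" "fC \<one>\<^bsub>A\<^esub> = \<one>\<^bsub>C\<^esub>" using fB fC by (simp_all add: rl_embedding_def)
  then have "hC \<one>\<^bsub>C\<^esub> = Inl \<one>\<^bsub>B\<^esub>" using hC[of "\<one>\<^bsub>A\<^esub>"] by simp
  moreover have "glue (mult B) (mult C) (hC x) (hC y) = hC (x \<otimes>\<^bsub>C\<^esub> y)"
    "glue (meet_op B) (meet_op C) (hC x) (hC y) = hC (x \<curlywedge>\<^bsub>C\<^esub> y)"
    "glue (join_op B) (join_op C) (hC x) (hC y) = hC (x \<curlyvee>\<^bsub>C\<^esub> y)"
    "glue (under B) (under C) (hC x) (hC y) = hC (x \<setminus>\<^bsub>C\<^esub> y)"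
    "glue (over B) (over C) (hC x) (hC y) = hC (x \<sslash>\<^bsub>C\<^esub> y)"
    if xy: "x \<in> carrier C" "y \<in> carrier C" for x y
    using glue_C[OF xy, of "mult A"] glue_C[OF xy, of "meet_op A"] glue_C[OF xy, of "join_op A"]
      glue_C[OF xy, of "under A"] glue_C[OF xy, of "over A"] fB fC
    by (simp_all add: rl_embedding_def)
  ultimately have CY: "rl_embedding C (R\<lparr>carrier := Y\<rparr>) hC"
    using inj_hC by (simp add: rl_embedding_def R_def Y_def)
  have RX: "rigid_conjunctive (R\<lparr>carrier := X\<rparr>)"
    using rigid_conjunctive_isomorphic[OF B BX] by (simp add: X_def)
  have RY: "rigid_conjunctive (R\<lparr>carrier := Y\<rparr>)"
    using rigid_conjunctive_isomorphic[OF C CY] by (simp add: Y_def)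
  have "(card_of (X \<union> Y), card_of (UNIV :: 'u set)) \<in> ordLeq"
    unfolding X_def Y_def
    using assms
    by (intro card_of_Un_ordLeq_infinite_Field card_of_Card_order ordLeq_transitive[OF card_of_image]
      card_of_mono1 subset_UNIV) (simp add: Field_card_of)
  then obtain D :: "'u residuated_lattice" and g where D: "rigid_conjunctive D"
    "rl_embedding (R\<lparr>carrier := X\<rparr>) D g" "rl_embedding (R\<lparr>carrier := Y\<rparr>) D g"
    and strong: "\<And>x y. \<lbrakk>x \<in> X; y \<in> Y; g x = g y\<rbrakk> \<Longrightarrow> x = y"
    using common_carrier_amalgam[OF RX RY assms] by blast
  define gB where "gB = g \<circ> Inl"
  define gC where "gC = g \<circ> hC"
  have D_in: "D \<in> rigid_conjunctive_conic_idempotent_RLs"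
    using D(1) by (simp add: rigid_conjunctive_conic_idempotent_RLs_def rigid_conjunctive_def)
  have emb: "rl_embedding B D gB" "rl_embedding C D gC"
    unfolding gB_def gC_def using rl_embedding_comp BX CY D(2,3) by blast+
  have agree: "gB (fB x) = gC (fC x)" if "x \<in> carrier A" for x
    using hC[OF that] by (simp add: gB_def gC_def)
  have strong': "(gB \<circ> fB) ` carrier A = gB ` carrier B \<inter> gC ` carrier C"
  proof
    show "(gB \<circ> fB) ` carrier A \<subseteq> gB ` carrier B \<inter> gC ` carrier C"
    proof (rule image_subsetI)
      fix x assume x: "x \<in> carrier A"
      have "gB (fB x) \<in> gB ` carrier B" "gC (fC x) \<in> gC ` carrier C" using x im by blast+
      then show "(gB \<circ> fB) x \<in> gB ` carrier B \<inter> gC ` carrier C" by (simp add: agree[OF x])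
    qed
    show "gB ` carrier B \<inter> gC ` carrier C \<subseteq> (gB \<circ> fB) ` carrier A"
    proof
      fix d assume "d \<in> gB ` carrier B \<inter> gC ` carrier C"
      then obtain b c where bc: "b \<in> carrier B" "c \<in> carrier C" "d = gB b" "d = gC c" by blast
      \<comment> \<open>Elements of \<open>X\<close> and \<open>Y\<close> with the same image are
        equal, so \<open>c\<close> was renamed to a copy from \<open>B\<close> and thus comes from
        \<open>A\<close>.\<close>
      then have "hC c = Inl b" using strong[of "Inl b" "hC c"] by (auto simp: X_def Y_def gB_def gC_def)
      then obtain a where "a \<in> carrier A" "b = fB a" using hC_Inl by blast
      then show "d \<in> (gB \<circ> fB) ` carrier A" using bc(3) by simp
    qed
  qed
  show "\<exists>D\<in>(rigid_conjunctive_conic_idempotent_RLs :: 'u residuated_lattice set). \<exists>gB gC.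
      rl_embedding B D gB \<and> rl_embedding C D gC \<and> (\<forall>x\<in>carrier A. gB (fB x) = gC (fC x)) \<and>
      (gB \<circ> fB) ` carrier A = gB ` carrier B \<inter> gC ` carrier C"
    using D_in emb agree strong' by blast
qed

end
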